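(* For every $n\ge1$, $$\sum_{\sigma\in\operatorname{rev}(NC_{B_n})}q^{\operatorname{fmaj}(\sigma)+\operatorname{ifmaj}(\sigma)}\;=\;\sum_{\sigma\in\operatorname{Sort}_{B_n}}q^{\operatorname{fmaj}(\sigma)+\operatorname{ifmaj}(\sigma)}\;=\;\begin{bmatrix}2n\\ n\end{bmatrix}_{q^2}.$$
   Context: **Signed permutations.** $B_n$ is the group of bijections $\sigma$ of $\{\pm1,\dots,\pm n\}$ with $\sigma_{-i}=-\sigma_i$, written $\sigma=[\sigma_1,\dots,\sigma_n]$. Let $\operatorname{neg}(\sigma)=|\{1\le i\le n:\sigma_i<0\}|$; with $\sigma_0:=0$, $\operatorname{fDes}(\sigma)=\{0\le i<n:\sigma_i>\sigma_{i+1}\}$ (usual order of integers); $\operatorname{fmaj}(\sigma)=2\sum_{i\in\operatorname{fDes}(\sigma)}i+\operatorname{neg}(\sigma)$; $\operatorname{ifmaj}(\sigma)=\operatorname{fmaj}(\sigma^{-1})$. Let $s_0=(1,-1)$ interchange $1$ and $-1$, and for $1\le i<n$ let $s_i$ interchange $i,i+1$ (and $-i,-(i+1)$). **Reverse noncrossing partitions.** A set partition of type $B_n$ is a set partition of $\{\pm1,\dots,\pm n\}$ such that $B$ is a block iff $-B$ is. It is sent to the signed permutation whose cycles are its blocks written in increasing order with respect to the order $-1<-2<\dots<-n<1<2<\dots<n$. A set partition of a totally ordered set is noncrossing if there are no $a<b<c<d$ with $a,c$ in one block and $b,d$ in another. $NC_{B_n}\subseteq B_n$ is the set of signed permutations coming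 from the type $B_n$ set partitions that are noncrossing with respect to the order $-1<-2<\dots<-n<1<2<\dots<n$. The involution $\operatorname{rev}$ on $B_n$ reverses the order of the negative entries in the one-line notation, keeping the set of their positions and all positive entries fixed (e.g. $\operatorname{rev}([2,-4,3,-1])=[2,-1,3,-4]$), and $\operatorname{rev}(NC_{B_n})=\{\operatorname{rev}(\sigma):\sigma\in NC_{B_n}\}$; equivalently, these are the signed permutations coming (by the same embedding) from the type $B_n$ set partitions that are noncrossing with respect to the standard order $-n<\dots<-1<1<\dots<n$. **Sortable elements.** $\operatorname{Sort}_{B_n}\subseteq B_n$ is the set of signed permutations having a reduced expression (a product of generators $s_0,\dots,s_{n-1}$ of minimal possible length) of the form $X_1X_2\cdots X_n$, where each $X_\ell$ is a (possibly empty) subword of $s_{n-1}\cdots s_1s_0$ and every generator occurring in $X_{\ell+1}$ also occurs in $X_\ell$. **$q$-notation.** $[k]_q=1+q+\dots+q^{k-1}$, $[k]_q!=[1]_q\cdots[k]_q$, $\begin{bmatrix}k\\ l\end{bmatrix}_q=\frac{[k]_q!}{[l]_q![k-l]_q!}$, and $\begin{bmatrix}k\\ l\end{bmatrix}_{q^2}$ denotes the result of replacing $q$ by $q^2$. *)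

theory Defs
  imports
    "HOL-Combinatorics.Combinatorics"
    "HOL-Library.Disjoint_Sets"
    "HOL-Library.Sublist"
    "HOL-Computational_Algebra.Polynomial"
begin

definition signed_range :: "nat \<Rightarrow> int set" where
  "signed_range n = {- int n..int n} - {0}"

text \<open>
  Signed permutations are functions on all integers that are the identity outside
  \<open>{\<plusminus>1,\<dots>,\<plusminus>n}\<close>. In particular they send 0 to 0, which is the convention used in the
  descent set below.
\<close>

definition signed_perms :: "nat \<Rightarrow> (int \<Rightarrow> int) set" where
  "signed_perms n = {\<sigma>. \<sigma> permutes signed_range n \<and> (\<forall>i. \<sigma> (- i) = - \<sigma> i)}"

definition neg :: "nat \<Rightarrow> (int \<Rightarrow> int) \<Rightarrow> nat" where
  "neg n \<sigma> = card {i \<in> {1..int n}. \<sigma> i < 0}"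

definition fDes :: "nat \<Rightarrow> (int \<Rightarrow> int) \<Rightarrow> nat set" where
  "fDes n \<sigma> = {i. i < n \<and> \<sigma> (int i) > \<sigma> (int (i + 1))}"

definition fmaj :: "nat \<Rightarrow> (int \<Rightarrow> int) \<Rightarrow> nat" where
  "fmaj n \<sigma> = 2 * (\<Sum>i\<in>fDes n \<sigma>. i) + neg n \<sigma>"

definition ifmaj :: "nat \<Rightarrow> (int \<Rightarrow> int) \<Rightarrow> nat" where
  "ifmaj n \<sigma> = fmaj n (inv \<sigma>)"


section \<open>Noncrossing partitions of type B\<close>

definition type_B_partition :: "nat \<Rightarrow> int set set \<Rightarrow> bool" where
  "type_B_partition n P \<longleftrightarrow>
     partition_on (signed_range n) P \<and> (\<forall>B. B \<in> P \<longleftrightarrow> uminus ` B \<in> P)"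

text \<open>The order \<open>-1 < -2 < \<dots> < -n < 1 < 2 < \<dots> < n\<close> (for all \<open>n\<close> at once, on nonzero integers).\<close>

definition B_less :: "int \<Rightarrow> int \<Rightarrow> bool" where
  "B_less x y \<longleftrightarrow> (x < 0 \<and> 0 < y) \<or> (y < x \<and> x < 0) \<or> (0 < x \<and> x < y)"

definition noncrossing :: "('a \<Rightarrow> 'a \<Rightarrow> bool) \<Rightarrow> 'a set set \<Rightarrow> bool" where
  "noncrossing r P \<longleftrightarrow>
     \<not> (\<exists>a b c d. r a b \<and> r b c \<and> r c d \<and>
          (\<exists>B\<in>P. \<exists>C\<in>P. B \<noteq> C \<and> a \<in> B \<and> c \<in> B \<and> b \<in> C \<and> d \<in> C))"

definition block_list :: "int set \<Rightarrow> int list" where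
  "block_list B = (THE xs. sorted_wrt B_less xs \<and> set xs = B)"

definition perm_of_partition :: "int set set \<Rightarrow> int \<Rightarrow> int" where
  "perm_of_partition P x =
     (if x \<in> \<Union>P then cycle_of_list (block_list (THE B. B \<in> P \<and> x \<in> B)) x else x)"

definition NC_B :: "nat \<Rightarrow> (int \<Rightarrow> int) set" where
  "NC_B n = perm_of_partition ` {P. type_B_partition n P \<and> noncrossing B_less P}"

text \<open>
  The \<open>j\<close>-th negative position from the left receives the entry at the \<open>j\<close>-th negative
  position from the right; the values at negative arguments are determined by oddness.
\<close>

definition neg_positions :: "nat \<Rightarrow> (int \<Rightarrow> int) \<Rightarrow> int list" where
  "neg_positions n \<sigma> = filter (\<lambda>i. \<sigma> i < 0) [1..int n]"

definition rev_neg :: "nat \<Rightarrow> (int \<Rightarrow> int) \<Rightarrow> int \<Rightarrow> int" where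
  "rev_neg n \<sigma> x =
     (case map_of (zip (neg_positions n \<sigma>) (map \<sigma> (rev (neg_positions n \<sigma>)))) \<bar>x\<bar> of
        None \<Rightarrow> \<sigma> x
      | Some y \<Rightarrow> sgn x * y)"


section \<open>Sortable elements\<close>

fun gen :: "nat \<Rightarrow> int \<Rightarrow> int" where
  "gen 0 = transpose 1 (- 1)"
| "gen (Suc i) = transpose (int (Suc i)) (int (Suc i) + 1)
                 \<circ> transpose (- int (Suc i)) (- (int (Suc i) + 1))"

text \<open>Words in the generators are lists of indices; products are compositions of maps.\<close>

definition word_prod :: "nat list \<Rightarrow> int \<Rightarrow> int" where
  "word_prod w = foldr (\<lambda>i f. gen i \<circ> f) w id"

definition reduced_word :: "nat \<Rightarrow> nat list \<Rightarrow> bool" where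
  "reduced_word n w \<longleftrightarrow>
     set w \<subseteq> {..<n} \<and>
     (\<forall>v. set v \<subseteq> {..<n} \<and> word_prod v = word_prod w \<longrightarrow> length w \<le> length v)"

definition Sort_B :: "nat \<Rightarrow> (int \<Rightarrow> int) set" where
  "Sort_B n = {\<sigma> \<in> signed_perms n. \<exists>Xs.
     length Xs = n \<and>
     (\<forall>X\<in>set Xs. subseq X (rev [0..<n])) \<and>
     (\<forall>l. Suc l < n \<longrightarrow> set (Xs ! Suc l) \<subseteq> set (Xs ! l)) \<and>
     reduced_word n (concat Xs) \<and> word_prod (concat Xs) = \<sigma>}"


section \<open>Gaussian binomial coefficients\<close>

definition q_int :: "'a::comm_ring_1 \<Rightarrow> nat \<Rightarrow> 'a" where
  "q_int q k = (\<Sum>i<k. q ^ i)"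

definition q_fact :: "'a::comm_ring_1 \<Rightarrow> nat \<Rightarrow> 'a" where
  "q_fact q k = (\<Prod>i=1..k. q_int q i)"

lemma q_fact_0 [simp]: "q_fact q 0 = 1"
  by (simp add: q_fact_def)

lemma q_fact_Suc: "q_fact q (Suc k) = q_int q (Suc k) * q_fact q k"
  by (simp add: q_fact_def mult.commute)

lemma q_int_add: "q_int q (a + b) = q_int q a + q ^ a * q_int q b"
  by (induction b) (simp_all add: q_int_def algebra_simps power_add)

text \<open>The quotient in the definition of \<open>q_binomial\<close> is exact.\<close>

lemma q_fact_dvd: "q_fact q a * q_fact q b dvd q_fact q (a + b)"
proof (induction "a + b" arbitrary: a b)
  case (Suc m)
  show ?case
  proof (cases "a = 0 \<or> b = 0")
    case False
    then obtain a' b' where ab: "a = Suc a'" "b = Suc b'"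
      by (metis not0_implies_Suc)
    have "q_fact q a' * q_fact q b dvd q_fact q m"
      and "q_fact q a * q_fact q b' dvd q_fact q m"
      using Suc.hyps(1)[of a' b] Suc.hyps(1)[of a b'] Suc.hyps(2) ab by simp_all
    then have "q_int q a * (q_fact q a' * q_fact q b) dvd q_int q a * q_fact q m"
      and "q_int q b * (q_fact q a * q_fact q b') dvd q_int q b * q_fact q m"
      by (simp_all add: mult_dvd_mono)
    then have "q_fact q a * q_fact q b dvd q_int q a * q_fact q m"
      and "q_fact q a * q_fact q b dvd q_int q b * q_fact q m"
      by (simp_all add: ab q_fact_Suc mult_ac)
    then have "q_fact q a * q_fact q b dvd
        q_int q a * q_fact q m + q ^ a * (q_int q b * q_fact q m)"
      by (rule dvd_add[OF _ dvd_mult])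
    also have "\<dots> = q_int q (a + b) * q_fact q m"
      by (simp add: q_int_add algebra_simps)
    also have "\<dots> = q_fact q (a + b)"
      using Suc.hyps(2) by (metis q_fact_Suc)
    finally show ?thesis .
  qed auto
qed simp

definition q_binomial :: "'a::{comm_ring_1,idom_divide} \<Rightarrow> nat \<Rightarrow> nat \<Rightarrow> 'a" where
  "q_binomial q k l = q_fact q k div (q_fact q l * q_fact q (k - l))"

end

theory Submission
  imports Defs
begin

text \<open>
  A signed permutation and its inverse have the same number of negative entries. The exponent is
  therefore twice the weight that adds up the descent positions of the permutation, those of its
  inverse, and the number \<open>h\<close> of negative entries. Each of the two families is encoded by words
  that describe paths from height \<open>h\<close> to height 0, in such a way that the weight is a sum of local
  contributions. For every positive value \<open>q\<close> of the squared variable, the paths that start at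
  height \<open>h\<close> have a generating function of the form \<open>G h - G (h + 1)\<close>, where \<open>G\<close> is a Gaussian
  binomial coefficient up to a power of \<open>q\<close>. The sum over \<open>h\<close> telescopes to the central coefficient
  (\<open>sum_Sort_B\<close> and \<open>sum_half_perms\<close>), and polynomials that agree at all positive integers are equal.
  
  Sortable elements. A reduced word of the required shape is a sequence of nested passes. Let
  \<open>\<rho>\<close> be the inverse of the element. A value is open at a gap between two positions if it has been
  read but a smaller one is still to come, as in stack sorting. Prefixing a further pass with letter
  set \<open>X\<close> raises the number of open values at the gap \<open>i\<close> by one exactly for \<open>i \<in> X\<close> (\<open>height_step\<close>).
  The profile of these numbers thus counts the passes through each letter and determines the element
  (\<open>Sort_B_eqI\<close>); which profiles occur is a local condition (\<open>signed_perm_valid_heights\<close>,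
  \<open>valid_heights_Sort_B\<close>). Each pass also preserves the avoidance of the pattern 231, which makes it
  possible to read the descents of the element and of its inverse off the profile (\<open>Sort_B_weight\<close>).
  
  Noncrossing partitions. After the reversal of the negative entries, each block that contains
  elements of both signs closes up with the negative of its own smallest positive element. The
  reversed permutation therefore depends only on the partition induced on the positive elements
  and on the set of those blocks that contain negative elements (\<open>rev_neg_class_perm\<close>), and every
  such half, with marked blocks under no arc, does occur (\<open>half_partition_extends\<close>). It is
  encoded by recording for each element whether its block continues to the right and whether it
  continues to the left (\<open>half_perms_words\<close>), and two neighbouring letters decide about the descents
  between them (\<open>half_perm_weight\<close>).
\<close>

section \<open>Reduced words\<close>

lemma gen_0: "gen 0 v = (if v = 1 then -1 else if v = -1 then 1 else v)"
  by (auto simp: transpose_def)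

lemma gen_pos:
  assumes "k \<ge> 1"
  shows "gen k v = (if v = int k then int k + 1 else if v = int k + 1 then int k
     else if v = - int k then - (int k + 1) else if v = - (int k + 1) then - int k else v)"
  using assms by (cases k) (auto simp: transpose_def)

lemma gen_invol [simp]: "gen k (gen k v) = v"
  by (cases "k = 0") (auto simp: gen_0 gen_pos simp del: gen.simps)

lemma gen_comp_gen [simp]: "gen k \<circ> gen k = id"
  by (rule ext) simp

lemma gen_uminus: "gen k (- v) = - gen k v"
  by (cases "k = 0") (auto simp: gen_0 gen_pos simp del: gen.simps)

lemma gen_in_range: "k < n \<Longrightarrow> v \<in> signed_range n \<Longrightarrow> gen k v \<in> signed_range n"
  by (cases "k = 0") (auto simp: gen_0 gen_pos signed_range_def simp del: gen.simps)

lemma gen_outside: "k < n \<Longrightarrow> v \<notin> signed_range n \<Longrightarrow> gen k v = v"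
  by (cases "k = 0") (auto simp: gen_0 gen_pos signed_range_def simp del: gen.simps)

lemma gen_signed: "k < n \<Longrightarrow> gen k \<in> signed_perms n"
  unfolding signed_perms_def
proof (intro CollectI conjI allI)
  assume k: "k < n"
  show "gen k permutes signed_range n"
    by (rule bij_imp_permutes)
      (auto simp: gen_outside[OF k] intro!: bij_betwI[of _ _ _ "gen k"] gen_in_range[OF k])
qed (rule gen_uminus)

lemma inv_gen [simp]: "inv (gen k) = gen k"
  by (rule inv_equality) simp_all

lemma signed_permsD:
  assumes "\<sigma> \<in> signed_perms n"
  shows "\<sigma> permutes signed_range n" "\<sigma> (- i) = - \<sigma> i" "bij \<sigma>" "inj \<sigma>"
    "\<sigma> i \<in> signed_range n \<longleftrightarrow> i \<in> signed_range n"
  using assms permutes_bij[of \<sigma>] permutes_inj[of \<sigma>] permutes_in_image[of \<sigma>]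
  by (auto simp: signed_perms_def)

lemma signed_comp: "\<sigma> \<in> signed_perms n \<Longrightarrow> \<tau> \<in> signed_perms n \<Longrightarrow> \<sigma> \<circ> \<tau> \<in> signed_perms n"
  by (auto simp: signed_perms_def intro: permutes_compose)

lemma signed_inv:
  assumes "\<sigma> \<in> signed_perms n" shows "inv \<sigma> \<in> signed_perms n"
proof -
  have "inv \<sigma> (- i) = - inv \<sigma> i" for i
    using signed_permsD[OF assms] by (metis bij_inv_eq_iff)
  then show ?thesis using assms by (auto simp: signed_perms_def permutes_inv)
qed

lemma signed_id [simp]: "id \<in> signed_perms n"
  by (auto simp: signed_perms_def permutes_id)

lemma signed_0 [simp]: "\<sigma> \<in> signed_perms n \<Longrightarrow> \<sigma> 0 = 0"
  by (auto simp: signed_perms_def) (metis add.inverse_neutral equal_neg_zero)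

lemma finite_signed_range [simp, intro]: "finite (signed_range n)"
  by (simp add: signed_range_def)

text \<open>
  Twice the Coxeter length. Counting the inversions of the full one-line notation on the
  signed range together with the negative entries avoids choosing one root out of each pair
  of opposite roots; a simple reflection then changes the count by exactly two.
\<close>

definition inversions :: "nat \<Rightarrow> (int \<Rightarrow> int) \<Rightarrow> (int \<times> int) set" where
  "inversions n \<rho> = {(a, b). a \<in> signed_range n \<and> b \<in> signed_range n \<and> a < b \<and> \<rho> a > \<rho> b}"

definition double_length :: "nat \<Rightarrow> (int \<Rightarrow> int) \<Rightarrow> nat" where
  "double_length n \<rho> = card (inversions n \<rho>) + neg n \<rho>"

definition ascent_at :: "(int \<Rightarrow> int) \<Rightarrow> nat \<Rightarrow> bool" where
  "ascent_at \<rho> k \<longleftrightarrow> \<rho> (if k = 0 then -1 else int k) < \<rho> (int k + 1)"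

lemma finite_inversions: "finite (inversions n \<rho>)"
  by (rule finite_subset[of _ "signed_range n \<times> signed_range n"]) (auto simp: inversions_def)

text \<open>
  The generators are simple: the neighbours they exchange are the only pairs whose order they reverse,
  so that all other inversions are merely relabelled.
\<close>

lemma gen_order_reversed:
  assumes "a < b" "gen k a \<ge> gen k b" "a \<noteq> 0" "b \<noteq> 0"
  shows "(a, b) \<in> (if k = 0 then {(-1, 1)} else {(int k, int k + 1), (- (int k + 1), - int k)})"
proof (cases "k = 0")
  case True
  with assms show ?thesis by (auto simp: gen_0 simp del: gen.simps split: if_splits)
next
  case False
  then have k: "k \<ge> 1" by simp
  from assms False show ?thesis unfolding gen_pos[OF k] by (auto split: if_splits)
qed

text \<open>
  Besides relabelling, the generator creates for \<open>k > 0\<close> two inversions that are negatives of each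
  other, and for \<open>k = 0\<close> one inversion and one negative entry.
\<close>

lemma double_length_gen:
  assumes \<rho>: "\<rho> \<in> signed_perms n" and k: "k < n" and asc: "ascent_at \<rho> k"
  shows "double_length n (\<rho> \<circ> gen k) = double_length n \<rho> + 2"
proof -
  let ?s = "gen k"
  let ?E = "if k = 0 then {(-1, 1)} else {(int k, int k + 1), (- (int k + 1), - int k)}"
  note odd = signed_permsD(2)[OF \<rho>]
  have E_not: "ab \<notin> inversions n \<rho>" if "ab \<in> ?E" for ab
    using that asc odd[of "int k"] odd[of "int k + 1"]
    by (auto simp: inversions_def ascent_at_def split: if_splits)
  have E_in: "ab \<in> inversions n (\<rho> \<circ> ?s)" if ab: "ab \<in> ?E" for ab
  proof (cases "k = 0")
    case True
    then have "ab = (-1, 1)" using ab by simp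
    moreover have "\<rho> (-1) < \<rho> 1" using asc True by (simp add: ascent_at_def)
    ultimately show ?thesis using k True
      by (simp add: inversions_def gen_0 signed_range_def del: gen.simps)
  next
    case False
    then have k1: "k \<ge> 1" by simp
    have *: "\<rho> (int k) < \<rho> (int k + 1)" "\<rho> (- (int k + 1)) = - \<rho> (int k + 1)"
      "\<rho> (- int k) = - \<rho> (int k)"
      using asc False odd[of "int k + 1"] odd[of "int k"] by (simp_all add: ascent_at_def)
    from False ab have "ab = (int k, int k + 1) \<or> ab = (- (int k + 1), - int k)" by simp
    then show ?thesis using * k k1
      by (elim disjE) (simp_all add: inversions_def gen_pos[OF k1] signed_range_def)
  qed
  have rng: "x \<noteq> 0" if "x \<in> signed_range n" for x using that by (simp add: signed_range_def)
  have eq: "inversions n (\<rho> \<circ> ?s) = map_prod ?s ?s ` inversions n \<rho> \<union> ?E"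
  proof (intro equalityI subsetI)
    fix ab assume ab: "ab \<in> inversions n (\<rho> \<circ> ?s)"
    obtain a b where [simp]: "ab = (a, b)" by force
    show "ab \<in> map_prod ?s ?s ` inversions n \<rho> \<union> ?E"
    proof (cases "?s a < ?s b")
      case True
      then have "(?s a, ?s b) \<in> inversions n \<rho>"
        using ab gen_in_range[OF k] by (auto simp: inversions_def)
      then have "map_prod ?s ?s (?s a, ?s b) \<in> map_prod ?s ?s ` inversions n \<rho>" by blast
      then show ?thesis by simp
    next
      case False
      then show ?thesis using gen_order_reversed[of a b k] ab rng
        by (auto simp: inversions_def)
    qed
  next
    fix ab assume "ab \<in> map_prod ?s ?s ` inversions n \<rho> \<union> ?E"
    then show "ab \<in> inversions n (\<rho> \<circ> ?s)"
    proof
      assume "ab \<in> map_prod ?s ?s ` inversions n \<rho>"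
      then obtain a b where ab: "(a, b) \<in> inversions n \<rho>" and [simp]: "ab = (?s a, ?s b)" by auto
      have "?s a < ?s b"
      proof (rule ccontr)
        assume "\<not> ?s a < ?s b"
        then have "(a, b) \<in> ?E"
          using gen_order_reversed[of a b k] ab rng by (auto simp: inversions_def)
        with E_not ab show False by blast
      qed
      with ab gen_in_range[OF k] show ?thesis by (auto simp: inversions_def)
    qed (rule E_in)
  qed
  have inj: "inj ?s" by (metis gen_invol injI)
  have "card (map_prod ?s ?s ` inversions n \<rho>) = card (inversions n \<rho>)"
    by (rule card_image) (meson inj prod.inj_map inj_on_subset subset_UNIV)
  moreover have "map_prod ?s ?s ` inversions n \<rho> \<inter> ?E = {}"
  proof (rule ccontr)
    assume "map_prod ?s ?s ` inversions n \<rho> \<inter> ?E \<noteq> {}"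
    then obtain a b where ab: "(a, b) \<in> inversions n \<rho>" "(?s a, ?s b) \<in> ?E" by auto
    then have "?s a < ?s b" "a < b" by (auto simp: inversions_def split: if_splits)
    moreover from ab(2) have "?s (?s a) > ?s (?s b)"
    proof (cases "k = 0")
      case False
      then have k1: "k \<ge> 1" by simp
      from ab(2) False have "?s a = int k \<and> ?s b = int k + 1 \<or> ?s a = - (int k + 1) \<and> ?s b = - int k"
        by simp
      then show ?thesis by (elim disjE) (simp_all only: gen_pos[OF k1], use k1 in auto)
    qed (simp add: gen_0 del: gen.simps gen_invol)
    ultimately show False by auto
  qed
  ultimately have c: "card (inversions n (\<rho> \<circ> ?s)) = card (inversions n \<rho>) + (if k = 0 then 1 else 2)"
    unfolding eq by (subst card_Un_disjoint) (auto simp: finite_inversions)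
  have "neg n (\<rho> \<circ> ?s) = neg n \<rho> + (if k = 0 then 1 else 0)"
  proof (cases "k = 0")
    case True
    then have "{i \<in> {1..int n}. (\<rho> \<circ> ?s) i < 0} = insert 1 {i \<in> {1..int n}. \<rho> i < 0}"
      using asc k odd[of 1] by (auto simp: gen_0 ascent_at_def simp del: gen.simps)
    moreover have "1 \<notin> {i \<in> {1..int n}. \<rho> i < 0}"
      using asc True odd[of 1] by (auto simp: ascent_at_def)
    moreover have "finite {i \<in> {1..int n}. \<rho> i < 0}"
      by (rule finite_subset[of _ "{1..int n}"]) auto
    ultimately have "card {i \<in> {1..int n}. (\<rho> \<circ> ?s) i < 0} = Suc (card {i \<in> {1..int n}. \<rho> i < 0})"
      by (metis card_insert_disjoint)
    then show ?thesis using True unfolding neg_def by simp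
  next
    case False
    have r: "?s i \<in> {1..int n} \<longleftrightarrow> i \<in> {1..int n}" for i
      using False k by (auto simp: gen_pos simp del: gen.simps split: if_splits)
    have "{i \<in> {1..int n}. (\<rho> \<circ> ?s) i < 0} = ?s ` {i \<in> {1..int n}. \<rho> i < 0}"
    proof (intro equalityI subsetI)
      fix i assume i: "i \<in> {i \<in> {1..int n}. (\<rho> \<circ> ?s) i < 0}"
      then have "?s i \<in> {i \<in> {1..int n}. \<rho> i < 0}" using r by auto
      then have "?s (?s i) \<in> ?s ` {i \<in> {1..int n}. \<rho> i < 0}" by blast
      then show "i \<in> ?s ` {i \<in> {1..int n}. \<rho> i < 0}" by simp
    qed (use r in auto)
    then show ?thesis using False by (simp add: neg_def card_image inj_on_subset[OF inj])
  qed
  with c show ?thesis by (simp add: double_length_def)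
qed


lemma gen_swaps:
  "gen k (if k = 0 then -1 else int k) = int k + 1"
  "gen k (int k + 1) = (if k = 0 then -1 else int k)"
  by (cases "k = 0"; simp add: gen_0 gen_pos del: gen.simps)+

lemma double_length_gen_descent:
  assumes \<rho>: "\<rho> \<in> signed_perms n" and k: "k < n" and desc: "\<not> ascent_at \<rho> k"
  shows "double_length n (\<rho> \<circ> gen k) + 2 = double_length n \<rho>"
proof -
  have "\<rho> (if k = 0 then -1 else int k) \<noteq> \<rho> (int k + 1)"
    using signed_permsD(4)[OF \<rho>] by (auto simp: inj_eq)
  with desc have "ascent_at (\<rho> \<circ> gen k) k"
    by (simp add: ascent_at_def gen_swaps comp_def del: gen.simps split del: if_split)
  from double_length_gen[OF signed_comp[OF \<rho> gen_signed[OF k]] k this]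
  show ?thesis by (simp add: comp_assoc)
qed

lemma word_prod_simps [simp]:
  "word_prod [] = id" "word_prod (i # w) = gen i \<circ> word_prod w"
  by (simp_all add: word_prod_def)

lemma word_prod_signed: "set w \<subseteq> {..<n} \<Longrightarrow> word_prod w \<in> signed_perms n"
  by (induction w) (auto intro!: signed_comp gen_signed)

lemma inv_word_prod_Cons:
  "set w \<subseteq> {..<n} \<Longrightarrow> inv (word_prod (i # w)) = inv (word_prod w) \<circ> gen i"
  using signed_permsD(3)[OF word_prod_signed[of w n]] signed_permsD(3)[OF gen_signed[of i "Suc i"]]
  by (simp add: o_inv_distrib del: gen.simps)

lemma double_length_id [simp]: "double_length n id = 0"
proof -
  have "inversions n id = {}" "{i \<in> {1..int n}. id i < 0} = {}" by (auto simp: inversions_def)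
  then show ?thesis unfolding double_length_def neg_def by (simp only: card.empty)
qed

lemma double_length_word_le:
  "set w \<subseteq> {..<n} \<Longrightarrow> double_length n (inv (word_prod w)) \<le> 2 * length w"
proof (induction w)
  case Nil
  then show ?case using double_length_id[of n] by (simp add: id_def)
next
  case (Cons i w)
  let ?\<rho> = "inv (word_prod w)"
  have \<rho>: "?\<rho> \<in> signed_perms n" and i: "i < n"
    using Cons.prems by (auto intro: signed_inv word_prod_signed)
  have "double_length n (?\<rho> \<circ> gen i) \<le> double_length n ?\<rho> + 2"
    using double_length_gen[OF \<rho> i] double_length_gen_descent[OF \<rho> i] by linarith
  moreover have "double_length n ?\<rho> \<le> 2 * length w" using Cons by simp
  moreover have eq: "inv (word_prod (i # w)) = ?\<rho> \<circ> gen i"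
    by (rule inv_word_prod_Cons[of w n]) (use Cons.prems in simp)
  ultimately show ?case unfolding eq length_Cons mult_Suc_right by linarith
qed

text \<open>
  Ascents at all places, including the one from \<open>-1\<close> to \<open>1\<close>, make the permutation increasing on the
  whole signed range.
\<close>

lemma only_ascents_imp_id:
  assumes \<rho>: "\<rho> \<in> signed_perms n" and asc: "\<And>k. k < n \<Longrightarrow> ascent_at \<rho> k"
  shows "\<rho> = id"
proof -
  note odd = signed_permsD(2)[OF \<rho>]
  have ge: "int k < n \<Longrightarrow> \<rho> (int k + 1) \<ge> int k + 1" for k
  proof (induction k)
    case 0
    then show ?case using asc[of 0] odd[of 1] by (simp add: ascent_at_def)
  next
    case (Suc k)
    then show ?case using asc[of "Suc k"] by (simp add: ascent_at_def algebra_simps)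
  qed
  have le: "j < n \<Longrightarrow> \<rho> (int (n - j)) \<le> int (n - j)" for j
  proof (induction j)
    case 0
    then show ?case using signed_permsD(5)[OF \<rho>, of "int n"] by (auto simp: signed_range_def)
  next
    case (Suc j)
    then show ?case using asc[of "n - Suc j"]
      by (simp add: ascent_at_def algebra_simps of_nat_diff Suc_diff_Suc split: if_splits)
  qed
  have pos: "\<rho> i = i" if "1 \<le> i" "i \<le> int n" for i
  proof -
    have "i = int (nat i - 1) + 1" "i = int (n - (n - nat i))" using that by auto
    then show ?thesis using ge[of "nat i - 1"] le[of "n - nat i"] that by auto
  qed
  show ?thesis
  proof
    fix i
    consider "i \<notin> signed_range n" | "1 \<le> i" "i \<le> int n" | "1 \<le> - i" "- i \<le> int n"
      by (force simp: signed_range_def)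
    then show "\<rho> i = id i"
    proof cases
      case 1
      then show ?thesis using signed_permsD(1)[OF \<rho>] by (simp add: permutes_not_in)
    next
      case 3
      then show ?thesis using pos[of "- i"] odd[of i] by simp
    qed (use pos in auto)
  qed
qed

text \<open>
  Sorting by descents: as long as some simple reflection lowers the length, apply it; the
  process ends in the identity.
\<close>

lemma exists_word_of_length:
  "\<rho> \<in> signed_perms n \<Longrightarrow>
     \<exists>w. set w \<subseteq> {..<n} \<and> inv (word_prod w) = \<rho> \<and> 2 * length w = double_length n \<rho>"
proof (induction "double_length n \<rho>" arbitrary: \<rho> rule: less_induct)
  case less
  show ?case
  proof (cases "\<forall>k<n. ascent_at \<rho> k")
    case True
    then have "\<rho> = id" using only_ascents_imp_id[OF less.prems] by blast
    then show ?thesis by (intro exI[of _ "[]"]) (simp add: inv_id)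
  next
    case False
    then obtain k where k: "k < n" "\<not> ascent_at \<rho> k" by blast
    let ?\<rho> = "\<rho> \<circ> gen k"
    have d: "double_length n ?\<rho> + 2 = double_length n \<rho>"
      by (rule double_length_gen_descent[OF less.prems k])
    obtain w where w: "set w \<subseteq> {..<n}" "inv (word_prod w) = ?\<rho>" "2 * length w = double_length n ?\<rho>"
      using less.hyps[of ?\<rho>] d signed_comp[OF less.prems gen_signed[OF k(1)]] by auto
    have "inv (word_prod (k # w)) = \<rho>"
      using w(1,2) by (simp add: inv_word_prod_Cons comp_assoc del: gen.simps word_prod_simps)
    then show ?thesis using w d k(1) by (intro exI[of _ "k # w"]) auto
  qed
qed

text \<open>
  No word can be shorter than half the double length, because a letter changes the latter by two, and
  sorting by descents produces a word that attains the bound.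
\<close>

lemma reduced_word_iff:
  "reduced_word n w \<longleftrightarrow>
     set w \<subseteq> {..<n} \<and> double_length n (inv (word_prod w)) = 2 * length w"
proof (intro iffI conjI)
  assume r: "reduced_word n w"
  then show s: "set w \<subseteq> {..<n}" by (simp add: reduced_word_def)
  obtain v where v: "set v \<subseteq> {..<n}" "inv (word_prod v) = inv (word_prod w)"
    "2 * length v = double_length n (inv (word_prod w))"
    using exists_word_of_length signed_inv word_prod_signed s by blast
  have "word_prod v = word_prod w"
    using v(2) signed_permsD(3)[OF word_prod_signed] v(1) s by (metis inv_inv_eq)
  with r v have "length w \<le> length v" by (auto simp: reduced_word_def)
  with v(3) double_length_word_le[OF s] show "double_length n (inv (word_prod w)) = 2 * length w"
    by linarith
next
  assume a: "set w \<subseteq> {..<n} \<and> double_length n (inv (word_prod w)) = 2 * length w"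
  show "reduced_word n w" unfolding reduced_word_def
  proof (intro conjI allI impI)
    fix v assume "set v \<subseteq> {..<n} \<and> word_prod v = word_prod w"
    then show "length w \<le> length v" using double_length_word_le[of v n] a by simp
  qed (use a in blast)
qed

lemma reduced_word_Cons:
  assumes "set (i # w) \<subseteq> {..<n}"
  shows "reduced_word n (i # w) \<longleftrightarrow> reduced_word n w \<and> ascent_at (inv (word_prod w)) i"
proof -
  let ?\<rho> = "inv (word_prod w)"
  have \<rho>: "?\<rho> \<in> signed_perms n" and i: "i < n" and w: "set w \<subseteq> {..<n}"
    using assms by (auto intro: signed_inv word_prod_signed)
  have "double_length n (inv (word_prod (i # w))) =
      (if ascent_at ?\<rho> i then double_length n ?\<rho> + 2 else double_length n ?\<rho> - 2)"
    using double_length_gen[OF \<rho> i] double_length_gen_descent[OF \<rho> i]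
    by (auto simp: inv_word_prod_Cons[OF w] simp del: gen.simps word_prod_simps)
  then show ?thesis using assms w double_length_word_le[OF w]
    by (auto simp: reduced_word_iff simp del: word_prod_simps)
qed


section \<open>Sorting passes\<close>

definition pass :: "nat set \<Rightarrow> nat \<Rightarrow> nat list" where
  "pass X t = rev (filter (\<lambda>i. i \<in> X) [0..<t])"

lemma pass_0 [simp]: "pass X 0 = []"
  by (simp add: pass_def)

lemma pass_Suc: "pass X (Suc t) = (if t \<in> X then t # pass X t else pass X t)"
  by (simp add: pass_def)

lemma set_pass [simp]: "set (pass X t) = X \<inter> {..<t}"
  by (auto simp: pass_def)

lemma subseq_distinct_eq_filter:
  assumes "subseq xs ys" "distinct ys"
  shows "xs = filter (\<lambda>y. y \<in> set xs) ys"
  using assms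
proof (induction rule: list_emb.induct)
  case (list_emb_Cons xs ys y)
  then have "y \<notin> set xs" by (metis distinct.simps(2) filter_is_subset subset_iff)
  then show ?case using list_emb_Cons by simp
next
  case (list_emb_Cons2 x y xs ys)
  then have "x \<notin> set ys" by auto
  then have "filter (\<lambda>z. z = x \<or> z \<in> set xs) ys = filter (\<lambda>z. z \<in> set xs) ys"
    by (intro filter_cong) auto
  then show ?case using list_emb_Cons2 by simp
qed simp

lemma subseq_imp_pass:
  assumes "subseq xs (rev [0..<n])"
  shows "xs = pass (set xs) n"
  using subseq_distinct_eq_filter[OF assms] by (simp add: pass_def rev_filter)

lemma subseq_pass: "subseq (pass X n) (rev [0..<n])"
  by (simp add: pass_def rev_filter)

text \<open>
  A pass moves, inside each maximal run \<open>{s<..<t}\<close> of its letters, the smallest value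
  \<open>Suc s\<close> to the top; in the run starting at the letter 0 it moves the value \<open>-1\<close>, the convention
  behind the first equation.
\<close>

fun run_start :: "nat set \<Rightarrow> nat \<Rightarrow> int" where
  "run_start X 0 = -1"
| "run_start X (Suc t) = (if t \<in> X then run_start X t else int (Suc t))"

lemma run_start_cases:
  "(run_start X t = -1 \<and> {..<t} \<subseteq> X) \<or>
   (\<exists>s<t. s \<notin> X \<and> run_start X t = int (Suc s) \<and> {s<..<t} \<subseteq> X)"
proof (induction t)
  case (Suc t)
  show ?case
  proof (cases "t \<in> X")
    case True
    from Suc show ?thesis
    proof
      assume "run_start X t = -1 \<and> {..<t} \<subseteq> X"
      then show ?thesis using True by (auto simp: less_Suc_eq)
    next
      assume "\<exists>s<t. s \<notin> X \<and> run_start X t = int (Suc s) \<and> {s<..<t} \<subseteq> X"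
      then obtain s where "s < t" "s \<notin> X" "run_start X t = int (Suc s)" "{s<..<t} \<subseteq> X" by blast
      then show ?thesis using True by (intro disjI2 exI[of _ s]) (auto simp: less_Suc_eq)
    qed
  qed auto
qed auto

lemma run_start_eq:
  "s < t \<Longrightarrow> s \<notin> X \<Longrightarrow> {s<..<t} \<subseteq> X \<Longrightarrow> run_start X t = int (Suc s)"
  by (induction t) (auto simp: less_Suc_eq subset_iff)

lemma run_start_minus_1: "{..<t} \<subseteq> X \<Longrightarrow> run_start X t = -1"
  by (induction t) (auto simp: subset_iff)

lemma run_start_bounds: "-1 \<le> run_start X t" "run_start X t \<le> int t"  "run_start X t \<noteq> 0"
  using run_start_cases[of X t] by auto

lemma word_prod_pass:
  assumes w: "set w \<subseteq> {..<n}" and "t \<le> n" "1 \<le> v"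
  shows "inv (word_prod (pass X t @ w)) (int v) = inv (word_prod w)
     (if v < t \<and> v \<in> X then int v + 1 else if v \<le> t then run_start X v else int v)"
  using assms(2-)
proof (induction t arbitrary: v)
  case (Suc t)
  let ?\<rho> = "inv (word_prod w)" and ?\<tau> = "inv (word_prod (pass X t @ w))"
  have s: "set (pass X t @ w) \<subseteq> {..<n}" using w Suc.prems by auto
  have IH: "1 \<le> v \<Longrightarrow> ?\<tau> (int v) = ?\<rho> (if v < t \<and> v \<in> X then int v + 1
      else if v \<le> t then run_start X v else int v)" for v
    using Suc by simp
  show ?case
  proof (cases "t \<in> X")
    case False
    then show ?thesis using IH[of v] Suc.prems by (auto simp: pass_Suc le_Suc_eq less_Suc_eq)
  next
    case True
    have eq: "inv (word_prod (pass X (Suc t) @ w)) (int v) = ?\<tau> (gen t (int v))"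
      using True inv_word_prod_Cons[OF s, of t] by (simp add: pass_Suc del: gen.simps word_prod_simps)
    show ?thesis
    proof (cases "t = 0")
      case t: True
      have "?\<rho> (-1) = - ?\<rho> 1" using signed_permsD(2)[OF signed_inv[OF word_prod_signed[OF w]]] by blast
      then show ?thesis using True t Suc.prems unfolding eq
        by (cases "v = 1") (auto simp: gen_0 simp del: gen.simps)
    next
      case False
      then have t1: "t \<ge> 1" by simp
      consider "v = t" | "v = Suc t" | "v < t" | "v > Suc t" by linarith
      then show ?thesis
      proof cases
        case 1
        then have "gen t (int v) = int (Suc t)" using t1 by (simp add: gen_pos del: gen.simps)
        then show ?thesis using IH[of "Suc t"] 1 True unfolding eq by (simp add: add.commute)
      next
        case 2
        then have "gen t (int v) = int t" using t1 by (simp add: gen_pos del: gen.simps)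
        then show ?thesis using IH[OF t1] 2 True unfolding eq by simp
      next
        case 3
        then have "gen t (int v) = int v" using t1 by (simp add: gen_pos del: gen.simps)
        then show ?thesis using IH[of v] 3 Suc.prems unfolding eq by auto
      next
        case 4
        then have "gen t (int v) = int v" using t1 by (simp add: gen_pos del: gen.simps)
        then show ?thesis using IH[of v] 4 Suc.prems unfolding eq by auto
      qed
    qed
  qed
qed auto

text \<open>
  The letters of the pass are prefixed one by one. The comparison that decides about the letter \<open>s\<close>
  involves the value that the smaller letters have carried up from the start of the run.
\<close>

lemma reduced_word_pass:
  assumes w: "set w \<subseteq> {..<n}" and "t \<le> n"
  shows "reduced_word n (pass X t @ w) \<longleftrightarrow> reduced_word n w \<and>
    (\<forall>s\<in>X. s < t \<longrightarrow> inv (word_prod w) (run_start X s) < inv (word_prod w) (int s + 1))"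
  using assms(2)
proof (induction t)
  case (Suc t)
  let ?\<rho> = "inv (word_prod w)" and ?\<tau> = "inv (word_prod (pass X t @ w))"
  show ?case
  proof (cases "t \<in> X")
    case True
    have s: "set (t # pass X t @ w) \<subseteq> {..<n}" using w Suc.prems by auto
    have "?\<tau> (if t = 0 then -1 else int t) = ?\<rho> (run_start X t)"
      using word_prod_pass[OF w, of t t X] Suc.prems by simp
    moreover have "?\<tau> (int t + 1) = ?\<rho> (int t + 1)"
      using word_prod_pass[OF w, of t "Suc t" X] Suc.prems by (simp add: add.commute)
    ultimately have "ascent_at ?\<tau> t \<longleftrightarrow> ?\<rho> (run_start X t) < ?\<rho> (int t + 1)"
      by (simp add: ascent_at_def)
    then show ?thesis using Suc reduced_word_Cons[OF s] True by (auto simp: pass_Suc less_Suc_eq)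
  qed (use Suc in \<open>auto simp: pass_Suc less_Suc_eq\<close>)
qed simp

text \<open>
  Without the letter \<open>i\<close> no value is moved across the gap between \<open>i\<close> and \<open>i + 1\<close>.
\<close>

lemma word_prod_support:
  assumes "set w \<subseteq> {..<n}" "i \<notin> set w"
  shows "v > int i \<longleftrightarrow> inv (word_prod w) v > int i"
  using assms
proof (induction w arbitrary: v)
  case (Cons j w)
  have "gen j v > int i \<longleftrightarrow> v > int i"
  proof (cases "j = 0")
    case False
    then have "j \<ge> 1" "j \<noteq> i" using Cons.prems by auto
    then show ?thesis by (auto simp: gen_pos simp del: gen.simps)
  qed (use Cons.prems in \<open>auto simp: gen_0 simp del: gen.simps\<close>)
  moreover have "inv (word_prod (j # w)) v = inv (word_prod w) (gen j v)"
    using inv_word_prod_Cons[of w n j] Cons.prems by (simp del: gen.simps word_prod_simps)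
  ultimately show ?case using Cons.IH[of "gen j v"] Cons.prems
    by (simp del: gen.simps word_prod_simps)
qed (simp add: inv_id)

text \<open>
  Prefixing a pass with letter set \<open>X\<close> to a word with letters in \<open>X\<close> keeps it reduced iff the
  start of each run is a fixed point, or, for the run starting at 0, iff the entry 1 is
  positive and stands to the right of all negative entries.
\<close>

lemma pass_condition_iff:
  assumes \<rho>: "\<rho> \<in> signed_perms n" and X: "X \<subseteq> {..<n}"
    and supp: "\<And>i v. i \<notin> X \<Longrightarrow> v > int i \<longleftrightarrow> \<rho> v > int i"
  shows "(\<forall>t\<in>X. \<rho> (run_start X t) < \<rho> (int t + 1)) \<longleftrightarrow>
    (\<forall>t<n. t \<notin> X \<longrightarrow> \<rho> (int t + 1) = int t + 1) \<and>
    (0 \<in> X \<longrightarrow> (\<forall>k\<in>{1..int n}. - \<rho> 1 < \<rho> k))"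
    (is "?R \<longleftrightarrow> ?F1 \<and> ?F2")
proof (intro iffI conjI)
  note odd = signed_permsD(2)[OF \<rho>]
  assume R: ?R
  show ?F1
  proof (intro allI impI)
    fix t assume t: "t < n" "t \<notin> X"
    have le: "\<rho> (int t + 1) \<le> \<rho> (int j + 1)" if j: "t \<le> j" "j < n" for j
    proof (cases "{t<..j} \<subseteq> X")
      case True
      show ?thesis
      proof (cases "j = t")
        case False
        then have "j \<in> X" using True j by auto
        moreover have "run_start X j = int (Suc t)"
          by (rule run_start_eq) (use True j t False in auto)
        ultimately show ?thesis using R by (force simp: add.commute)
      qed simp
    next
      case False
      then obtain T where "T \<in> {t<..j}" and T: "T \<notin> X" by blast
      then have T: "t < T" "T \<le> j" "T \<notin> X" by auto
      then have "\<rho> (int t + 1) \<le> int T" "\<rho> (int j + 1) > int T"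
        using supp[OF T(3), of "int t + 1"] supp[OF T(3), of "int j + 1"] by auto
      then show ?thesis by linarith
    qed
    obtain k where k: "\<rho> k = int t + 1" using signed_permsD(3)[OF \<rho>] by (metis bij_is_surj surjD)
    then have "k > int t" using supp[OF t(2), of k] by simp
    moreover have "k \<in> signed_range n" using signed_permsD(5)[OF \<rho>, of k] k t
      by (auto simp: signed_range_def)
    ultimately have "t \<le> nat (k - 1)" "nat (k - 1) < n" "int (nat (k - 1)) + 1 = k"
      by (auto simp: signed_range_def)
    then have "\<rho> (int t + 1) \<le> int t + 1" using le[of "nat (k - 1)"] k by simp
    moreover have "\<rho> (int t + 1) > int t" using supp[OF t(2), of "int t + 1"] by simp
    ultimately show "\<rho> (int t + 1) = int t + 1" by linarith
  qed
  show ?F2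
  proof (intro impI ballI)
    fix k assume "0 \<in> X" and k: "k \<in> {1..int n}"
    then have neg: "- \<rho> 1 < 0" using R odd[of 1] by force
    define j where "j = nat (k - 1)"
    have j: "k = int j + 1" using k by (simp add: j_def)
    show "- \<rho> 1 < \<rho> k"
    proof (cases "{..j} \<subseteq> X")
      case True
      then have "run_start X j = -1" by (intro run_start_minus_1) auto
      then show ?thesis using R True odd[of 1] j by force
    next
      case False
      then obtain T where "T \<le> j" "T \<notin> X" by auto
      then show ?thesis using supp[of T k] neg j by auto
    qed
  qed
next
  note odd = signed_permsD(2)[OF \<rho>]
  assume F: "?F1 \<and> ?F2"
  show ?R
  proof
    fix t assume t: "t \<in> X"
    from run_start_cases[of X t] show "\<rho> (run_start X t) < \<rho> (int t + 1)"
    proof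
      assume *: "run_start X t = -1 \<and> {..<t} \<subseteq> X"
      with t have "0 \<in> X" by (cases "t = 0") auto
      then show ?thesis using * F t X odd[of 1] by auto
    next
      assume "\<exists>s<t. s \<notin> X \<and> run_start X t = int (Suc s) \<and> {s<..<t} \<subseteq> X"
      then obtain s where s: "s < t" "s \<notin> X" "run_start X t = int s + 1" by auto
      then have "\<rho> (int s + 1) = int s + 1" using F t X by auto
      moreover have "\<rho> (int t + 1) > int s" using supp[OF s(2), of "int t + 1"] s by simp
      moreover have "\<rho> (int t + 1) \<noteq> \<rho> (int s + 1)"
        using s(1) by (simp add: inj_eq[OF signed_permsD(4)[OF \<rho>]])
      ultimately show ?thesis using s by simp
    qed
  qed
qed


section \<open>Open values\<close>

text \<open>
  The value \<open>v\<close> is open at the gap after position \<open>i\<close> if it has been read but a smaller value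
  is still to come. For a permutation this is the stack content while stack-sorting; for a
  sortable element the number of open values turns out to be the number of passes that
  contain the letter \<open>i\<close>. Here \<open>\<rho>\<close> is the inverse of the element, mapping values to positions.
\<close>

definition open_values :: "nat \<Rightarrow> (int \<Rightarrow> int) \<Rightarrow> nat \<Rightarrow> int set" where
  "open_values n \<rho> i = {v \<in> {1..int n}. \<rho> v \<le> int i \<and> (\<exists>x<v. \<rho> x > int i)}"

definition height :: "nat \<Rightarrow> (int \<Rightarrow> int) \<Rightarrow> nat \<Rightarrow> nat" where
  "height n \<rho> i = card (open_values n \<rho> i)"

text \<open>
  The full one-line notation has no occurrence of the pattern 231 in which the
  entry playing the role of 2 is positive.
\<close>

definition avoids_231 :: "(int \<Rightarrow> int) \<Rightarrow> bool" where
  "avoids_231 \<rho> \<longleftrightarrow> (\<forall>x y z. x < y \<longrightarrow> y < z \<longrightarrow> 0 < y \<longrightarrow> \<not> (\<rho> y < \<rho> z \<and> \<rho> z < \<rho> x))"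

text \<open>
  The substitution by which a pass changes the inverse permutation, extended to the negative values
  by oddness.
\<close>

definition unshift :: "nat set \<Rightarrow> int \<Rightarrow> int" where
  "unshift X x = (if 1 \<le> x then (if nat x \<in> X then x + 1 else run_start X (nat x))
     else if x \<le> -1 then - (if nat (- x) \<in> X then - x + 1 else run_start X (nat (- x))) else 0)"

lemma unshift_less:
  assumes "x < y" "1 \<le> y"
  shows "unshift X x < y + 1"
  using assms run_start_bounds[of X "nat x"] run_start_bounds[of X "nat (- x)"]
  by (auto simp: unshift_def)

lemma open_values_range: "open_values n \<rho> i \<subseteq> {1..int n}"
  by (auto simp: open_values_def)

lemma finite_open_values [simp, intro]: "finite (open_values n \<rho> i)"
  by (rule finite_subset[OF open_values_range]) simp

lemma signed_perm_outside:
  assumes "\<rho> \<in> signed_perms n" "\<bar>x\<bar> > int n" shows "\<rho> x = x"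
proof -
  have "x \<notin> signed_range n" using assms(2) by (auto simp: signed_range_def)
  then show ?thesis using permutes_not_in[OF signed_permsD(1)[OF assms(1)]] by blast
qed

lemma signed_perm_eq_0: "\<rho> \<in> signed_perms n \<Longrightarrow> \<rho> x = 0 \<longleftrightarrow> x = 0"
  using inj_eq[OF signed_permsD(4), of \<rho> n x 0] by simp

lemma signed_perm_abs_le:
  assumes "\<rho> \<in> signed_perms n" shows "\<bar>\<rho> x\<bar> \<le> int n \<longleftrightarrow> \<bar>x\<bar> \<le> int n"
proof -
  have "\<bar>y\<bar> \<le> int n \<longleftrightarrow> y \<in> signed_range n \<or> y = 0" for y by (auto simp: signed_range_def)
  then show ?thesis using signed_permsD(5)[OF assms, of x] signed_perm_eq_0[OF assms] by simp
qed

lemma signed_perm_abs_leI: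
  assumes "\<rho> \<in> signed_perms n" "x \<le> int n" "0 \<le> \<rho> x" shows "\<bar>x\<bar> \<le> int n"
proof (rule ccontr)
  assume "\<not> \<bar>x\<bar> \<le> int n"
  then have "x < - int n" "\<rho> x = x" using assms(2) signed_perm_outside[OF assms(1), of x] by auto
  then show False using assms(3) by simp
qed

text \<open>
  One step of the construction of a sortable element: \<open>\<rho>'\<close> comes from the later passes and
  \<open>\<rho>\<close> from all passes, the first of which has letter set \<open>X\<close>.
\<close>

locale sorting_pass =
  fixes n :: nat and X :: "nat set" and \<rho> \<rho>' :: "int \<Rightarrow> int"
  assumes \<rho>: "\<rho> \<in> signed_perms n" and \<rho>': "\<rho>' \<in> signed_perms n" and X: "X \<subseteq> {..<n}"
    and supp: "i \<notin> X \<Longrightarrow> v > int i \<longleftrightarrow> \<rho> v > int i"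
    and supp': "i \<notin> X \<Longrightarrow> v > int i \<longleftrightarrow> \<rho>' v > int i"
    and unshift: "\<bar>x\<bar> \<le> int n \<Longrightarrow> \<rho> x = \<rho>' (unshift X x)"
    and fixed: "t < n \<Longrightarrow> t \<notin> X \<Longrightarrow> \<rho>' (int t + 1) = int t + 1"
    and one: "0 \<in> X \<Longrightarrow> k \<in> {1..int n} \<Longrightarrow> - \<rho>' 1 < \<rho>' k"
begin

lemmas odd = signed_permsD(2)[OF \<rho>] and odd' = signed_permsD(2)[OF \<rho>']

lemma one_pos: "0 \<in> X \<Longrightarrow> 0 < \<rho>' 1"
  using one[of 1] X by auto

lemma negative_step:
  assumes "u \<ge> 1" "u \<le> int n" "\<rho>' u < 0"
  shows "2 \<le> u \<and> nat (u - 1) \<in> X \<and> \<rho> (u - 1) = \<rho>' u"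
proof -
  have "0 \<in> X" using supp'[of 0 u] assms by force
  then have "u \<noteq> 1" using one_pos assms by auto
  then have u: "2 \<le> u" using assms by simp
  have "nat (u - 1) \<in> X"
  proof (rule ccontr)
    assume "nat (u - 1) \<notin> X"
    moreover have "nat (u - 1) < n" using u assms by linarith
    ultimately show False using fixed[of "nat (u - 1)"] u assms by simp
  qed
  then show ?thesis using u assms unshift[of "u - 1"] by (simp add: unshift_def)
qed

text \<open>
  The substitution preserves the order except at the tops of the runs, and the positions of these are
  known from the conditions \<open>fixed\<close> and \<open>one\<close>. A forbidden pattern would therefore already occur
  before the pass.
\<close>

lemma avoids_231_step:
  assumes av: "avoids_231 \<rho>'" shows "avoids_231 \<rho>"
  unfolding avoids_231_def
proof (intro allI impI notI)
  fix x y z assume xyz: "x < y" "y < z" "0 < y" and "\<rho> y < \<rho> z \<and> \<rho> z < \<rho> x"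
  then have yz: "\<rho> y < \<rho> z" and zx: "\<rho> z < \<rho> x" by auto
  have z: "z \<le> int n"
  proof (rule ccontr)
    assume "\<not> z \<le> int n"
    then have "\<rho> z = z" using signed_perm_outside[OF \<rho>] by simp
    moreover have "\<rho> x \<le> int n \<or> \<rho> x = x"
      using signed_perm_outside[OF \<rho>, of x] signed_perm_abs_le[OF \<rho>, of x] by force
    ultimately show False using zx xyz \<open>\<not> z \<le> int n\<close> by auto
  qed
  have x: "\<bar>x\<bar> \<le> int n"
  proof (rule ccontr)
    assume "\<not> \<bar>x\<bar> \<le> int n"
    then have "x < - int n" "\<rho> x = x" using signed_perm_outside[OF \<rho>, of x] xyz z by auto
    moreover have "\<rho> z \<ge> - int n" using signed_perm_abs_le[OF \<rho>, of z] z xyz by auto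
    ultimately show False using zx by simp
  qed
  show False
  proof (cases "nat z \<in> X")
    case zX: True
    show False
    proof (cases "nat y \<in> X")
      case True
      have "unshift X x < y + 1" using unshift_less xyz by simp
      moreover have "\<rho> y = \<rho>' (y + 1)" "\<rho> z = \<rho>' (z + 1)" "\<rho> x = \<rho>' (unshift X x)"
        using True zX xyz z x unshift by (simp_all add: unshift_def)
      ultimately show False using av yz zx xyz unfolding avoids_231_def by (smt (verit))
    next
      case False
      then show False using supp[of "nat y" z] supp[of "nat y" x] xyz zx by simp
    qed
  next
    case False
    then have *: "\<rho> z = \<rho>' (run_start X (nat z))" using unshift[of z] xyz z by (simp add: unshift_def)
    from run_start_cases[of X "nat z"] show False
    proof
      assume r: "run_start X (nat z) = -1 \<and> {..<nat z} \<subseteq> X"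
      then have "0 \<in> X" "nat y \<in> X" using xyz by auto
      then have "\<rho> y = \<rho>' (y + 1)" using unshift[of y] xyz z by (simp add: unshift_def)
      then show False using one[OF \<open>0 \<in> X\<close>, of "y + 1"] * r yz odd'[of 1] xyz z by simp
    next
      assume "\<exists>s<nat z. s \<notin> X \<and> run_start X (nat z) = int (Suc s) \<and> {s<..<nat z} \<subseteq> X"
      then obtain s where s: "s < nat z" "s \<notin> X" "run_start X (nat z) = int s + 1" by auto
      then have zs: "\<rho> z = int s + 1" using * fixed[of s] z by simp
      then have "y \<le> int s" using supp[OF s(2), of y] yz by auto
      then have "\<rho> x \<le> int s" using supp[OF s(2), of x] xyz by auto
      then show False using zx zs by simp
    qed
  qed
qed

text \<open>
  At a gap \<open>i\<close> with \<open>i \<in> X\<close> the pass lowers every open value by one and opens one more, the top of the run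
  through \<open>i\<close>. At the other gaps nothing is open, before or after the pass.
\<close>

lemma height_step:
  assumes i: "i < n"
  shows "height n \<rho> i = height n \<rho>' i + (if i \<in> X then 1 else 0)"
proof (cases "i \<in> X")
  case False
  have "\<not> (\<rho> v \<le> int i \<and> x < v \<and> \<rho> x > int i)" "\<not> (\<rho>' v \<le> int i \<and> x < v \<and> \<rho>' x > int i)" for v x
    using supp[OF False, of v] supp[OF False, of x] supp'[OF False, of v] supp'[OF False, of x] by auto
  then have "open_values n \<rho> i = {}" "open_values n \<rho>' i = {}" unfolding open_values_def by blast+
  then show ?thesis using False by (simp add: height_def)
next
  case iX: True
  \<comment> \<open>The top of the run of letters that contains \<open>i\<close>.\<close>
  define T where "T = (LEAST T. i < T \<and> T \<notin> X)"
  have ex: "i < n \<and> n \<notin> X" using i X by auto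
  have T: "i < T" "T \<notin> X" and Tn: "T \<le> n"
    using LeastI[of "\<lambda>T. i < T \<and> T \<notin> X", OF ex] Least_le[of "\<lambda>T. i < T \<and> T \<notin> X", OF ex]
    by (auto simp: T_def)
  have iT: "j \<in> X" if "i \<le> j" "j < T" for j
    using not_less_Least[of j "\<lambda>T. i < T \<and> T \<notin> X"] that iX by (cases "j = i") (auto simp: T_def)
  have rT: "\<rho> (int T) = \<rho>' (run_start X T)" using T Tn unshift[of "int T"] by (simp add: unshift_def)
  have "\<rho> (int T) \<le> int i" using run_start_cases[of X T]
  proof
    assume r: "run_start X T = -1 \<and> {..<T} \<subseteq> X"
    then have "0 \<in> X" using T by auto
    then show ?thesis using one_pos rT r odd'[of 1] by simp
  next
    assume "\<exists>s<T. s \<notin> X \<and> run_start X T = int (Suc s) \<and> {s<..<T} \<subseteq> X"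
    then obtain s where s: "s < T" "s \<notin> X" "run_start X T = int s + 1" by auto
    then have "s < i" using iT[of s] by force
    then show ?thesis using rT s fixed[of s] i by simp
  qed
  moreover have "\<exists>x<int T. \<rho> x > int i"
  proof (rule ccontr)
    assume no: "\<not> (\<exists>x<int T. \<rho> x > int i)"
    have "inv \<rho> ` {int i + 1..int n} \<subseteq> {int T + 1..int n}"
    proof
      fix x assume "x \<in> inv \<rho> ` {int i + 1..int n}"
      then obtain p where p: "p \<in> {int i + 1..int n}" "x = inv \<rho> p" by auto
      then have "\<rho> x = p" using signed_permsD(3)[OF \<rho>] by (simp add: bij_inv_eq_iff)
      then have "\<rho> x > int i" "x \<le> int n" using p signed_perm_abs_le[OF \<rho>, of x] by auto
      moreover from this have "\<not> x < int T" using no by blast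
      moreover have "x \<noteq> int T" using calculation(1) \<open>\<rho> (int T) \<le> int i\<close> by auto
      ultimately show "x \<in> {int T + 1..int n}" by simp
    qed
    moreover have "inj_on (inv \<rho>) {int i + 1..int n}"
      using signed_permsD(3)[OF \<rho>] by (meson bij_imp_bij_inv bij_is_inj inj_on_subset subset_UNIV)
    ultimately have "card {int i + 1..int n} \<le> card {int T + 1..int n}"
      by (metis card_inj_on_le finite_atLeastAtMost_int)
    then show False using T Tn by simp
  qed
  ultimately have To: "int T \<in> open_values n \<rho> i"
    using T Tn by (simp add: open_values_def)
  have "open_values n \<rho> i = insert (int T) ((\<lambda>v. v - 1) ` open_values n \<rho>' i)"
  proof (intro equalityI subsetI)
    fix v assume "v \<in> open_values n \<rho> i"
    then obtain x where v: "1 \<le> v" "v \<le> int n" "\<rho> v \<le> int i" "x < v" "\<rho> x > int i"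
      by (auto simp: open_values_def)
    show "v \<in> insert (int T) ((\<lambda>v. v - 1) ` open_values n \<rho>' i)"
    proof (cases "v = int T")
      case False
      moreover have "v \<le> int T" using supp[OF T(2), of v] v T by force
      ultimately have vT: "v < int T" by simp
      have vX: "nat v \<in> X"
      proof (rule ccontr)
        assume a: "nat v \<notin> X"
        then have "nat v < i" using iT[of "nat v"] vT v by force
        then show False using supp[OF a, of x] v by simp
      qed
      then have "nat v < n" using X by auto
      have x: "\<bar>x\<bar> \<le> int n"
        using signed_perm_abs_leI[OF \<rho>, of x] v by simp
      have "\<rho>' (v + 1) \<le> int i" using v vX unshift[of v] by (simp add: unshift_def)
      moreover have "unshift X x < v + 1" "\<rho>' (unshift X x) > int i"
        using unshift_less v unshift[OF x] by simp_all
      ultimately have "v + 1 \<in> open_values n \<rho>' i"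
        using v \<open>nat v < n\<close> by (auto simp: open_values_def)
      then have "v + 1 - 1 \<in> (\<lambda>v. v - 1) ` open_values n \<rho>' i" by blast
      then show ?thesis by simp
    qed simp
  next
    fix v assume "v \<in> insert (int T) ((\<lambda>v. v - 1) ` open_values n \<rho>' i)"
    then consider "v = int T" | "v + 1 \<in> open_values n \<rho>' i" by force
    then show "v \<in> open_values n \<rho> i"
    proof cases
      case 2
      then obtain x where v: "0 \<le> v" "v + 1 \<le> int n" "\<rho>' (v + 1) \<le> int i" "x < v + 1" "\<rho>' x > int i"
        by (auto simp: open_values_def)
      have x: "\<bar>x\<bar> \<le> int n"
        using signed_perm_abs_leI[OF \<rho>', of x] v by simp
      have x0: "x \<noteq> 0" using v signed_0[OF \<rho>'] by auto
      have v1: "v \<ge> 1"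
      proof (rule ccontr)
        assume "\<not> v \<ge> 1"
        then have v0: "v = 0" using v by simp
        then have x1: "- x \<ge> 1" "\<rho>' (- x) < - int i" using v x0 odd'[of x] by auto
        then have "0 \<in> X" using supp'[of 0 "- x"] by force
        then show False using one[of "- x"] x1 x v v0 by auto
      qed
      have vX: "nat v \<in> X"
      proof (rule ccontr)
        assume a: "nat v \<notin> X"
        then have "\<rho>' (v + 1) = v + 1" using fixed[OF _ a] v v1 by simp
        then show False using supp'[OF a, of x] v v1 by simp
      qed
      have "\<rho> v \<le> int i" using vX v v1 unshift[of v] by (simp add: unshift_def)
      moreover have "\<exists>x<v. \<rho> x > int i"
      proof -
        consider "x \<le> -1" | "x = 1" "0 \<in> X" | "x \<ge> 2" "nat (x - 1) \<in> X" | "x \<ge> 1" "nat (x - 1) \<notin> X"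
          using x0 by (cases "x = 1") force+
        then show ?thesis
        proof cases
          case 1
          then have "\<rho> (- x - 1) = \<rho>' (- x)" "- x \<ge> 2"
            using negative_step[of "- x"] v odd'[of x] x by auto
          then have "\<rho> (x + 1) > int i" "x + 1 < v" using odd[of "- x - 1"] odd'[of x] v v1
            by (simp_all add: algebra_simps)
          then show ?thesis by blast
        next
          case 2
          define U where "U = (LEAST U. U \<notin> X)"
          have U: "U \<notin> X" "U \<le> n"
            using LeastI[of "\<lambda>U. U \<notin> X" n] Least_le[of "\<lambda>U. U \<notin> X" n] X by (auto simp: U_def)
          have "j \<in> X" if "j < U" for j
            using not_less_Least[of j "\<lambda>U. U \<notin> X"] that unfolding U_def by blast
          then have "{..<U} \<subseteq> X" by blast
          then have "run_start X U = -1" by (rule run_start_minus_1)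
          moreover have "U \<ge> 1" using U 2 by (cases "U = 0") auto
          ultimately have "\<rho> (- int U) = \<rho>' 1" using U unshift[of "- int U"] by (simp add: unshift_def)
          then show ?thesis using 2 v v1 by (intro exI[of _ "- int U"]) auto
        next
          case 3
          then have "\<rho> (x - 1) = \<rho>' x" using unshift[of "x - 1"] x by (simp add: unshift_def)
          then show ?thesis using v by (intro exI[of _ "x - 1"]) auto
        next
          case 4
          then have "\<rho>' x = x" using fixed[OF _ 4(2)] x by simp
          then show ?thesis using supp'[OF 4(2), of "v + 1"] v 4 by simp
        qed
      qed
      ultimately show ?thesis using v v1 by (auto simp: open_values_def)
    qed (use To in simp)
  qed
  moreover have "int T \<notin> (\<lambda>v. v - 1) ` open_values n \<rho>' i"
  proof
    assume "int T \<in> (\<lambda>v. v - 1) ` open_values n \<rho>' i"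
    then have "int T + 1 \<in> open_values n \<rho>' i" by force
    then show False using supp'[OF T(2), of "int T + 1"] T by (auto simp: open_values_def)
  qed
  ultimately show ?thesis using iX by (simp add: height_def card_image inj_on_def)
qed

end


lemma word_imp_sorting_pass:
  assumes X: "X \<subseteq> {..<n}" and w: "set w \<subseteq> X" and red: "reduced_word n (pass X n @ w)"
  shows "sorting_pass n X (inv (word_prod (pass X n @ w))) (inv (word_prod w))"
proof -
  let ?\<rho> = "inv (word_prod (pass X n @ w))" and ?\<rho>' = "inv (word_prod w)"
  have wn: "set w \<subseteq> {..<n}" and pn: "set (pass X n @ w) \<subseteq> {..<n}" using X w by auto
  have sp: "?\<rho> \<in> signed_perms n" "?\<rho>' \<in> signed_perms n"
    using wn pn by (auto intro!: signed_inv word_prod_signed)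
  have supp: "v > int i \<longleftrightarrow> ?\<rho> v > int i" "v > int i \<longleftrightarrow> ?\<rho>' v > int i" if "i \<notin> X" for i v
    using word_prod_support[OF pn, of i v] word_prod_support[OF wn, of i v] that w by auto
  have cond: "\<forall>s\<in>X. ?\<rho>' (run_start X s) < ?\<rho>' (int s + 1)"
    using red reduced_word_pass[OF wn, of n X] X by auto
  have F: "(\<forall>t<n. t \<notin> X \<longrightarrow> ?\<rho>' (int t + 1) = int t + 1) \<and>
    (0 \<in> X \<longrightarrow> (\<forall>k\<in>{1..int n}. - ?\<rho>' 1 < ?\<rho>' k))"
    using cond pass_condition_iff[OF sp(2) X supp(2)] by blast
  have pos: "?\<rho> x = ?\<rho>' (unshift X x)" if "1 \<le> x" "x \<le> int n" for x
  proof -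
    have "nat x < n" if "nat x \<in> X" using that X by auto
    then show ?thesis
      using word_prod_pass[OF wn, of n "nat x" X] that by (auto simp: unshift_def)
  qed
  have "?\<rho> x = ?\<rho>' (unshift X x)" if "\<bar>x\<bar> \<le> int n" for x
  proof -
    consider "x = 0" | "1 \<le> x" | "1 \<le> - x" by linarith
    then show ?thesis
    proof cases
      case 1
      then show ?thesis using sp by (simp add: unshift_def)
    next
      case 3
      have "?\<rho>' (- unshift X x) = - ?\<rho>' (unshift X x)" "?\<rho> (- x) = - ?\<rho> x"
        using signed_permsD(2)[OF sp(2)] signed_permsD(2)[OF sp(1)] by blast+
      moreover have "unshift X (- x) = - unshift X x" using 3 by (simp add: unshift_def)
      ultimately show ?thesis using pos[of "- x"] 3 that by simp
    qed (use pos that in auto)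
  qed
  then show ?thesis
    using sp X supp F by unfold_locales blast+
qed

text \<open>
  Hence the height at the gap \<open>i\<close> counts the passes that contain the letter \<open>i\<close>; as the passes are nested,
  this number tells which ones they are.
\<close>

lemma nested_passes:
  assumes "\<forall>Y\<in>set Xs. subseq Y (rev [0..<n])" "sorted_wrt (\<lambda>Y Z. set Z \<subseteq> set Y) Xs"
    "reduced_word n (concat Xs)"
  shows "avoids_231 (inv (word_prod (concat Xs))) \<and>
    (\<forall>i<n. height n (inv (word_prod (concat Xs))) i = length (filter (\<lambda>Y. i \<in> set Y) Xs))"
  using assms
proof (induction Xs)
  case Nil
  have "open_values n id i = {}" for i by (auto simp: open_values_def)
  then show ?case unfolding concat.simps word_prod_simps inv_id height_def
    by (simp add: avoids_231_def)
next
  case (Cons Y Xs)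
  let ?w = "concat Xs"
  have Y: "Y = pass (set Y) n" using subseq_imp_pass Cons.prems by auto
  then have Yn: "set Y \<subseteq> {..<n}" by (metis inf_le2 set_pass)
  have w: "set ?w \<subseteq> set Y" using Cons.prems by auto
  have red: "reduced_word n (pass (set Y) n @ ?w)" using Cons.prems Y by simp
  interpret sorting_pass n "set Y" "inv (word_prod (pass (set Y) n @ ?w))" "inv (word_prod ?w)"
    by (rule word_imp_sorting_pass[OF Yn w red])
  have "reduced_word n ?w" using red reduced_word_pass[of ?w n n "set Y"] w Yn by auto
  then have "avoids_231 (inv (word_prod ?w))"
    "\<forall>i<n. height n (inv (word_prod ?w)) i = length (filter (\<lambda>Y. i \<in> set Y) Xs)"
    using Cons by auto
  moreover have "concat (Y # Xs) = pass (set Y) n @ ?w" using Y by simp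
  ultimately show ?case using avoids_231_step height_step by simp
qed

lemma nested_member_iff:
  assumes "sorted_wrt (\<lambda>Y Z. set Z \<subseteq> set Y) Xs" "l < length Xs"
  shows "i \<in> set (Xs ! l) \<longleftrightarrow> l < length (filter (\<lambda>Y. i \<in> set Y) Xs)"
  using assms
proof (induction Xs arbitrary: l)
  case (Cons Y Xs)
  show ?case
  proof (cases "i \<in> set Y")
    case True
    then show ?thesis using Cons by (cases l) auto
  next
    case False
    then have "\<forall>Z\<in>set Xs. i \<notin> set Z" using Cons.prems by auto
    moreover from this have "filter (\<lambda>Y. i \<in> set Y) Xs = []" by (simp add: filter_empty_conv)
    ultimately show ?thesis using False Cons.prems by (cases l) auto
  qed
qed simp

definition passes_from :: "nat \<Rightarrow> (nat \<Rightarrow> nat) \<Rightarrow> nat \<Rightarrow> nat list list" where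
  "passes_from n H l = map (\<lambda>j. pass {i. i < n \<and> j < H i} n) [l..<n]"

lemma Sort_B_iff:
  "\<sigma> \<in> Sort_B n \<longleftrightarrow> (\<exists>Xs. length Xs = n \<and> (\<forall>Y\<in>set Xs. subseq Y (rev [0..<n])) \<and>
     sorted_wrt (\<lambda>Y Z. set Z \<subseteq> set Y) Xs \<and> reduced_word n (concat Xs) \<and> word_prod (concat Xs) = \<sigma>)"
proof -
  have tr: "transp (\<lambda>Y Z. set Z \<subseteq> set (Y :: nat list))" by (auto intro: transpI)
  have "\<sigma> \<in> signed_perms n" if "reduced_word n (concat Xs)" "word_prod (concat Xs) = \<sigma>" for Xs
    using that word_prod_signed[of "concat Xs" n] unfolding reduced_word_iff by blast
  then show ?thesis
    unfolding Sort_B_def sorted_wrt_iff_nth_Suc_transp[OF tr] by blast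
qed

lemma Sort_B_heights:
  assumes "\<sigma> \<in> Sort_B n"
  shows "\<sigma> \<in> signed_perms n" "avoids_231 (inv \<sigma>)"
    "\<sigma> = word_prod (concat (passes_from n (height n (inv \<sigma>)) 0))"
proof -
  obtain Xs where Xs: "length Xs = n" "\<forall>Y\<in>set Xs. subseq Y (rev [0..<n])"
    "sorted_wrt (\<lambda>Y Z. set Z \<subseteq> set Y) Xs" "reduced_word n (concat Xs)" "word_prod (concat Xs) = \<sigma>"
    using assms unfolding Sort_B_iff by blast
  show "\<sigma> \<in> signed_perms n" using assms by (simp add: Sort_B_def)
  note np = nested_passes[OF Xs(2-4)]
  show "avoids_231 (inv \<sigma>)" using np Xs(5) by simp
  have "Xs = passes_from n (height n (inv \<sigma>)) 0"
  proof (rule nth_equalityI)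
    fix l assume l: "l < length Xs"
    have p: "Xs ! l = pass (set (Xs ! l)) n" using subseq_imp_pass Xs(2) l by auto
    then have "set (Xs ! l) \<subseteq> {..<n}" by (metis inf_le2 set_pass)
    then have "set (Xs ! l) = {i. i < n \<and> l < height n (inv \<sigma>) i}"
      using nested_member_iff[OF Xs(3) l] np Xs(5) by auto
    then show "Xs ! l = passes_from n (height n (inv \<sigma>)) 0 ! l"
      using p l Xs(1) by (simp add: passes_from_def)
  qed (simp add: Xs(1) passes_from_def)
  then show "\<sigma> = word_prod (concat (passes_from n (height n (inv \<sigma>)) 0))" using Xs(5) by simp
qed

section \<open>Which height profiles occur\<close>

text \<open>
  Reading an entry opens at most one value. A height above \<open>i + 1\<close> at the gap \<open>i\<close> forces a negative entry
  beyond the position \<open>i + 1\<close>; being smaller than every positive value, it prevents any of them from being closed.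
\<close>

definition valid_heights :: "nat \<Rightarrow> (nat \<Rightarrow> nat) \<Rightarrow> bool" where
  "valid_heights n H \<longleftrightarrow> H n = 0 \<and>
     (\<forall>i<n. H (Suc i) \<le> Suc (H i) \<and> (Suc i < H i \<longrightarrow> H i \<le> H (Suc i)))"

lemma finite_sub_interval: "finite {v \<in> {a..b :: int}. P v}"
  by (rule finite_subset[of _ "{a..b}"]) auto

lemma bij_betw_abs:
  assumes "\<rho> \<in> signed_perms n"
  shows "bij_betw (\<lambda>v. \<bar>\<rho> v\<bar>) {1..int n} {1..int n}"
proof -
  have inj: "inj_on (\<lambda>v. \<bar>\<rho> v\<bar>) {1..int n}"
  proof (rule inj_onI)
    fix u v assume uv: "u \<in> {1..int n}" "v \<in> {1..int n}" "\<bar>\<rho> u\<bar> = \<bar>\<rho> v\<bar>"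
    then have "\<rho> u = \<rho> v \<or> \<rho> u = \<rho> (- v)" using signed_permsD(2)[OF assms, of v] by auto
    then have "u = v \<or> u = - v" unfolding inj_eq[OF signed_permsD(4)[OF assms]] .
    then show "u = v" using uv by auto
  qed
  have sub: "(\<lambda>v. \<bar>\<rho> v\<bar>) ` {1..int n} \<subseteq> {1..int n}"
  proof (rule image_subsetI)
    fix v assume v: "v \<in> {1..int n}"
    then have "\<bar>\<rho> v\<bar> \<le> int n" unfolding signed_perm_abs_le[OF assms] by simp
    moreover have "\<rho> v \<noteq> 0" unfolding signed_perm_eq_0[OF assms] using v by simp
    ultimately show "\<bar>\<rho> v\<bar> \<in> {1..int n}" by simp
  qed
  from endo_inj_surj[OF finite_atLeastAtMost_int sub inj] inj show ?thesis
    unfolding bij_betw_def by (rule conjI[rotated])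
qed

lemma card_abs_le:
  assumes "\<rho> \<in> signed_perms n" "i \<le> n"
  shows "card {v \<in> {1..int n}. \<bar>\<rho> v\<bar> \<le> int i} = i"
proof -
  note b = bij_betw_abs[OF assms(1)]
  have "bij_betw (\<lambda>v. \<bar>\<rho> v\<bar>) {v \<in> {1..int n}. \<bar>\<rho> v\<bar> \<le> int i} {1..int i}"
  proof (rule bij_betw_subset[OF b])
    have "x \<in> (\<lambda>v. \<bar>\<rho> v\<bar>) ` {v \<in> {1..int n}. \<bar>\<rho> v\<bar> \<le> int i}" if x: "x \<in> {1..int i}" for x
    proof -
      have "x \<in> (\<lambda>v. \<bar>\<rho> v\<bar>) ` {1..int n}" using b x assms(2) by (auto simp: bij_betw_def)
      then show ?thesis using x by auto
    qed
    moreover have "\<bar>\<rho> v\<bar> \<ge> 1" if "v \<in> {1..int n}" for v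
      using bij_betwE[OF b] that by auto
    ultimately show "(\<lambda>v. \<bar>\<rho> v\<bar>) ` {v \<in> {1..int n}. \<bar>\<rho> v\<bar> \<le> int i} = {1..int i}" by auto
  qed auto
  from bij_betw_same_card[OF this] show ?thesis by simp
qed

lemma height_0:
  assumes \<rho>: "\<rho> \<in> signed_perms n" shows "height n \<rho> 0 = neg n \<rho>"
proof -
  have "v \<in> open_values n \<rho> 0 \<longleftrightarrow> v \<in> {1..int n} \<and> \<rho> v < 0" for v
  proof (cases "v \<in> {1..int n}")
    case True
    have ex: "\<exists>x<v. \<rho> x > 0" if "\<rho> v < 0"
      by (rule exI[of _ "- v"]) (use that True signed_permsD(2)[OF \<rho>, of v] in simp)
    have "\<rho> v \<noteq> 0" using True signed_perm_eq_0[OF \<rho>, of v] by auto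
    with ex have "\<rho> v \<le> 0 \<and> (\<exists>x<v. \<rho> x > 0) \<longleftrightarrow> \<rho> v < 0" by (cases "\<rho> v < 0") auto
    then show ?thesis using True by (simp add: open_values_def)
  qed (auto simp: open_values_def)
  then have "open_values n \<rho> 0 = {i \<in> {1..int n}. \<rho> i < 0}" by auto
  then show ?thesis by (simp add: height_def neg_def)
qed

lemma open_values_Suc_subset:
  assumes \<rho>: "\<rho> \<in> signed_perms n" and u: "\<rho> u = int i + 1"
  shows "open_values n \<rho> (Suc i) \<subseteq> insert u (open_values n \<rho> i)"
proof
  fix v assume "v \<in> open_values n \<rho> (Suc i)"
  then obtain x where v: "v \<in> {1..int n}" "\<rho> v \<le> int i + 1" "x < v" "\<rho> x > int i + 1"
    by (auto simp: open_values_def)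
  show "v \<in> insert u (open_values n \<rho> i)"
  proof (cases "\<rho> v = int i + 1")
    case True
    then have "\<rho> v = \<rho> u" using u by simp
    then show ?thesis by (simp add: inj_eq[OF signed_permsD(4)[OF \<rho>]])
  next
    case False
    then have "\<rho> v \<le> int i" "\<rho> x > int i" using v by auto
    then show ?thesis using v by (auto simp: open_values_def)
  qed
qed

lemma signed_perm_valid_heights:
  assumes \<rho>: "\<rho> \<in> signed_perms n" shows "valid_heights n (height n \<rho>)"
  unfolding valid_heights_def
proof (intro conjI allI impI)
  have "open_values n \<rho> n = {}"
  proof (rule ccontr)
    assume "open_values n \<rho> n \<noteq> {}"
    then obtain x v where "v \<le> int n" "x < v" "\<rho> x > int n" by (auto simp: open_values_def)
    then show False using signed_perm_abs_leI[OF \<rho>, of x] signed_perm_abs_le[OF \<rho>, of x] by auto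
  qed
  then show "height n \<rho> n = 0" by (simp add: height_def)
next
  fix i assume "i < n"
  obtain u where u: "\<rho> u = int i + 1" using signed_permsD(3)[OF \<rho>] by (metis bij_is_surj surjD)
  from open_values_Suc_subset[OF \<rho> u]
  have "height n \<rho> (Suc i) \<le> card (insert u (open_values n \<rho> i))"
    unfolding height_def by (rule card_mono[rotated]) simp
  also have "\<dots> \<le> Suc (height n \<rho> i)" by (simp add: height_def card_insert_if)
  finally show "height n \<rho> (Suc i) \<le> Suc (height n \<rho> i)" .
  assume big: "Suc i < height n \<rho> i"
  have "\<not> open_values n \<rho> i \<subseteq> {v \<in> {1..int n}. \<bar>\<rho> v\<bar> \<le> int (Suc i)}"
  proof
    assume "open_values n \<rho> i \<subseteq> {v \<in> {1..int n}. \<bar>\<rho> v\<bar> \<le> int (Suc i)}"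
    then have "height n \<rho> i \<le> card {v \<in> {1..int n}. \<bar>\<rho> v\<bar> \<le> int (Suc i)}"
      unfolding height_def by (rule card_mono[OF finite_sub_interval])
    then have "height n \<rho> i \<le> Suc i" using card_abs_le[OF \<rho>, of "Suc i"] \<open>i < n\<close> by simp
    then show False using big by simp
  qed
  then obtain v where "v \<in> open_values n \<rho> i" "v \<notin> {v \<in> {1..int n}. \<bar>\<rho> v\<bar> \<le> int (Suc i)}" by blast
  then have v: "1 \<le> v" "\<rho> v \<le> int i" "\<bar>\<rho> v\<bar> > int (Suc i)"
    by (auto simp: open_values_def)
  then have "\<rho> (- v) > int (Suc i)" using signed_permsD(2)[OF \<rho>, of v] by auto
  have "open_values n \<rho> i \<subseteq> open_values n \<rho> (Suc i)"
  proof
    fix u assume "u \<in> open_values n \<rho> i"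
    then have u: "u \<in> {1..int n}" "\<rho> u \<le> int (Suc i)" by (auto simp: open_values_def)
    then have "\<exists>x<u. \<rho> x > int (Suc i)"
      using \<open>\<rho> (- v) > int (Suc i)\<close> v(1) by (intro exI[of _ "- v"]) auto
    then show "u \<in> open_values n \<rho> (Suc i)" using u by (simp add: open_values_def)
  qed
  then show "height n \<rho> i \<le> height n \<rho> (Suc i)"
    unfolding height_def by (simp add: card_mono)
qed

text \<open>
  If no value is open, all values read so far are smaller than all values to come, and counting shows
  that the permutation respects the gap.
\<close>

lemma height_eq_0_imp:
  assumes \<rho>: "\<rho> \<in> signed_perms n" and "i \<le> n" and h: "height n \<rho> i = 0"
  shows "v > int i \<longleftrightarrow> \<rho> v > int i"
proof -
  let ?A = "{int i + 1..int n}"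
  have inj: "inj_on \<rho> ?A" by (rule inj_on_subset[OF signed_permsD(4)[OF \<rho>] subset_UNIV])
  have "open_values n \<rho> i = {}" using h by (simp add: height_def)
  have sub: "\<rho> ` ?A \<subseteq> ?A"
  proof (rule ccontr)
    assume "\<not> \<rho> ` ?A \<subseteq> ?A"
    then obtain v where v: "v \<in> ?A" "\<rho> v \<notin> ?A" by blast
    moreover have "\<rho> v \<le> int n" using signed_perm_abs_le[OF \<rho>, of v] v by auto
    ultimately have "\<rho> v \<le> int i" by auto
    have "\<not> ?A \<subseteq> \<rho> ` ?A"
    proof
      assume "?A \<subseteq> \<rho> ` ?A"
      then have "?A = \<rho> ` ?A" using card_image[OF inj] by (intro card_subset_eq) auto
      then show False using v by blast
    qed
    then obtain p where p: "p \<in> ?A" "p \<notin> \<rho> ` ?A" by blast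
    obtain x where x: "\<rho> x = p" using signed_permsD(3)[OF \<rho>] by (metis bij_is_surj surjD)
    have "x \<le> int n" using x p signed_perm_abs_le[OF \<rho>, of x] by auto
    moreover have "x \<notin> ?A" using x p by auto
    ultimately have "x \<le> int i" by auto
    then have "x < v" "\<rho> x > int i" using v(1) p(1) unfolding x by auto
    then have "\<exists>x<v. \<rho> x > int i" by blast
    then have "v \<in> open_values n \<rho> i"
      using v \<open>\<rho> v \<le> int i\<close> by (auto simp: open_values_def)
    then show False using \<open>open_values n \<rho> i = {}\<close> by simp
  qed
  have eq: "\<rho> ` ?A = ?A" by (intro endo_inj_surj sub inj) simp
  show ?thesis
  proof (cases "\<bar>v\<bar> \<le> int n")
    case True
    then have "\<bar>\<rho> v\<bar> \<le> int n" using signed_perm_abs_le[OF \<rho>] by simp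
    moreover have "\<rho> v \<in> ?A \<longleftrightarrow> v \<in> ?A"
      using inj_image_mem_iff[OF signed_permsD(4)[OF \<rho>], of v ?A] unfolding eq .
    ultimately show ?thesis using True by auto
  next
    case False
    then have "\<rho> v = v" by (intro signed_perm_outside[OF \<rho>]) simp
    then show ?thesis by simp
  qed
qed

text \<open>
  Failure of the condition on the value 1 in a sorting pass is visible in the heights around
  the last negative position \<open>p\<close>.
\<close>

lemma one_not_last_heights:
  assumes \<rho>: "\<rho> \<in> signed_perms n" and k: "k \<in> {1..int n}" "\<rho> k \<le> - \<rho> 1"
  obtains p where "1 \<le> p" "p \<le> n" "height n \<rho> (p - 1) = p" "height n \<rho> p < p"
proof -
  note odd = signed_permsD(2)[OF \<rho>]
  define N where "N = (\<lambda>v. - \<rho> v) ` {v \<in> {1..int n}. \<rho> v < 0}"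
  have fin: "finite N" unfolding N_def by (intro finite_imageI finite_sub_interval)
  have one: "1 \<in> {1..int n}" using k by auto
  have k_or_1: "\<rho> 1 < 0 \<or> (\<rho> k < 0 \<and> \<rho> 1 \<ge> 0)"
    using k signed_perm_eq_0[OF \<rho>, of 1] by (cases "\<rho> 1 < 0") auto
  then have "\<exists>v\<in>{1..int n}. \<rho> v < 0" using k(1) one by blast
  then have ne: "N \<noteq> {}" unfolding N_def by blast
  \<comment> \<open>The last position with a negative entry.\<close>
  define p where "p = Max N"
  have "p \<in> N" using Max_in[OF fin ne] by (simp add: p_def)
  then obtain w where w: "w \<in> {1..int n}" "\<rho> w = - p" "p > 0" by (auto simp: N_def)
  have max: "- \<rho> v \<le> p" if "v \<in> {1..int n}" for v
  proof (cases "\<rho> v < 0")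
    case True
    then show ?thesis using that fin by (auto simp: p_def N_def intro!: Max_ge)
  qed (use w in auto)
  have one_le: "\<bar>\<rho> 1\<bar> \<le> p" using k_or_1 max[OF one] max[OF k(1)] k(2) by auto
  have pn: "p \<le> int n" using signed_perm_abs_le[OF \<rho>, of w] w by auto
  define q where "q = nat p"
  have q: "p = int q" "1 \<le> q" "q \<le> n" using w pn by (auto simp: q_def)
  have le_iff: "\<rho> v \<le> int (q - 1) \<longleftrightarrow> \<bar>\<rho> v\<bar> \<le> int q" if "v \<in> {1..int n}" for v
  proof -
    have "\<rho> v \<noteq> p"
    proof
      assume "\<rho> v = p"
      then have "\<rho> v = \<rho> (- w)" using w odd[of w] by simp
      then have "v = - w" by (simp add: inj_eq[OF signed_permsD(4)[OF \<rho>]])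
      then show False using that w by auto
    qed
    then show ?thesis using max[OF that] q by auto
  qed
  have w1: "\<rho> (- w) > int (q - 1)" "- w < 1" using w q odd[of w] by auto
  have "v \<in> open_values n \<rho> (q - 1) \<longleftrightarrow> v \<in> {1..int n} \<and> \<bar>\<rho> v\<bar> \<le> int q" for v
  proof (cases "v \<in> {1..int n}")
    case True
    have "\<exists>x<v. \<rho> x > int (q - 1)" by (rule exI[of _ "- w"]) (use w1 True in simp)
    then show ?thesis using True le_iff[OF True] by (simp add: open_values_def)
  qed (auto simp: open_values_def)
  then have "open_values n \<rho> (q - 1) = {v \<in> {1..int n}. \<bar>\<rho> v\<bar> \<le> int q}" by blast
  then have h1: "height n \<rho> (q - 1) = q" using card_abs_le[OF \<rho> q(3)] by (simp add: height_def)
  have "v \<noteq> 1 \<and> \<bar>\<rho> v\<bar> \<le> int q" if vo: "v \<in> open_values n \<rho> q" for v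
  proof -
    obtain x where x: "v \<in> {1..int n}" "\<rho> v \<le> int q" "x < v" "\<rho> x > int q"
      using vo unfolding open_values_def by blast
    have "x \<le> int n" "0 \<le> \<rho> x" using x(1,3,4) by simp_all
    then have xn: "\<bar>x\<bar> \<le> int n" by (rule signed_perm_abs_leI[OF \<rho>])
    have "\<not> x \<le> -1"
    proof
      assume "x \<le> -1"
      then have "- x \<in> {1..int n}" using xn by simp
      then have "- \<rho> (- x) \<le> int q" using max q(1) by blast
      then show False unfolding odd using x(4) by linarith
    qed
    moreover have "x \<noteq> 0" using x(4) signed_0[OF \<rho>] by auto
    ultimately have "v \<noteq> 1" using x(3) by linarith
    moreover have "- \<rho> v \<le> int q" using max[OF x(1)] unfolding q(1) .
    ultimately show ?thesis using x(2) by linarith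
  qed
  then have sub: "open_values n \<rho> q \<subseteq> {v \<in> {1..int n}. \<bar>\<rho> v\<bar> \<le> int q} - {1}"
    using open_values_range by blast
  have "height n \<rho> q \<le> card ({v \<in> {1..int n}. \<bar>\<rho> v\<bar> \<le> int q} - {1})"
    unfolding height_def by (rule card_mono[OF finite_Diff[OF finite_sub_interval] sub])
  also have "\<dots> = q - 1"
  proof -
    have "1 \<in> {v \<in> {1..int n}. \<bar>\<rho> v\<bar> \<le> int q}"
      using one one_le unfolding q(1) by (intro CollectI conjI)
    from card_Diff_singleton[OF this] show ?thesis unfolding card_abs_le[OF \<rho> q(3)] .
  qed
  finally have "height n \<rho> q < q" using q(2) by linarith
  show thesis by (rule that[OF q(2,3) h1 \<open>height n \<rho> q < q\<close>])
qed


lemma valid_heights_le: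
  assumes "valid_heights n H" "i \<le> n" shows "H i \<le> n"
proof (rule ccontr)
  assume "\<not> H i \<le> n"
  have "n < H j" if "i \<le> j" "j \<le> n" for j
    using that
  proof (induction j rule: dec_induct)
    case (step j)
    then have "Suc j < H j" by simp
    then have "H j \<le> H (Suc j)" using assms(1) step by (auto simp: valid_heights_def)
    then show ?case using step by simp
  qed (use \<open>\<not> H i \<le> n\<close> in simp)
  from this[of n] assms show False by (simp add: valid_heights_def)
qed

lemma passes_from_props:
  shows "\<forall>Y\<in>set (passes_from n H l). subseq Y (rev [0..<n])"
    and "sorted_wrt (\<lambda>Y Z. set Z \<subseteq> set Y) (passes_from n H l)"
proof -
  show "\<forall>Y\<in>set (passes_from n H l). subseq Y (rev [0..<n])"
    by (auto simp: passes_from_def subseq_pass)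
  have "sorted_wrt (\<lambda>j k. set (pass {i. i < n \<and> k < H i} n) \<subseteq> set (pass {i. i < n \<and> j < H i} n)) [l..<n]"
    by (rule sorted_wrt_mono_rel[OF _ sorted_wrt_upt]) auto
  then show "sorted_wrt (\<lambda>Y Z. set Z \<subseteq> set Y) (passes_from n H l)"
    by (simp add: passes_from_def sorted_wrt_map)
qed

lemma count_passes_from:
  assumes "valid_heights n H" "i < n"
  shows "length (filter (\<lambda>Y. i \<in> set Y) (passes_from n H l)) = H i - l"
proof -
  have "length (filter (\<lambda>Y. i \<in> set Y) (passes_from n H l)) = length (filter (\<lambda>j. j < H i) [l..<n])"
    using assms(2) by (simp add: passes_from_def filter_map comp_def)
  also have "\<dots> = card (set (filter (\<lambda>j. j < H i) [l..<n]))"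
    by (rule distinct_card[symmetric]) simp
  also have "set (filter (\<lambda>j. j < H i) [l..<n]) = {l..<H i}"
    using valid_heights_le[OF assms(1), of i] assms(2) by auto
  finally show ?thesis by simp
qed

text \<open>
  The passes are added from the last one to the first one. The two conditions on the heights supply the
  two conditions for a further pass: a letter missing in the pass has height 0 at the next gap, so that a
  fixed point follows, and the condition on the value 1 could fail only where the heights drop too early.
\<close>

lemma valid_heights_reduced:
  assumes H: "valid_heights n H" and "l \<le> n"
  shows "reduced_word n (concat (passes_from n H l))"
  using assms(2)
proof (induction rule: inc_induct)
  case base
  show ?case by (simp add: passes_from_def reduced_word_def)
next
  case (step l)
  define X where "X = {i. i < n \<and> l < H i}"
  let ?w = "concat (passes_from n H (Suc l))" and ?\<rho> = "inv (word_prod (concat (passes_from n H (Suc l))))"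
  have eq: "concat (passes_from n H l) = pass X n @ ?w"
    using step.hyps by (simp add: passes_from_def upt_conv_Cons X_def)
  have wX: "set ?w \<subseteq> X" by (auto simp: passes_from_def X_def)
  have X: "X \<subseteq> {..<n}" by (auto simp: X_def)
  have wn: "set ?w \<subseteq> {..<n}" using wX X by blast
  have \<rho>: "?\<rho> \<in> signed_perms n" using wn by (intro signed_inv word_prod_signed)
  have supp: "v > int i \<longleftrightarrow> ?\<rho> v > int i" if "i \<notin> X" for i v
    by (rule word_prod_support[OF wn]) (use that wX in blast)
  have "height n ?\<rho> i = H i - Suc l" if "i < n" for i
    using nested_passes[OF passes_from_props step.IH] count_passes_from[OF H that] that by simp
  moreover have "height n ?\<rho> n = H n - Suc l"
    using signed_perm_valid_heights[OF \<rho>] H by (simp add: valid_heights_def)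
  ultimately have h: "height n ?\<rho> i = H i - Suc l" if "i \<le> n" for i
    using that by (cases "i = n") auto
  have "?\<rho> (int t + 1) = int t + 1" if t: "t < n" "t \<notin> X" for t
  proof -
    have "H t \<le> l" using t by (simp add: X_def)
    then have "H (Suc t) \<le> Suc l" using H t(1) by (force simp: valid_heights_def)
    then have "height n ?\<rho> (Suc t) = 0" using h t by simp
    then have "\<not> ?\<rho> (int t + 1) > int (Suc t)"
      using height_eq_0_imp[OF \<rho> _ \<open>height n ?\<rho> (Suc t) = 0\<close>, of "int t + 1"] t by simp
    moreover have "?\<rho> (int t + 1) > int t" using supp[OF t(2), of "int t + 1"] by simp
    ultimately show ?thesis by simp
  qed
  moreover have "- ?\<rho> 1 < ?\<rho> k" if k: "0 \<in> X" "k \<in> {1..int n}" for k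
  proof (rule ccontr)
    assume "\<not> - ?\<rho> 1 < ?\<rho> k"
    then have "?\<rho> k \<le> - ?\<rho> 1" by simp
    from one_not_last_heights[OF \<rho> k(2) this] obtain p where
      p: "1 \<le> p" "p \<le> n" "height n ?\<rho> (p - 1) = p" "height n ?\<rho> p < p" by blast
    have "p - 1 < n" "p - 1 \<le> n" using p(1,2) by simp_all
    have "p = H (p - 1) - Suc l" "H p - Suc l < p"
      using h[OF \<open>p - 1 \<le> n\<close>] h[OF p(2)] p(3,4) by simp_all
    then have "H (p - 1) = p + Suc l" "H p < p + Suc l" using p(1) by linarith+
    moreover have "Suc (p - 1) < H (p - 1) \<longrightarrow> H (p - 1) \<le> H (Suc (p - 1))"
      using H \<open>p - 1 < n\<close> unfolding valid_heights_def by blast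
    ultimately show False using p(1) by simp
  qed
  ultimately have "\<forall>t\<in>X. ?\<rho> (run_start X t) < ?\<rho> (int t + 1)"
    using pass_condition_iff[OF \<rho> X supp] by blast
  then show ?case unfolding eq reduced_word_pass[OF wn order_refl] using step.IH by blast
qed

lemma valid_heights_Sort_B:
  assumes H: "valid_heights n H"
  obtains \<sigma> where "\<sigma> \<in> Sort_B n" "\<And>i. i \<le> n \<Longrightarrow> height n (inv \<sigma>) i = H i"
proof -
  let ?Xs = "passes_from n H 0" and ?\<sigma> = "word_prod (concat (passes_from n H 0))"
  have red: "reduced_word n (concat ?Xs)" by (rule valid_heights_reduced[OF H]) simp
  have S: "?\<sigma> \<in> Sort_B n"
    unfolding Sort_B_iff using passes_from_props red
    by (intro exI[of _ ?Xs]) (simp add: passes_from_def)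
  have "height n (inv ?\<sigma>) i = H i" if "i \<le> n" for i
  proof (cases "i = n")
    case True
    have "inv ?\<sigma> \<in> signed_perms n" using Sort_B_heights(1)[OF S] by (rule signed_inv)
    from signed_perm_valid_heights[OF this] H show ?thesis by (simp add: True valid_heights_def)
  next
    case False
    then show ?thesis
      using nested_passes[OF passes_from_props red] count_passes_from[OF H] that by simp
  qed
  with S show thesis by (rule that)
qed

lemma Sort_B_eqI:
  assumes "\<sigma> \<in> Sort_B n" "\<tau> \<in> Sort_B n"
    and "\<And>i. i < n \<Longrightarrow> height n (inv \<sigma>) i = height n (inv \<tau>) i"
  shows "\<sigma> = \<tau>"
proof -
  have "passes_from n (height n (inv \<sigma>)) 0 = passes_from n (height n (inv \<tau>)) 0"
    unfolding passes_from_def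
    by (intro map_cong refl arg_cong2[where f = pass] Collect_cong) (use assms(3) in auto)
  then show ?thesis using Sort_B_heights(3)[OF assms(1)] Sort_B_heights(3)[OF assms(2)] by simp
qed

section \<open>Descents of sortable elements\<close>

locale avoiding_perm =
  fixes n :: nat and \<rho> :: "int \<Rightarrow> int"
  assumes \<rho>: "\<rho> \<in> signed_perms n" and avoids: "avoids_231 \<rho>"
begin

abbreviation "S \<equiv> open_values n \<rho>"
abbreviation "H \<equiv> height n \<rho>"

lemmas odd = signed_permsD(2)[OF \<rho>]
lemmas inj = inj_eq[OF signed_permsD(4)[OF \<rho>]]

lemma no_231: "x < y \<Longrightarrow> y < z \<Longrightarrow> 0 < y \<Longrightarrow> \<rho> y < \<rho> z \<Longrightarrow> \<not> \<rho> z < \<rho> x"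
  using avoids unfolding avoids_231_def by blast

lemma inv_app: "\<rho> (inv \<rho> i) = i"
  using signed_permsD(3)[OF \<rho>] by (simp add: bij_is_surj surj_f_inv_f)

lemma range_abs: "x \<le> int n \<Longrightarrow> 0 \<le> \<rho> x \<Longrightarrow> - x \<le> int n"
  using signed_perm_abs_leI[OF \<rho>, of x] by linarith

text \<open>
  Some entry still to come is negative. As all positive values exceed it, each of them stays open once it has
  been read.
\<close>

definition pending :: "nat \<Rightarrow> bool" where
  "pending i \<longleftrightarrow> (\<exists>x<0. \<rho> x > int i)"

lemma pending_mono: "pending j \<Longrightarrow> i \<le> j \<Longrightarrow> pending i"
  unfolding pending_def by (meson le_less_trans of_nat_le_iff)

lemma S_pending:
  assumes "pending i" shows "S i = {v \<in> {1..int n}. \<rho> v \<le> int i}"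
proof -
  obtain x where x: "x < 0" "\<rho> x > int i" using assms by (auto simp: pending_def)
  have "\<exists>x<v. \<rho> x > int i" if "v \<in> {1..int n}" for v
    by (rule exI[of _ x]) (use x that in simp)
  then show ?thesis unfolding open_values_def by blast
qed

lemma abs_le_if_not_pending:
  assumes "\<not> pending i" "v \<ge> 1" shows "\<rho> v \<le> int i \<longleftrightarrow> \<bar>\<rho> v\<bar> \<le> int i"
proof -
  have "- v < 0" using assms(2) by simp
  then have "\<not> \<rho> (- v) > int i" using assms(1) unfolding pending_def by blast
  then show ?thesis unfolding odd by linarith
qed

lemma pending_iff:
  assumes "i \<le> n" shows "pending i \<longleftrightarrow> i < H i"
proof
  assume p: "pending i"
  obtain x where x: "x < 0" "\<rho> x > int i" using p by (auto simp: pending_def)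
  let ?A = "{v \<in> {1..int n}. \<bar>\<rho> v\<bar> \<le> int i}"
  have "- x \<le> int n" by (rule range_abs) (use x in simp_all)
  moreover have "\<rho> (- x) < - int i" unfolding odd using x by simp
  ultimately have "- x \<in> S i - ?A" using x unfolding S_pending[OF p] by simp
  moreover have "?A \<subseteq> S i" unfolding S_pending[OF p] by auto
  ultimately have "?A \<subset> S i" by blast
  then have "card ?A < card (S i)" by (rule psubset_card_mono[OF finite_open_values])
  then show "i < H i" unfolding card_abs_le[OF \<rho> assms] height_def .
next
  assume "i < H i"
  show "pending i"
  proof (rule ccontr)
    assume np: "\<not> pending i"
    have "S i \<subseteq> {v \<in> {1..int n}. \<bar>\<rho> v\<bar> \<le> int i}"
    proof
      fix v assume "v \<in> S i"
      then have "v \<in> {1..int n}" "\<rho> v \<le> int i" by (simp_all add: open_values_def)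
      then show "v \<in> {v \<in> {1..int n}. \<bar>\<rho> v\<bar> \<le> int i}" using abs_le_if_not_pending[OF np, of v] by simp
    qed
    then have "H i \<le> card {v \<in> {1..int n}. \<bar>\<rho> v\<bar> \<le> int i}"
      unfolding height_def by (rule card_mono[OF finite_sub_interval])
    then show False using \<open>i < H i\<close> unfolding card_abs_le[OF \<rho> assms] by simp
  qed
qed

lemma height_insert: "S i = insert a (S j) \<Longrightarrow> a \<notin> S j \<Longrightarrow> H i = Suc (H j)"
  by (simp add: height_def)

lemma height_mono: "S i \<subseteq> S j \<Longrightarrow> H i \<le> H j"
  unfolding height_def by (rule card_mono[OF finite_open_values])

lemma S_Suc_subset: "\<rho> u = int (Suc i) \<Longrightarrow> u < 0 \<Longrightarrow> S (Suc i) \<subseteq> S i"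
  using open_values_Suc_subset[OF \<rho>, of u i] open_values_range[of n \<rho> "Suc i"] by fastforce

text \<open>
  An entry that is opened exceeds a later one and hence, in the absence of the pattern 231, also the next
  one. As long as a negative entry is still to come, every positive entry is opened, so that a height
  that does not rise marks a negative entry; a negative entry is smaller than the entry before it.
\<close>

lemma descent_iff:
  assumes i: "1 \<le> i" "i < n"
  shows "inv \<rho> (int i) > inv \<rho> (int i + 1) \<longleftrightarrow> H i = Suc (H (i - 1)) \<or> (i < H i \<and> H (Suc i) \<le> H i)"
proof -
  define a b where "a = inv \<rho> (int i)" and "b = inv \<rho> (int i + 1)"
  have a: "\<rho> a = int i" and b: "\<rho> b = int i + 1" by (simp_all add: a_def b_def inv_app)
  have ab0: "a \<noteq> 0" "b \<noteq> 0" using a b i signed_0[OF \<rho>] by auto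
  have ab: "a \<noteq> b" using a b by auto
  have an: "a \<le> int n" "b \<le> int n"
    using signed_perm_abs_le[OF \<rho>, of a] signed_perm_abs_le[OF \<rho>, of b] a b i by auto
  obtain k where k: "i = Suc k" using i by (cases i) auto
  have Sk: "a \<notin> S k" using a k by (simp add: open_values_def)
  have "a > b \<longleftrightarrow> H i = Suc (H k) \<or> (i < H i \<and> H (Suc i) \<le> H i)"
  proof (cases "pending i")
    case p: True
    obtain x0 where x0: "x0 < 0" "\<rho> x0 > int i" using p by (auto simp: pending_def)
    have pk: "pending k" using p k pending_mono by simp
    have Si: "v \<in> S i \<longleftrightarrow> v \<in> {1..int n} \<and> \<rho> v \<le> int i" for v unfolding S_pending[OF p] by simp
    have Sk': "v \<in> S k \<longleftrightarrow> v \<in> {1..int n} \<and> \<rho> v \<le> int k" for v unfolding S_pending[OF pk] by simp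
    have le_k: "\<rho> v \<le> int i \<longleftrightarrow> v = a \<or> \<rho> v \<le> int k" for v
      using inj[of v a] a k by auto
    show ?thesis
    proof (cases "a > 0")
      case True
      then have "S i = insert a (S k)" unfolding set_eq_iff insert_iff Si Sk' le_k using an by auto
      then have "H i = Suc (H k)" using Sk by (rule height_insert)
      moreover have "a > b"
      proof (rule ccontr)
        assume "\<not> a > b"
        then have "a < b" using ab by simp
        moreover have "\<rho> x0 \<noteq> \<rho> b" unfolding inj using x0 True \<open>a < b\<close> by simp
        ultimately show False using no_231[of x0 a b] x0 a b True by simp
      qed
      ultimately show ?thesis by simp
    next
      case False
      then have a0: "a < 0" using ab0 by simp
      have "S i = S k" unfolding set_eq_iff Si Sk' le_k using a0 by auto
      then have "H i = H k" by (simp add: height_def)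
      moreover have "i < H i" using pending_iff p i by simp
      moreover have "a > b \<longleftrightarrow> H (Suc i) \<le> H i"
      proof (cases "b < 0")
        case True
        have "a > b"
        proof (rule ccontr)
          assume "\<not> a > b"
          moreover have "\<rho> (- b) = - int i - 1" "\<rho> (- a) = - int i" unfolding odd a b by simp_all
          ultimately show False using no_231[of a "- b" "- a"] ab a i True a0 by simp
        qed
        moreover have "S (Suc i) \<subseteq> S i" by (rule S_Suc_subset[of b]) (use b True in simp_all)
        ultimately show ?thesis using height_mono by simp
      next
        case False
        then have b0: "b > 0" using ab0 by simp
        have "\<rho> x0 \<noteq> \<rho> b" unfolding inj using x0 b0 by simp
        then have p': "pending (Suc i)" unfolding pending_def using x0 b by (intro exI[of _ x0]) simp
        have "\<rho> v \<le> int (Suc i) \<longleftrightarrow> v = b \<or> \<rho> v \<le> int i" for v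
          using inj[of v b] b by auto
        then have "S (Suc i) = insert b (S i)"
          unfolding S_pending[OF p'] set_eq_iff insert_iff Si using an b0 by auto
        moreover have "b \<notin> S i" unfolding Si using b by simp
        ultimately have "H (Suc i) = Suc (H i)" by (rule height_insert)
        then show ?thesis using a0 b0 by simp
      qed
      ultimately show ?thesis by simp
    qed
  next
    case np: False
    then have le: "\<not> i < H i" using pending_iff i by simp
    have b0: "b > 0"
    proof (rule ccontr)
      assume "\<not> b > 0"
      then have "b < 0" using ab0 by simp
      then show False using np b unfolding pending_def by (metis lessI of_nat_less_iff of_nat_Suc add.commute)
    qed
    show ?thesis
    proof (cases "a > 0")
      case False
      then have a0: "a < 0" using ab0 by simp
      have "S i \<subseteq> S k" unfolding k by (rule S_Suc_subset[of a]) (use a k a0 in simp_all)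
      then have "H i \<le> H k" by (rule height_mono)
      then show ?thesis using le a0 b0 by simp
    next
      case a0: True
      show ?thesis
      proof (cases "a > b")
        case True
        have "a \<in> S i" unfolding open_values_def using a a0 an True b
          by (intro CollectI conjI exI[of _ b]) auto
        moreover have "S k \<subseteq> S i"
        proof
          fix v assume "v \<in> S k"
          then obtain x where v: "v \<in> {1..int n}" "\<rho> v \<le> int k" "x < v" "\<rho> x > int k"
            unfolding open_values_def by blast
          have "\<exists>x<v. \<rho> x > int i"
          proof (cases "\<rho> x = int i")
            case True
            then have "x = a" using inj[of x a] a by simp
            then show ?thesis using v \<open>a > b\<close> b by (intro exI[of _ b]) auto
          next
            case False
            then show ?thesis using v k by (intro exI[of _ x]) auto
          qed
          then show "v \<in> S i" using v k by (simp add: open_values_def)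
        qed
        moreover have "S i \<subseteq> insert a (S k)"
          unfolding k by (rule open_values_Suc_subset[OF \<rho>]) (use a k in simp)
        ultimately have "S i = insert a (S k)" by blast
        then have "H i = Suc (H k)" using Sk by (rule height_insert)
        then show ?thesis using True by simp
      next
        case False
        then have "a < b" using ab by simp
        have "a \<notin> S i"
        proof
          assume "a \<in> S i"
          then obtain x where x: "x < a" "\<rho> x > int i" unfolding open_values_def by blast
          moreover have "\<rho> x \<noteq> \<rho> b" unfolding inj using x \<open>a < b\<close> by simp
          ultimately show False using no_231[of x a b] a b a0 \<open>a < b\<close> by simp
        qed
        moreover have "S i \<subseteq> insert a (S k)"
          unfolding k by (rule open_values_Suc_subset[OF \<rho>]) (use a k in simp)
        ultimately have "H i \<le> H k" by (intro height_mono) blast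
        then show ?thesis using False le by simp
      qed
    qed
  qed
  then show ?thesis by (simp add: a_def b_def k)
qed

end


lemma down_closed_eq_interval:
  fixes C :: "int set"
  assumes "finite C" "C \<subseteq> {1..}" "\<And>u v. v \<in> C \<Longrightarrow> 1 \<le> u \<Longrightarrow> u < v \<Longrightarrow> u \<in> C"
  shows "C = {1..int (card C)}"
proof (cases "C = {}")
  case False
  have M: "Max C \<in> C" "\<And>v. v \<in> C \<Longrightarrow> v \<le> Max C" using assms(1) False by simp_all
  have "u \<in> C" if "1 \<le> u" "u \<le> Max C" for u
    using assms(3)[OF M(1) that(1)] that(2) M(1) by (cases "u = Max C") auto
  then have eq: "C = {1..Max C}" using M(2) assms(2) by auto
  moreover have "card {1..Max C} = nat (Max C)" by simp
  ultimately have "int (card C) = Max C" using M(1) assms(2) by (metis atLeast_iff int_nat_eq subsetD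
    order_trans zero_le_one)
  then show ?thesis using eq by simp
qed simp

context avoiding_perm
begin

definition popped :: "nat \<Rightarrow> int set" where
  "popped i = {v \<in> {1..int n}. \<rho> v \<le> int i \<and> (\<forall>x. \<rho> x > int i \<longrightarrow> v \<le> x)}"

text \<open>
  Of the \<open>i\<close> values at the first \<open>i\<close> positions, \<open>H i\<close> are open. The others have left the stack, and no value still
  to come is smaller than any of them.
\<close>

lemma popped_eq:
  assumes np: "\<not> pending i" and i: "i \<le> n"
  shows "popped i = {1..int (i - H i)}"
proof -
  let ?A = "{v \<in> {1..int n}. \<bar>\<rho> v\<bar> \<le> int i}"
  have fin: "finite (popped i)" unfolding popped_def by (rule finite_sub_interval)
  have A: "v \<in> ?A \<longleftrightarrow> v \<in> {1..int n} \<and> \<rho> v \<le> int i" for v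
    using abs_le_if_not_pending[OF np, of v] by auto
  have "?A = popped i \<union> S i"
  proof (intro set_eqI)
    fix v
    have "v \<in> popped i \<union> S i \<longleftrightarrow> v \<in> {1..int n} \<and> \<rho> v \<le> int i"
      unfolding popped_def open_values_def by (auto simp: not_le)
    then show "v \<in> ?A \<longleftrightarrow> v \<in> popped i \<union> S i" using A by blast
  qed
  moreover have "popped i \<inter> S i = {}"
    unfolding popped_def open_values_def by (auto simp: not_le)
  ultimately have "card ?A = card (popped i) + H i"
    unfolding height_def using card_Un_disjoint[OF fin finite_open_values] by simp
  then have "card (popped i) = i - H i" unfolding card_abs_le[OF \<rho> i] by simp
  moreover have "popped i = {1..int (card (popped i))}"
  proof (rule down_closed_eq_interval[OF fin])
    show "popped i \<subseteq> {1..}" by (auto simp: popped_def)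
    fix u v assume v: "v \<in> popped i" and u: "1 \<le> u" "u < v"
    then have le: "\<rho> x > int i \<Longrightarrow> v \<le> x" for x by (simp add: popped_def)
    have "\<rho> u \<le> int i" using le[of u] u by force
    moreover have "u \<in> {1..int n}" using u v by (simp add: popped_def)
    moreover have "u \<le> x" if "\<rho> x > int i" for x using le[OF that] u by simp
    ultimately show "u \<in> popped i" unfolding popped_def by blast
  qed
  ultimately show ?thesis by simp
qed

lemma popped_mono:
  assumes "i \<le> j" shows "popped i \<subseteq> popped j"
proof
  fix v assume v: "v \<in> popped i"
  then have "v \<le> x" if "\<rho> x > int j" for x using that assms by (simp add: popped_def)
  then show "v \<in> popped j" using v assms by (simp add: popped_def)
qed

definition inv_ascents :: "nat set" where
  "inv_ascents = {j \<in> {1..<n}. \<rho> (int j) < \<rho> (int j + 1)}"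

text \<open>
  At such a gap the stack has just released the value \<open>i - H i\<close>, whereas \<open>i - H i + 1\<close> stands further to the
  right, so that \<open>i - H i\<close> is an ascent of the inverse.
\<close>

definition pop_times :: "nat set" where
  "pop_times = {i \<in> {1..<n}. H i < i \<and> H i \<le> H (i - 1)}"

lemma pop_time_imp_inv_ascent:
  assumes i: "i \<in> pop_times" shows "i - H i \<in> inv_ascents"
proof -
  let ?c = "i - H i"
  have i': "1 \<le> i" "i < n" "H i < i" using i by (auto simp: pop_times_def)
  then have np: "\<not> pending i" using pending_iff by simp
  note C = popped_eq[OF np less_imp_le[OF i'(2)]]
  have c: "int ?c \<in> popped i" "int ?c + 1 \<notin> popped i" unfolding C using i' by auto
  have le: "\<rho> (int ?c) \<le> int i" "\<And>x. \<rho> x > int i \<Longrightarrow> int ?c \<le> x"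
    using c(1) by (auto simp: popped_def)
  define u where "u = inv \<rho> (int n)"
  have u: "\<rho> u = int n" by (simp add: u_def inv_app)
  then have "int ?c \<le> u" using le(2)[of u] i' by simp
  moreover have "u \<noteq> int ?c" using le(1) u i' by auto
  moreover have "u \<le> int n" using signed_perm_abs_le[OF \<rho>, of u] u by simp
  ultimately have cn: "int ?c + 1 \<le> int n" by simp
  have "\<rho> (int ?c + 1) > int i"
  proof (rule ccontr)
    assume a: "\<not> \<rho> (int ?c + 1) > int i"
    then have "\<exists>x. \<rho> x > int i \<and> x < int ?c + 1"
      using c(2) cn unfolding popped_def by (auto simp: not_le)
    then obtain x where x: "\<rho> x > int i" "x < int ?c + 1" by blast
    then have "x = int ?c" using le(2)[OF x(1)] by simp
    then show False using x(1) le(1) by simp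
  qed
  then have "\<rho> (int ?c) < \<rho> (int ?c + 1)" using le(1) by linarith
  moreover have "1 \<le> ?c" "?c < n" using i' cn by linarith+
  ultimately show ?thesis unfolding inv_ascents_def by simp
qed

lemma inj_on_pop_times: "inj_on (\<lambda>i. i - H i) pop_times"
proof (rule linorder_inj_onI)
  fix i j assume ij: "i < j" "i \<in> pop_times" "j \<in> pop_times"
  then have *: "1 \<le> i" "H i < i" "j < n" "H j < j" "H j \<le> H (j - 1)" by (auto simp: pop_times_def)
  have np: "\<not> pending i" using pending_iff[of i] * ij by simp
  have ij1: "i \<le> j - 1" using ij(1) by simp
  have npj: "\<not> pending (j - 1)" using pending_mono[OF _ ij1] np by blast
  have "int (i - H i) \<in> popped i" using popped_eq[OF np] * ij by auto
  then have "int (i - H i) \<in> popped (j - 1)" using popped_mono[OF ij1] by blast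
  then have "i - H i \<le> j - 1 - H (j - 1)" using popped_eq[OF npj] * by simp
  then show "i - H i \<noteq> j - H j" using * ij by linarith
qed (rule linear)

text \<open>
  The value \<open>j\<close> leaves the stack before \<open>j + 1\<close> is read, since otherwise it would exceed a value to the right of
  \<open>j + 1\<close> and thus begin a pattern 231. The first gap after its departure is the pop time looked for.
\<close>

lemma inv_ascent_from_pop_time:
  assumes j: "j \<in> inv_ascents" shows "\<exists>i\<in>pop_times. i - H i = j"
proof -
  have j': "1 \<le> j" "j < n" "\<rho> (int j) < \<rho> (int j + 1)" using j by (auto simp: inv_ascents_def)
  define w where "w = \<rho> (int j + 1)"
  have far: "int j \<le> x" if "\<rho> x > w" for x
    using no_231[of x "int j" "int j + 1"] j' that unfolding w_def by force
  have "w \<noteq> 0" unfolding w_def using signed_perm_eq_0[OF \<rho>, of "int j + 1"] by simp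
  moreover have "\<not> w < 0"
  proof
    assume "w < 0"
    then have "\<rho> (- (int j + 1)) > w" unfolding odd w_def by simp
    then show False using far[of "- (int j + 1)"] by simp
  qed
  moreover have "w \<noteq> 1"
  proof
    assume w1: "w = 1"
    have "\<rho> (int j) \<noteq> 0" using signed_perm_eq_0[OF \<rho>, of "int j"] j' by simp
    then have "\<rho> (- int j) \<ge> 1" using j' w1 unfolding odd w_def by simp
    moreover have "\<rho> (- int j) \<noteq> \<rho> (int j + 1)" unfolding inj by simp
    ultimately have "\<rho> (- int j) > w" using w1 w_def by simp
    then show False using far[of "- int j"] j' by simp
  qed
  ultimately have w2: "w \<ge> 2" by linarith
  define k where "k = nat (w - 1)"
  have wn: "w \<le> int n" using signed_perm_abs_le[OF \<rho>, of "int j + 1"] j' by (auto simp: w_def)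
  have k: "int k = w - 1" "1 \<le> k" "k < n" using w2 wn by (auto simp: k_def)
  have far': "int j \<le> x" if "\<rho> x > int k" for x
  proof (cases "\<rho> x = w")
    case True
    then have "x = int j + 1" unfolding w_def inj .
    then show ?thesis by simp
  qed (use far[of x] that k in simp)
  have npk: "\<not> pending k" unfolding pending_def using far' j' by force
  have jk: "int j \<in> popped k" unfolding popped_def using far' j' k w_def by auto
  define P where "P = (\<lambda>i. \<not> pending i \<and> int j \<in> popped i)"
  define i where "i = (LEAST i. P i)"
  have Pk: "P k" using npk jk by (simp add: P_def)
  have Pi: "P i" unfolding i_def by (rule LeastI[of P, OF Pk])
  have ik: "i \<le> k" unfolding i_def by (rule Least_le[of P, OF Pk])
  have least: "\<not> P l" if "l < i" for l using not_less_Least that unfolding i_def by blast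
  have np: "\<not> pending i" and ji: "int j \<in> popped i" using Pi by (simp_all add: P_def)
  have i1: "1 \<le> i"
  proof (rule ccontr)
    assume "\<not> 1 \<le> i"
    then have i0: "i = 0" by simp
    have "\<rho> (int j) \<noteq> 0" using signed_perm_eq_0[OF \<rho>, of "int j"] j' by simp
    then have "\<rho> (- int j) > 0" using ji unfolding odd i0 popped_def by simp
    then show False using np j' unfolding pending_def i0 by (metis neg_less_0_iff_less of_nat_0 of_nat_0_less_iff less_le_trans zero_less_one)
  qed
  have "int j + 1 \<notin> popped k" using k w_def by (simp add: popped_def)
  then have "int j + 1 \<notin> popped i" using popped_mono[OF ik] by blast
  then have eq: "i - H i = j" using ji popped_eq[OF np] ik k j' by auto
  have "H i \<le> H (i - 1)"
  proof (cases "pending (i - 1)")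
    case True
    then show ?thesis using pending_iff[of "i - 1"] eq j' ik k by linarith
  next
    case False
    then have "int j \<notin> popped (i - 1)" using least[of "i - 1"] i1 by (simp add: P_def)
    then have "j > i - 1 - H (i - 1)" using popped_eq[OF False] ik k j' by auto
    then show ?thesis using eq i1 j' by linarith
  qed
  then have "i \<in> pop_times" using i1 ik k eq j' by (simp add: pop_times_def)
  then show ?thesis using eq by blast
qed

text \<open>
  Thus the ascents of the inverse correspond to the gaps at which values leave the stack.
\<close>

lemma sum_inv_ascents: "\<Sum> inv_ascents = (\<Sum>i\<in>pop_times. i - H i)"
proof -
  have "bij_betw (\<lambda>i. i - H i) pop_times inv_ascents"
    unfolding bij_betw_def using inj_on_pop_times pop_time_imp_inv_ascent inv_ascent_from_pop_time
    by blast
  from sum.reindex_bij_betw[OF this, of "\<lambda>j. j"] show ?thesis by simp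
qed

end

lemma neg_inv:
  assumes \<rho>: "\<rho> \<in> signed_perms n" shows "neg n (inv \<rho>) = neg n \<rho>"
proof -
  note b = signed_permsD(3)[OF \<rho>]
  have inv: "inv \<rho> (\<rho> i) = i" for i using b by (simp add: bij_is_inj)
  have odd': "inv \<rho> (- i) = - inv \<rho> i" for i using signed_permsD(2)[OF signed_inv[OF \<rho>]] .
  have "{i \<in> {1..int n}. inv \<rho> i < 0} = (\<lambda>i. - \<rho> i) ` {i \<in> {1..int n}. \<rho> i < 0}"
  proof (intro set_eqI iffI)
    fix i assume i: "i \<in> {i \<in> {1..int n}. inv \<rho> i < 0}"
    have r: "\<rho> (inv \<rho> i) = i" using b by (simp add: bij_is_surj surj_f_inv_f)
    have "\<bar>inv \<rho> i\<bar> \<le> int n" using signed_perm_abs_le[OF signed_inv[OF \<rho>], of i] i by simp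
    then have "- inv \<rho> i \<in> {i \<in> {1..int n}. \<rho> i < 0}"
      using i r signed_permsD(2)[OF \<rho>, of "inv \<rho> i"] by simp
    moreover have "i = - \<rho> (- inv \<rho> i)" using r signed_permsD(2)[OF \<rho>, of "inv \<rho> i"] by simp
    ultimately show "i \<in> (\<lambda>i. - \<rho> i) ` {i \<in> {1..int n}. \<rho> i < 0}" by blast
  next
    fix i assume "i \<in> (\<lambda>i. - \<rho> i) ` {i \<in> {1..int n}. \<rho> i < 0}"
    then obtain k where k: "k \<in> {1..int n}" "\<rho> k < 0" "i = - \<rho> k" by blast
    then show "i \<in> {i \<in> {1..int n}. inv \<rho> i < 0}"
      using signed_perm_abs_le[OF \<rho>, of k] inv odd'[of "\<rho> k"] by simp
  qed
  moreover have "inj_on (\<lambda>i. - \<rho> i) {i \<in> {1..int n}. \<rho> i < 0}"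
    using inj_eq[OF signed_permsD(4)[OF \<rho>]] by (simp add: inj_on_def)
  ultimately show ?thesis unfolding neg_def by (simp only: card_image)
qed

text \<open>
  The sum of the ascent positions of a sortable element and of its inverse, in terms of the heights.
\<close>

definition height_cost :: "nat \<Rightarrow> (nat \<Rightarrow> nat) \<Rightarrow> nat" where
  "height_cost n H = (\<Sum>i\<in>{1..<n}.
     (if H i = Suc (H (i - 1)) \<or> (i < H i \<and> H (Suc i) \<le> H i) then 0 else i)
     + (if H i \<le> i \<and> H i \<le> H (i - 1) then i - H i else 0))"

lemma sum_fDes_split:
  fixes P :: "nat \<Rightarrow> bool"
  shows "\<Sum> {i \<in> {1..<n}. P i} + (\<Sum>i\<in>{1..<n}. if P i then 0 else i) = n * (n - 1) div 2"
proof -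
  have "\<Sum> {i \<in> {1..<n}. P i} = (\<Sum>i\<in>{1..<n}. if P i then i else 0)"
    by (rule sum.inter_filter) simp
  then have "\<Sum> {i \<in> {1..<n}. P i} + (\<Sum>i\<in>{1..<n}. if P i then 0 else i)
      = (\<Sum>i\<in>{1..<n}. (if P i then i else 0) + (if P i then 0 else i))"
    by (simp only: sum.distrib)
  also have "\<dots> = (\<Sum>i\<in>{1..<n}. i)" by (intro sum.cong) auto
  also have "\<dots> = (\<Sum>i\<in>{0..<n}. i)" by (intro sum.mono_neutral_left) auto
  also have "\<dots> = n * (n - 1) div 2" by (simp add: Sum_Ico_nat)
  finally show ?thesis .
qed

lemma sum_fDes_eq: "(\<Sum>i\<in>fDes n \<sigma>. i) = \<Sum> {i \<in> {1..<n}. \<sigma> (int i) > \<sigma> (int i + 1)}"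
  by (rule sum.mono_neutral_right) (auto simp: fDes_def add.commute)

text \<open>
  Descents are traded for ascents, since the stack makes the ascents of the inverse visible; for each of the
  two permutations, the ascent and descent positions add up to \<open>n * (n - 1) div 2\<close>.
\<close>

lemma Sort_B_weight:
  assumes \<sigma>: "\<sigma> \<in> Sort_B n"
  shows "fmaj n \<sigma> + ifmaj n \<sigma> + 2 * height_cost n (height n (inv \<sigma>))
    = 2 * (n * (n - 1) + height n (inv \<sigma>) 0)"
proof -
  have sp: "\<sigma> \<in> signed_perms n" by (rule Sort_B_heights(1)[OF \<sigma>])
  interpret avoiding_perm n "inv \<sigma>"
    by unfold_locales (rule signed_inv[OF sp], rule Sort_B_heights(2)[OF \<sigma>])
  have inv2: "inv (inv \<sigma>) = \<sigma>" using signed_permsD(3)[OF sp] by (rule inv_inv_eq)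
  let ?D = "\<lambda>i. H i = Suc (H (i - 1)) \<or> (i < H i \<and> H (Suc i) \<le> H i)"
  have "{i \<in> {1..<n}. \<sigma> (int i) > \<sigma> (int i + 1)} = {i \<in> {1..<n}. ?D i}"
    using descent_iff unfolding inv2 by auto
  then have 1: "(\<Sum>i\<in>fDes n \<sigma>. i) + (\<Sum>i\<in>{1..<n}. if ?D i then 0 else i) = n * (n - 1) div 2"
    using sum_fDes_split[of n ?D] unfolding sum_fDes_eq by simp
  have "inv \<sigma> (int j) \<noteq> inv \<sigma> (int j + 1)" for j unfolding inj by simp
  then have asc: "inv_ascents = {j \<in> {1..<n}. \<not> inv \<sigma> (int j) > inv \<sigma> (int j + 1)}"
    unfolding inv_ascents_def by (auto simp: not_less order.strict_iff_order)
  have "\<Sum> inv_ascents = (\<Sum>j\<in>{1..<n}. if inv \<sigma> (int j) > inv \<sigma> (int j + 1) then 0 else j)"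
    unfolding asc sum.inter_filter[OF finite_atLeastLessThan] by (intro sum.cong) auto
  then have 2: "(\<Sum>i\<in>fDes n (inv \<sigma>). i) + \<Sum> inv_ascents = n * (n - 1) div 2"
    using sum_fDes_split[of n "\<lambda>j. inv \<sigma> (int j) > inv \<sigma> (int j + 1)"] unfolding sum_fDes_eq by simp
  have "\<Sum> inv_ascents = (\<Sum>i\<in>{1..<n}. if H i < i \<and> H i \<le> H (i - 1) then i - H i else 0)"
    unfolding sum_inv_ascents pop_times_def by (rule sum.inter_filter) simp
  also have "\<dots> = (\<Sum>i\<in>{1..<n}. if H i \<le> i \<and> H i \<le> H (i - 1) then i - H i else 0)"
    by (intro sum.cong) auto
  finally have 3: "height_cost n H = (\<Sum>i\<in>{1..<n}. if ?D i then 0 else i) + \<Sum> inv_ascents"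
    unfolding height_cost_def by (simp only: sum.distrib)
  have "neg n \<sigma> = H 0" using height_0[OF \<rho>] neg_inv[OF sp] by simp
  moreover have "neg n (inv \<sigma>) = H 0" using height_0[OF \<rho>] by simp
  moreover have "2 * (n * (n - 1) div 2) = n * (n - 1)"
    by (rule dvd_mult_div_cancel) (cases n, auto)
  moreover have "f + c = t \<Longrightarrow> g + a = t \<Longrightarrow> d = c + a \<Longrightarrow> k = h \<Longrightarrow> l = h \<Longrightarrow> 2 * t = m
      \<Longrightarrow> 2 * f + k + (2 * g + l) + 2 * d = 2 * (m + h)" for f c t g a d k h l m :: nat
    by simp
  ultimately show ?thesis unfolding fmaj_def ifmaj_def using 1 2 3 by blast
qed


section \<open>Gaussian binomial coefficients at a real argument\<close>

text \<open>
  The Pascal recursion is taken as the definition because an integer lower index, with value 0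
  outside the triangle, spares all side conditions in the recursions below.
\<close>

fun gbin :: "real \<Rightarrow> nat \<Rightarrow> int \<Rightarrow> real" where
  "gbin q 0 j = (if j = 0 then 1 else 0)"
| "gbin q (Suc N) j = gbin q N (j - 1) + q powi j * gbin q N j"

lemma gbin_outside: "j < 0 \<or> int N < j \<Longrightarrow> gbin q N j = 0"
  by (induction N arbitrary: j) auto

lemma gbin_Suc':
  assumes "q > 0"
  shows "gbin q (Suc N) j = q powi (int N + 1 - j) * gbin q N (j - 1) + gbin q N j"
proof (induction N arbitrary: j)
  case (Suc N)
  let ?A = "gbin q N (j - 1 - 1)" and ?B = "gbin q N (j - 1)" and ?C = "gbin q N j"
  have e: "int (Suc N) + 1 - j = int N + 1 - (j - 1)" by simp
  have p: "q powi j * q powi (int N + 1 - j) = q powi (int N + 1 - (j - 1)) * q powi (j - 1)"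
    using assms by (simp add: power_int_add[symmetric] add.commute)
  have "gbin q (Suc (Suc N)) j = (q powi (int N + 1 - (j - 1)) * ?A + ?B)
      + q powi j * (q powi (int N + 1 - j) * ?B + ?C)"
    unfolding gbin.simps(2)[of q "Suc N"] Suc ..
  also have "\<dots> = q powi (int N + 1 - (j - 1)) * (?A + q powi (j - 1) * ?B) + (?B + q powi j * ?C)"
    using p by algebra
  also have "\<dots> = q powi (int (Suc N) + 1 - j) * gbin q (Suc N) (j - 1) + gbin q (Suc N) j"
    unfolding e gbin.simps(2) ..
  finally show ?case .
qed auto

lemma gbin_symmetric:
  assumes "q > 0" shows "gbin q N (int N - j) = gbin q N j"
proof (induction N arbitrary: j)
  case (Suc N)
  show ?case
    using Suc[of j] Suc[of "j - 1"] gbin_Suc'[OF assms, of N j] gbin.simps(2)[of q N "int (Suc N) - j"]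
    by (simp add: algebra_simps del: gbin.simps)
qed auto

lemma gbin_absorb:
  assumes "q > 0"
  shows "(1 - q powi (int N + 1)) * gbin q N j = (1 - q powi (int N + 1 - j)) * gbin q (Suc N) j"
proof -
  have "q powi (int N + 1) = q powi (int N + 1 - j) * q powi j"
    using assms by (simp flip: power_int_add)
  with gbin_Suc'[OF assms, of N j] gbin.simps(2)[of q N j] show ?thesis by algebra
qed

text \<open>
  Gaussian binomial coefficients are palindromic polynomials of degree \<open>j * (N - j)\<close>.
\<close>

lemma gbin_inverse:
  assumes "q > 0"
  shows "gbin (inverse q) N j = q powi (- (j * (int N - j))) * gbin q N j"
proof (induction N arbitrary: j)
  case (Suc N)
  have e: "- ((j - 1) * (int N - (j - 1))) = - (j * (int (Suc N) - j)) + (int N + 1 - j)"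
    "- j + - (j * (int N - j)) = - (j * (int (Suc N) - j))" by (simp_all add: algebra_simps)
  have p: "q powi (a + b) = q powi a * q powi b" for a b using assms by (simp add: power_int_add)
  have t: "q powi (- ((j - 1) * (int N - (j - 1)))) = q powi (- (j * (int (Suc N) - j))) * q powi (int N + 1 - j)"
    "q powi (- j) * q powi (- (j * (int N - j))) = q powi (- (j * (int (Suc N) - j)))"
    unfolding e(1) p[symmetric] e(2) by (rule refl)+
  have "gbin (inverse q) (Suc N) j = gbin (inverse q) N (j - 1) + q powi (- j) * gbin (inverse q) N j"
    by (simp add: power_int_minus power_int_inverse)
  also have "\<dots> = q powi (- (j * (int (Suc N) - j))) * (q powi (int N + 1 - j) * gbin q N (j - 1) + gbin q N j)"
    unfolding Suc using t by algebra
  also have "\<dots> = q powi (- (j * (int (Suc N) - j))) * gbin q (Suc N) j"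
    unfolding gbin_Suc'[OF assms] ..
  finally show ?case .
qed auto

lemma gbin_q_fact:
  assumes "q > 0" "k \<le> N"
  shows "gbin q N (int k) * (q_fact q k * q_fact q (N - k)) = q_fact q N"
  using assms(2)
proof (induction N arbitrary: k)
  case (Suc N)
  have 1: "gbin q N (int k - 1) * (q_fact q k * q_fact q (Suc N - k)) = q_int q k * q_fact q N"
  proof (cases k)
    case 0
    then show ?thesis by (simp add: gbin_outside q_int_def)
  next
    case (Suc k')
    then show ?thesis using Suc.IH[of k'] Suc.prems by (simp add: q_fact_Suc algebra_simps)
  qed
  have 2: "gbin q N (int k) * (q_fact q k * q_fact q (Suc N - k)) = q_int q (Suc N - k) * q_fact q N"
  proof (cases "k = Suc N")
    case True
    then show ?thesis by (simp add: gbin_outside q_int_def)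
  next
    case False
    then have "Suc N - k = Suc (N - k)" using Suc.prems by simp
    then show ?thesis using Suc.IH[of k] Suc.prems False by (simp add: q_fact_Suc algebra_simps)
  qed
  have "gbin q (Suc N) (int k) * (q_fact q k * q_fact q (Suc N - k))
      = gbin q N (int k - 1) * (q_fact q k * q_fact q (Suc N - k))
        + q ^ k * (gbin q N (int k) * (q_fact q k * q_fact q (Suc N - k)))"
    by (simp add: algebra_simps)
  also have "\<dots> = (q_int q k + q ^ k * q_int q (Suc N - k)) * q_fact q N"
    unfolding 1 2 by (simp add: algebra_simps)
  also have "\<dots> = q_fact q (Suc N)"
    using q_int_add[of q k "Suc N - k"] Suc.prems by (simp add: q_fact_Suc)
  finally show ?case .
qed simp

lemma q_fact_pos: "q > 0 \<Longrightarrow> q_fact q k > (0 :: real)"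
  unfolding q_fact_def q_int_def by (intro prod_pos ballI sum_pos) (auto simp: lessThan_empty_iff)

section \<open>Counting height profiles\<close>

text \<open>
  The unknowns \<open>up i r\<close> and \<open>level i r\<close> are the weighted numbers of initial parts of height profiles that start at
  height \<open>h\<close> and end after \<open>i\<close> steps at height \<open>r\<close>, according to whether the last step went up. The solution
  is a difference of a Gaussian binomial coefficient and its mirror image, as in the reflection principle.
\<close>

lemma profile_recursion_solution:
  fixes up level :: "nat \<Rightarrow> nat \<Rightarrow> real" and y :: real
  assumes y: "y > 0"
    and base: "\<And>r. up 0 r = 0" "\<And>r. level 0 r = (if r = h then 1 else 0)"
    and up_0: "\<And>i. up (Suc i) 0 = 0"
    and up_Suc: "\<And>i r. up (Suc i) (Suc r) = up i r + y ^ (if r > i then i else 2 * i - r) * level i r"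
    and level_high: "\<And>i r. i < r \<Longrightarrow> level (Suc i) r = up i r + level i r"
    and level_low: "\<And>i r. r \<le> i \<Longrightarrow> level (Suc i) r = level (Suc i) (Suc r) + up (Suc i) (Suc r)"
  shows "level (Suc n) 0 = gbin y (2 * n + 1) (int (Suc n) - int h)
           - y ^ (2 * h + 1) * gbin y (2 * n + 1) (int (Suc n) + int h + 1)"
proof -
  define D where "D = (\<lambda>i r. gbin y (2 * i - r) (int i - int h) - y ^ (2 * h + 1) * gbin y (2 * i - r) (int i + int h + 1))"
  define M where "M = (\<lambda>i r. if r > i then gbin y i (int r - int h) else D i r)"
  have pw: "y powi (a + b) = y powi a * y powi b" for a b using y by (simp add: power_int_add)
  have pwh: "y ^ (2 * h + 1) * y powi a = y powi (2 * int h + 1 + a)" for a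
  proof -
    have e: "int (2 * h + 1) = 2 * int h + 1" by simp
    have "y powi (int (2 * h + 1) + a) = y ^ (2 * h + 1) * y powi a"
      unfolding pw power_int_of_nat ..
    then show ?thesis unfolding e by (rule sym)
  qed
  \<comment> \<open>\<open>M\<close> is the closed form of the sum of both unknowns; with its help a level value is again
    such a sum, but in the preceding row of the Gaussian binomial coefficients.\<close>
  have main: "(\<forall>r. up i r + level i r = M i r) \<and>
    (i > 0 \<longrightarrow> (\<forall>r. level i r = (if r \<ge> i then gbin y (i - 1) (int r - int h) else M i (Suc r))))" for i
  proof (induction i)
    case 0
    show ?case by (auto simp: base M_def D_def)
  next
    case (Suc i)
    have Mi: "up i r + level i r = M i r" for r using Suc by blast
    have Li: "i > 0 \<Longrightarrow> level i r = (if r \<ge> i then gbin y (i - 1) (int r - int h) else M i (Suc r))" for r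
      using Suc by blast
    have absorb: "(1 - y ^ N) * gbin y (N - 1) j = (1 - y powi (int N - j)) * gbin y N j" if "N > 0" for N j
      using gbin_absorb[OF y, of "N - 1" j] that by (simp add: power_int_def nat_add_distrib del: gbin.simps)
    have up_hi: "up (Suc i) (Suc r) = y powi (int i - int r + int h) * gbin y i (int r - int h)" if r: "r > i" for r
    proof (cases "i = 0")
      case True
      then show ?thesis using up_Suc[of 0 r] base r by auto
    next
      case False
      have "up (Suc i) (Suc r) = M i r - (1 - y ^ i) * level i r"
        using up_Suc[of i r] Mi[of r] r by (simp add: algebra_simps)
      also have "\<dots> = gbin y i (int r - int h) - (1 - y ^ i) * gbin y (i - 1) (int r - int h)"
        using r False Li[of r] by (simp add: M_def)
      also have "\<dots> = y powi (int i - (int r - int h)) * gbin y i (int r - int h)"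
        using False by (subst absorb) (simp_all add: algebra_simps)
      finally show ?thesis by (simp add: algebra_simps)
    qed
    have up_lo: "up (Suc i) (Suc r) = y powi (int i - int r + int h) *
        (gbin y (2 * i - r) (int i - int h) - gbin y (2 * i - r) (int i + int h + 1))" if r: "r \<le> i" for r
    proof (cases "i = 0")
      case True
      then show ?thesis using up_Suc[of 0 0] base r by (auto simp: gbin_outside)
    next
      case False
      let ?N = "2 * i - r"
      have N: "?N > 0" "int ?N = 2 * int i - int r" using r False by auto
      have L: "level i r = gbin y (?N - 1) (int i - int h) - y ^ (2 * h + 1) * gbin y (?N - 1) (int i + int h + 1)"
      proof (cases "r = i")
        case True
        then show ?thesis using Li[of r] False by (simp add: gbin_outside)
      next
        case False
        then show ?thesis using Li[of r] r \<open>i \<noteq> 0\<close> by (simp add: M_def D_def)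
      qed
      have "up (Suc i) (Suc r) = M i r - (1 - y ^ ?N) * level i r"
        using up_Suc[of i r] Mi[of r] r by (simp add: algebra_simps)
      also have "\<dots> = D i r - ((1 - y ^ ?N) * gbin y (?N - 1) (int i - int h)
          - y ^ (2 * h + 1) * ((1 - y ^ ?N) * gbin y (?N - 1) (int i + int h + 1)))"
        using r unfolding L by (simp add: M_def algebra_simps)
      also have "\<dots> = y powi (int ?N - (int i - int h)) * gbin y ?N (int i - int h)
          - y ^ (2 * h + 1) * (y powi (int ?N - (int i + int h + 1)) * gbin y ?N (int i + int h + 1))"
        unfolding absorb[OF N(1)] D_def by (simp add: algebra_simps)
      also have "y ^ (2 * h + 1) * (y powi (int ?N - (int i + int h + 1)) * gbin y ?N (int i + int h + 1))
          = y powi (int i - int r + int h) * gbin y ?N (int i + int h + 1)"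
      proof -
        have "y ^ (2 * h + 1) * y powi (int ?N - (int i + int h + 1)) = y powi (int i - int r + int h)"
          unfolding pwh N(2) by (simp add: algebra_simps)
        then show ?thesis by (simp flip: mult.assoc)
      qed
      finally show ?thesis using N(2) by (simp add: algebra_simps)
    qed
    have Lhi: "level (Suc i) r = gbin y i (int r - int h)" if "r > i" for r
      using level_high[OF that] Mi[of r] that by (simp add: M_def)
    have Mhi: "up (Suc i) r + level (Suc i) r = gbin y (Suc i) (int r - int h)" if r: "r > Suc i" for r
    proof -
      obtain s where s: "r = Suc s" "s > i" using r by (cases r) auto
      then show ?thesis using up_hi[of s] Lhi[of r] gbin_Suc'[OF y, of i "int r - int h"] r
        by (simp add: algebra_simps del: gbin.simps)
    qed
    have diff: "up (Suc i) (Suc r) = D (Suc i) (Suc r) - D (Suc i) (Suc (Suc r))" if r: "r \<le> i" for r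
    proof -
      have N: "2 * Suc i - Suc r = Suc (2 * i - r)" "2 * Suc i - Suc (Suc r) = 2 * i - r"
        "int (2 * i - r) = 2 * int i - int r" using r by auto
      have g: "gbin y (Suc (2 * i - r)) j - gbin y (2 * i - r) j = y powi (2 * int i - int r + 1 - j) * gbin y (2 * i - r) (j - 1)" for j
        using gbin_Suc'[OF y, of "2 * i - r" j] N(3) by (simp del: gbin.simps)
      have e: "y ^ (2 * h + 1) * y powi (2 * int i - int r + 1 - (int (Suc i) + int h + 1)) = y powi (int i - int r + int h)"
        unfolding pwh by (simp add: algebra_simps)
      have "D (Suc i) (Suc r) - D (Suc i) (Suc (Suc r))
          = (gbin y (Suc (2 * i - r)) (int (Suc i) - int h) - gbin y (2 * i - r) (int (Suc i) - int h))
            - y ^ (2 * h + 1) * (gbin y (Suc (2 * i - r)) (int (Suc i) + int h + 1) - gbin y (2 * i - r) (int (Suc i) + int h + 1))"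
        unfolding D_def N(1,2) by (simp add: algebra_simps del: gbin.simps)
      also have "\<dots> = y powi (int i - int r + int h) * gbin y (2 * i - r) (int i - int h)
          - (y ^ (2 * h + 1) * y powi (2 * int i - int r + 1 - (int (Suc i) + int h + 1))) * gbin y (2 * i - r) (int i + int h + 1)"
        unfolding g by (simp add: algebra_simps)
      also have "\<dots> = up (Suc i) (Suc r)" unfolding e up_lo[OF r] by (simp add: algebra_simps)
      finally show ?thesis by simp
    qed
    have D_top: "D (Suc i) (Suc (Suc i)) = level (Suc i) (Suc i)"
      using Lhi[of "Suc i"] by (simp add: D_def gbin_outside)
    have D_0: "D (Suc i) 0 = D (Suc i) (Suc 0)"
    proof -
      have N: "2 * Suc i - 0 = Suc (2 * i + 1)" "2 * Suc i - Suc 0 = 2 * i + 1" by auto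
      have s: "gbin y (2 * i + 1) (int i - int h) = gbin y (2 * i + 1) (int i + int h + 1)"
        using gbin_symmetric[OF y, of "2 * i + 1" "int i + int h + 1"] by (simp add: algebra_simps del: gbin.simps)
      have e: "y ^ (2 * h + 1) * y powi (int i - int h) = y powi (int i + int h + 1)"
        unfolding pwh by (simp add: algebra_simps)
      have g: "gbin y (Suc (2 * i + 1)) j = y powi (2 * int i + 2 - j) * gbin y (2 * i + 1) (j - 1) + gbin y (2 * i + 1) j" for j
        using gbin_Suc'[OF y, of "2 * i + 1" j] by (simp del: gbin.simps add: algebra_simps)
      have "D (Suc i) 0 = D (Suc i) (Suc 0) + y powi (int i + int h + 1) * gbin y (2 * i + 1) (int i - int h)
          - y ^ (2 * h + 1) * y powi (int i - int h) * gbin y (2 * i + 1) (int i + int h + 1)"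
        unfolding D_def N g by (simp add: algebra_simps del: gbin.simps)
      then show ?thesis unfolding e s by simp
    qed
    have Mlo: "up (Suc i) r + level (Suc i) r = D (Suc i) r" if "r \<le> Suc i" for r
      using that
    proof (induction rule: inc_induct)
      case base
      show ?case using diff[of i] D_top by simp
    next
      case (step r)
      have L: "level (Suc i) r = D (Suc i) (Suc r)" using level_low[of r i] step by simp
      show ?case
      proof (cases r)
        case 0
        then show ?thesis using up_0 L D_0 by simp
      next
        case (Suc s)
        then show ?thesis using diff[of s] L step.hyps by simp
      qed
    qed
    have "level (Suc i) r = M (Suc i) (Suc r)" if "r \<le> i" for r
      using level_low[OF that] Mlo[of "Suc r"] that by (simp add: M_def)
    then show ?case using Mlo Mhi Lhi by (auto simp: M_def not_less)
  qed
  have "level (Suc n) 0 = M (Suc n) (Suc 0)" using main[of "Suc n"] by simp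
  also have "\<dots> = D (Suc n) (Suc 0)" by (simp add: M_def)
  also have "\<dots> = gbin y (2 * n + 1) (int (Suc n) - int h)
           - y ^ (2 * h + 1) * gbin y (2 * n + 1) (int (Suc n) + int h + 1)"
    unfolding D_def by (simp del: gbin.simps)
  finally show ?thesis .
qed


text \<open>
  A height profile as a list, with the height at the last gap first, so that a further step is a \<open>Cons\<close>.
\<close>

fun height_walk :: "nat list \<Rightarrow> bool" where
  "height_walk [] = False"
| "height_walk [h] = True"
| "height_walk (r' # r # w) \<longleftrightarrow>
     height_walk (r # w) \<and> r' \<le> Suc r \<and> (Suc (length w) < r \<longrightarrow> r \<le> r')"

text \<open>
  The cost of a step depends on whether the preceding step went up; therefore the flag \<open>u\<close> of \<open>walks\<close> below
  keeps track of it.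
\<close>

fun went_up :: "nat list \<Rightarrow> bool" where
  "went_up (r' # r # w) \<longleftrightarrow> r' = Suc r"
| "went_up w = False"

fun walk_cost :: "nat list \<Rightarrow> nat" where
  "walk_cost (r' # r # w) = walk_cost (r # w)
     + (if went_up (r # w) \<or> (length w < r \<and> r' \<le> r) then 0 else length w)
     + (if r \<le> length w \<and> \<not> went_up (r # w) then length w - r else 0)"
| "walk_cost w = 0"

definition walks :: "nat \<Rightarrow> nat \<Rightarrow> nat \<Rightarrow> bool \<Rightarrow> nat list set" where
  "walks h i r u = {w. height_walk w \<and> length w = Suc i \<and> last w = h \<and> hd w = r \<and> went_up w = u}"

lemma height_walk_bound: "height_walk w \<Longrightarrow> x \<in> set w \<Longrightarrow> x \<le> last w + length w"
proof (induction w arbitrary: x rule: height_walk.induct)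
  case (3 r' r w)
  have l: "last (r' # r # w) = last (r # w)" "length (r' # r # w) = Suc (length (r # w))" by simp_all
  have hw: "height_walk (r # w)" "r' \<le> Suc r" using 3(2) by simp_all
  have le: "z \<le> last (r # w) + length (r # w)" if "z \<in> set (r # w)" for z
    by (rule 3(1)[OF hw(1) that])
  have "r \<in> set (r # w)" by simp
  note le_r = le[OF this]
  from 3(3) have "x = r' \<or> x \<in> set (r # w)" unfolding set_simps(2)[of r'] by blast
  then show ?case unfolding l using le[of x] le_r hw(2) by linarith
qed simp_all

lemma finite_walks [simp, intro]: "finite (walks h i r u)"
proof (rule finite_subset)
  show "walks h i r u \<subseteq> {w. set w \<subseteq> {..h + Suc i} \<and> length w = Suc i}"
    using height_walk_bound by (fastforce simp: walks_def)
  show "finite {w. set w \<subseteq> {..h + Suc i} \<and> length w = Suc i}"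
    by (rule finite_lists_length_eq) simp
qed

lemma walks_SucI:
  assumes "height_walk (r1 # w)" "length w = i" "last (r1 # w) = h" "r \<le> Suc r1"
    "Suc i < r1 \<longrightarrow> r1 \<le> r" "u \<longleftrightarrow> r = Suc r1"
  shows "r # r1 # w \<in> walks h (Suc i) r u"
  using assms by (simp add: walks_def)

lemma walks_SucE:
  assumes "v \<in> walks h (Suc i) r u"
  obtains r1 w where "v = r # r1 # w" "height_walk (r1 # w)" "length w = i" "last (r1 # w) = h"
    "r \<le> Suc r1" "Suc i < r1 \<longrightarrow> r1 \<le> r" "u \<longleftrightarrow> r = Suc r1"
proof -
  have "length v = Suc (Suc i)" using assms by (simp add: walks_def)
  then obtain a r1 w where v: "v = a # r1 # w" by (metis Suc_length_conv)
  show thesis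
    by (rule that[of r1 w]) (use assms v in \<open>auto simp: walks_def last_ConsR simp del: last.simps\<close>)
qed

lemma Cons_walks_iff:
  "r # w \<in> walks h i r True \<union> walks h i r False \<longleftrightarrow>
     height_walk (r # w) \<and> length w = i \<and> last (r # w) = h"
  by (auto simp: walks_def simp del: last.simps height_walk.simps)

lemma image_Cons_walksE:
  assumes "v \<in> Cons s ` (walks h i r True \<union> walks h i r False)"
  obtains w where "v = s # r # w" "height_walk (r # w)" "length w = i" "last (r # w) = h"
proof -
  obtain u where u: "u \<in> walks h i r True \<union> walks h i r False" "v = s # u" using assms by blast
  then have "length u = Suc i" "hd u = r" by (auto simp: walks_def)
  then obtain w where "u = r # w" by (cases u) auto
  then show thesis using that[of w] u Cons_walks_iff[of r w h i] by simp
qed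

lemma image_Cons_walksI:
  assumes "height_walk (r # w)" "length w = i" "last (r # w) = h"
  shows "s # r # w \<in> Cons s ` (walks h i r True \<union> walks h i r False)"
  using assms Cons_walks_iff[of r w h i] by (intro imageI) simp

lemma walks_up: "walks h (Suc i) (Suc r) True = Cons (Suc r) ` (walks h i r True \<union> walks h i r False)"
proof (intro equalityI subsetI)
  fix v assume "v \<in> walks h (Suc i) (Suc r) True"
  then show "v \<in> Cons (Suc r) ` (walks h i r True \<union> walks h i r False)"
    by (rule walks_SucE) (simp add: image_Cons_walksI del: last.simps)
next
  fix v assume "v \<in> Cons (Suc r) ` (walks h i r True \<union> walks h i r False)"
  then show "v \<in> walks h (Suc i) (Suc r) True"
    by (rule image_Cons_walksE) (simp add: walks_SucI del: last.simps)
qed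

lemma walks_up_0: "walks h (Suc i) 0 True = {}"
proof -
  have "v \<notin> walks h (Suc i) 0 True" for v
    by (rule notI, erule walks_SucE) simp
  then show ?thesis by blast
qed

lemma walks_high:
  assumes "i < r"
  shows "walks h (Suc i) r False = Cons r ` (walks h i r True \<union> walks h i r False)"
proof (intro equalityI subsetI)
  fix v assume "v \<in> walks h (Suc i) r False"
  then show "v \<in> Cons r ` (walks h i r True \<union> walks h i r False)"
  proof (rule walks_SucE)
    fix r1 w assume w: "v = r # r1 # w" "height_walk (r1 # w)" "length w = i" "last (r1 # w) = h"
      "r \<le> Suc r1" "Suc i < r1 \<longrightarrow> r1 \<le> r" "False = (r = Suc r1)"
    then have "r1 = r" using assms by presburger
    then show ?thesis using w(1-4) image_Cons_walksI[of r w i h r] by simp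
  qed
next
  fix v assume "v \<in> Cons r ` (walks h i r True \<union> walks h i r False)"
  then show "v \<in> walks h (Suc i) r False"
    by (rule image_Cons_walksE) (simp add: walks_SucI del: last.simps)
qed

text \<open>
  At small heights a walk may drop by any amount. The walks that end in a drop arise from those that end one
  unit higher without going up, by lowering their last height.
\<close>

lemma walks_low:
  assumes "r \<le> i"
  shows "walks h (Suc i) r False = Cons r ` (walks h i r True \<union> walks h i r False)
     \<union> (\<lambda>w. r # tl w) ` walks h (Suc i) (Suc r) False"
proof (intro equalityI subsetI)
  fix v assume "v \<in> walks h (Suc i) r False"
  then show "v \<in> Cons r ` (walks h i r True \<union> walks h i r False) \<union> (\<lambda>w. r # tl w) ` walks h (Suc i) (Suc r) False"
  proof (rule walks_SucE)
    fix r1 w assume w: "v = r # r1 # w" "height_walk (r1 # w)" "length w = i" "last (r1 # w) = h"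
      "r \<le> Suc r1" "Suc i < r1 \<longrightarrow> r1 \<le> r" "False = (r = Suc r1)"
    show ?thesis
    proof (cases "r1 = r")
      case True
      then show ?thesis using w(1-4) image_Cons_walksI[of r w i h r] by simp
    next
      case False
      then have "Suc r \<le> Suc r1" "Suc i < r1 \<longrightarrow> r1 \<le> Suc r" "False = (Suc r = Suc r1)"
        using w(5-7) by presburger+
      then have "Suc r # r1 # w \<in> walks h (Suc i) (Suc r) False" by (intro walks_SucI w(2-4))
      then have "r # tl (Suc r # r1 # w) \<in> (\<lambda>w. r # tl w) ` walks h (Suc i) (Suc r) False" by (rule imageI)
      then show ?thesis using w(1) by simp
    qed
  qed
next
  fix v assume "v \<in> Cons r ` (walks h i r True \<union> walks h i r False) \<union> (\<lambda>w. r # tl w) ` walks h (Suc i) (Suc r) False"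
  then consider "v \<in> Cons r ` (walks h i r True \<union> walks h i r False)"
    | u where "u \<in> walks h (Suc i) (Suc r) False" "v = r # tl u" by blast
  then show "v \<in> walks h (Suc i) r False"
  proof cases
    case 1
    then show ?thesis by (rule image_Cons_walksE) (use assms in \<open>simp add: walks_SucI del: last.simps\<close>)
  next
    case 2
    from 2(1) show ?thesis
    proof (rule walks_SucE)
      fix r1 w assume w: "u = Suc r # r1 # w" "height_walk (r1 # w)" "length w = i" "last (r1 # w) = h"
        "Suc r \<le> Suc r1" "Suc i < r1 \<longrightarrow> r1 \<le> Suc r" "False = (Suc r = Suc r1)"
      then have "r \<le> Suc r1" "Suc i < r1 \<longrightarrow> r1 \<le> r" "False = (r = Suc r1)" using assms by presburger+
      then show ?thesis using w(1-4) 2(2) by (simp add: walks_SucI del: last.simps)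
    qed
  qed
qed

definition walk_sum :: "real \<Rightarrow> nat \<Rightarrow> bool \<Rightarrow> nat \<Rightarrow> nat \<Rightarrow> real" where
  "walk_sum y h u i r = (\<Sum>w\<in>walks h i r u. y ^ walk_cost w)"

lemma walk_sum_Cons:
  assumes "\<And>w'. length w' = i \<Longrightarrow> walk_cost (s # r # w') = walk_cost (r # w') + (if went_up (r # w') then 0 else e)"
  shows "(\<Sum>w\<in>Cons s ` (walks h i r True \<union> walks h i r False). y ^ walk_cost w)
    = walk_sum y h True i r + y ^ e * walk_sum y h False i r"
proof -
  have c: "walk_cost (s # w) = walk_cost w + (if u then 0 else e)" if "w \<in> walks h i r u" for w u
    using that assms[of "tl w"] unfolding walks_def by (cases w) auto
  have "(\<Sum>w\<in>Cons s ` (walks h i r True \<union> walks h i r False). y ^ walk_cost w)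
      = (\<Sum>w\<in>walks h i r True \<union> walks h i r False. y ^ walk_cost (s # w))"
    by (subst sum.reindex) (auto simp: inj_on_def)
  also have "\<dots> = (\<Sum>w\<in>walks h i r True. y ^ walk_cost (s # w)) + (\<Sum>w\<in>walks h i r False. y ^ walk_cost (s # w))"
    by (rule sum.union_disjoint[OF finite_walks finite_walks]) (auto simp: walks_def)
  also have "\<dots> = (\<Sum>w\<in>walks h i r True. y ^ walk_cost w) + (\<Sum>w\<in>walks h i r False. y ^ e * y ^ walk_cost w)"
    using c by (intro arg_cong2[where f = "(+)"] sum.cong) (simp_all add: power_add)
  finally show ?thesis by (simp add: walk_sum_def sum_distrib_left)
qed

lemma walk_sum_closed_form:
  assumes y: "y > 0"
  shows "walk_sum y h False (Suc n) 0 = gbin y (2 * n + 1) (int (Suc n) - int h)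
           - y ^ (2 * h + 1) * gbin y (2 * n + 1) (int (Suc n) + int h + 1)"
proof (rule profile_recursion_solution[OF y, of "walk_sum y h True"])
  have "walks h 0 r u = (if r = h \<and> \<not> u then {[h]} else {})" for r u
    unfolding walks_def by (auto simp: length_Suc_conv)
  then show "walk_sum y h True 0 r = 0" "walk_sum y h False 0 r = (if r = h then 1 else 0)" for r
    by (simp_all add: walk_sum_def)
  show "walk_sum y h True (Suc i) 0 = 0" for i by (simp add: walk_sum_def walks_up_0)
  show "walk_sum y h True (Suc i) (Suc r)
      = walk_sum y h True i r + y ^ (if r > i then i else 2 * i - r) * walk_sum y h False i r" for i r
    unfolding walk_sum_def[of y h True "Suc i"] walks_up
    by (rule walk_sum_Cons) (auto simp: not_less)
  show "walk_sum y h False (Suc i) r = walk_sum y h True i r + walk_sum y h False i r" if "i < r" for i r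
    using walk_sum_Cons[of i r r 0 y h] that unfolding walk_sum_def[of y h False "Suc i"] walks_high[OF that]
    by simp
  show "walk_sum y h False (Suc i) r = walk_sum y h False (Suc i) (Suc r) + walk_sum y h True (Suc i) (Suc r)"
    if r: "r \<le> i" for i r
  proof -
    let ?A = "Cons r ` (walks h i r True \<union> walks h i r False)" and ?g = "\<lambda>w. r # tl w"
    have "(\<Sum>w\<in>?A. y ^ walk_cost w) = walk_sum y h True i r + y ^ (2 * i - r) * walk_sum y h False i r"
      by (rule walk_sum_Cons) (use r in auto)
    also have "\<dots> = walk_sum y h True (Suc i) (Suc r)"
      unfolding walk_sum_def[of y h True "Suc i"] walks_up
      by (rule walk_sum_Cons[symmetric]) (use r in auto)
    finally have 1: "(\<Sum>w\<in>?A. y ^ walk_cost w) = walk_sum y h True (Suc i) (Suc r)" .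
    have "inj_on ?g (walks h (Suc i) (Suc r) False)"
      by (rule inj_onI, elim walks_SucE) simp
    then have "(\<Sum>w\<in>?g ` walks h (Suc i) (Suc r) False. y ^ walk_cost w)
        = (\<Sum>w\<in>walks h (Suc i) (Suc r) False. y ^ walk_cost (?g w))" by (simp add: sum.reindex)
    also have "\<dots> = (\<Sum>w\<in>walks h (Suc i) (Suc r) False. y ^ walk_cost w)"
    proof (rule sum.cong[OF refl])
      fix v assume "v \<in> walks h (Suc i) (Suc r) False"
      then show "y ^ walk_cost (?g v) = y ^ walk_cost v"
      proof (rule walks_SucE)
        fix r1 w assume v: "v = Suc r # r1 # w" "Suc r \<le> Suc r1" "False = (Suc r = Suc r1)"
        then have "Suc r \<le> r1" by simp
        then show ?thesis unfolding v(1) by simp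
      qed
    qed
    finally have 2: "(\<Sum>w\<in>?g ` walks h (Suc i) (Suc r) False. y ^ walk_cost w) = walk_sum y h False (Suc i) (Suc r)"
      by (simp add: walk_sum_def)
    have "w \<notin> ?g ` walks h (Suc i) (Suc r) False" if wA: "w \<in> ?A" for w
    proof
      assume "w \<in> ?g ` walks h (Suc i) (Suc r) False"
      then obtain v where v: "v \<in> walks h (Suc i) (Suc r) False" "w = ?g v" by blast
      obtain r1 v' where v': "v = Suc r # r1 # v'" "Suc r \<le> Suc r1" "False = (Suc r = Suc r1)"
        using v(1) by (rule walks_SucE)
      obtain w' where "w = r # r # w'" using wA by (rule image_Cons_walksE)
      then show False using v(2) v' by simp
    qed
    then have "?A \<inter> ?g ` walks h (Suc i) (Suc r) False = {}" by blast
    then have "walk_sum y h False (Suc i) r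
        = (\<Sum>w\<in>?A. y ^ walk_cost w) + (\<Sum>w\<in>?g ` walks h (Suc i) (Suc r) False. y ^ walk_cost w)"
      unfolding walk_sum_def[of y h False "Suc i" r] walks_low[OF r] by (intro sum.union_disjoint) auto
    then show ?thesis unfolding 1 2 by simp
  qed
qed

definition profile :: "nat \<Rightarrow> (nat \<Rightarrow> nat) \<Rightarrow> nat list" where
  "profile n H = map H (rev [0..<Suc n])"

lemma profile_simps [simp]:
  "profile 0 H = [H 0]" "profile (Suc n) H = H (Suc n) # profile n H"
  "length (profile n H) = Suc n" "hd (profile n H) = H n"
  by (simp_all add: profile_def)

lemma last_profile [simp]: "last (profile n H) = H 0"
  by (induction n) (auto simp: profile_def)

lemma profile_Cons: "\<exists>w. profile n H = H n # w \<and> length w = n"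
  by (cases n) auto

lemma height_walk_profile:
  "height_walk (profile n H) \<longleftrightarrow>
     (\<forall>i<n. H (Suc i) \<le> Suc (H i) \<and> (Suc i < H i \<longrightarrow> H i \<le> H (Suc i)))"
proof (induction n)
  case (Suc n)
  obtain w where "profile n H = H n # w" "length w = n" using profile_Cons by blast
  then show ?case using Suc by (auto simp: less_Suc_eq)
qed simp

lemma walk_cost_profile:
  "height_walk (profile n H) \<Longrightarrow> walk_cost (profile n H) = height_cost n H"
proof (induction n)
  case 0
  show ?case by (simp add: height_cost_def)
next
  case (Suc n)
  obtain w where w: "profile n H = H n # w" "length w = n" using profile_Cons by blast
  have IH: "walk_cost (profile n H) = height_cost n H" using Suc w by simp
  show ?case
  proof (cases n)
    case 0
    then show ?thesis using w by (simp add: height_cost_def)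
  next
    case (Suc m)
    have up: "went_up (profile n H) \<longleftrightarrow> H n = Suc (H (n - 1))"
      using profile_Cons[of m H] Suc by auto
    have "H n \<le> Suc (H (n - 1))" using Suc.prems Suc unfolding height_walk_profile by auto
    then have "\<not> went_up (profile n H) \<longleftrightarrow> H n \<le> H (n - 1)" unfolding up by linarith
    moreover have "height_cost (Suc n) H = height_cost n H +
        ((if H n = Suc (H (n - 1)) \<or> (n < H n \<and> H (Suc n) \<le> H n) then 0 else n)
        + (if H n \<le> n \<and> H n \<le> H (n - 1) then n - H n else 0))"
      using Suc by (simp add: height_cost_def)
    ultimately show ?thesis using IH w up by simp
  qed
qed

lemma Sort_B_profiles:
  assumes "n \<ge> 1"
  shows "bij_betw (\<lambda>\<sigma>. profile n (height n (inv \<sigma>))) (Sort_B n) (\<Union>h\<le>n. walks h n 0 False)"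
  unfolding bij_betw_def
proof
  show "inj_on (\<lambda>\<sigma>. profile n (height n (inv \<sigma>))) (Sort_B n)"
  proof (rule inj_onI)
    fix \<sigma> \<tau> assume s: "\<sigma> \<in> Sort_B n" "\<tau> \<in> Sort_B n"
      and "profile n (height n (inv \<sigma>)) = profile n (height n (inv \<tau>))"
    then have "height n (inv \<sigma>) i = height n (inv \<tau>) i" if "i < n" for i
      using that by (simp add: profile_def)
    then show "\<sigma> = \<tau>" by (rule Sort_B_eqI[OF s])
  qed
  have valid: "valid_heights n H \<longleftrightarrow> H n = 0 \<and> height_walk (profile n H)" for H
    by (simp add: valid_heights_def height_walk_profile)
  have not_up: "\<not> went_up w" if "hd w = 0" for w using that by (cases w rule: went_up.cases) auto
  show "(\<lambda>\<sigma>. profile n (height n (inv \<sigma>))) ` Sort_B n = (\<Union>h\<le>n. walks h n 0 False)"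
  proof (intro equalityI subsetI)
    fix w assume "w \<in> (\<lambda>\<sigma>. profile n (height n (inv \<sigma>))) ` Sort_B n"
    then obtain \<sigma> where \<sigma>: "\<sigma> \<in> Sort_B n" "w = profile n (height n (inv \<sigma>))" by blast
    have v: "valid_heights n (height n (inv \<sigma>))"
      by (intro signed_perm_valid_heights signed_inv Sort_B_heights(1)[OF \<sigma>(1)])
    then have "w \<in> walks (height n (inv \<sigma>) 0) n 0 False"
      using not_up[of w] unfolding valid walks_def \<sigma>(2) by simp
    then show "w \<in> (\<Union>h\<le>n. walks h n 0 False)" using valid_heights_le[OF v, of 0] by auto
  next
    fix w assume "w \<in> (\<Union>h\<le>n. walks h n 0 False)"
    then have w: "height_walk w" "length w = Suc n" "hd w = 0" by (auto simp: walks_def)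
    define H where "H = (\<lambda>i. w ! (n - i))"
    have eq: "profile n H = w"
      by (rule nth_equalityI) (use w(2) in \<open>auto simp: profile_def H_def rev_nth simp del: upt_Suc\<close>)
    have "H n = 0" using w by (cases w) (simp_all add: H_def)
    then have "valid_heights n H" using w(1) eq by (simp add: valid)
    then obtain \<sigma> where \<sigma>: "\<sigma> \<in> Sort_B n" "\<And>i. i \<le> n \<Longrightarrow> height n (inv \<sigma>) i = H i"
      by (rule valid_heights_Sort_B[OF _ that])
    have "profile n (height n (inv \<sigma>)) = w" unfolding eq[symmetric] profile_def using \<sigma>(2)
      by (intro map_cong) auto
    then show "w \<in> (\<lambda>\<sigma>. profile n (height n (inv \<sigma>))) ` Sort_B n" using \<sigma>(1) by blast
  qed
qed

text \<open>
  The weight is a constant minus the cost of the profile, so the profiles are counted at the inverse of \<open>q\<close>; the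
  palindromicity of the central coefficient compensates for this in the end.
\<close>

lemma sum_Sort_B:
  assumes n: "n \<ge> 1" and x: "x > (0 :: real)"
  shows "(\<Sum>\<sigma>\<in>Sort_B n. x ^ (fmaj n \<sigma> + ifmaj n \<sigma>)) = gbin (x\<^sup>2) (2 * n) (int n)"
proof -
  define q y where "q = x\<^sup>2" and "y = inverse q"
  have q: "q > 0" and y: "y > 0" using x by (simp_all add: q_def y_def)
  obtain m where m: "n = Suc m" using n by (cases n) auto
  define G where "G = (\<lambda>h :: nat. gbin y (2 * n) (int n - int h))"
  have yq: "q powi a = y powi (- a)" for a by (simp add: y_def power_int_minus power_int_inverse)
  have pw: "y powi (a + b) = y powi a * y powi b" for a b using y by (simp add: power_int_add)
  let ?p = "\<lambda>\<sigma>. profile n (height n (inv \<sigma>))"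
  have weight: "x ^ (fmaj n \<sigma> + ifmaj n \<sigma>) = q ^ (n * (n - 1) + last (?p \<sigma>)) * y ^ walk_cost (?p \<sigma>)"
    if \<sigma>: "\<sigma> \<in> Sort_B n" for \<sigma>
  proof -
    let ?H = "height n (inv \<sigma>)"
    have "valid_heights n ?H"
      by (intro signed_perm_valid_heights signed_inv Sort_B_heights(1)[OF \<sigma>])
    then have "height_walk (profile n ?H)" by (simp add: valid_heights_def height_walk_profile)
    then have c: "walk_cost (?p \<sigma>) = height_cost n ?H" by (rule walk_cost_profile)
    have "x ^ (fmaj n \<sigma> + ifmaj n \<sigma>) * q ^ height_cost n ?H = q ^ (n * (n - 1) + ?H 0)"
      using Sort_B_weight[OF \<sigma>] by (simp add: q_def flip: power_mult power_add)
    then have "x ^ (fmaj n \<sigma> + ifmaj n \<sigma>) = q ^ (n * (n - 1) + ?H 0) / q ^ height_cost n ?H"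
      using q by (simp add: field_simps)
    then show ?thesis unfolding c by (simp add: y_def divide_inverse power_inverse)
  qed
  have level_sum: "(\<Sum>w\<in>walks h n 0 False. q ^ (n * (n - 1) + h) * y ^ walk_cost w)
      = y powi (- (int n * int n)) * (G h - G (Suc h))" for h
  proof -
    let ?P = "gbin y (2 * m + 1)"
    have s: "?P (int n - int h - 1) = ?P (int n + int h)"
      using gbin_symmetric[OF y, of "2 * m + 1" "int n + int h"] m by (simp add: algebra_simps del: gbin.simps)
    have N: "2 * n = Suc (2 * m + 1)" using m by simp
    have "G (Suc h) = gbin y (2 * n) (int n + int h + 1)"
      unfolding G_def using gbin_symmetric[OF y, of "2 * n" "int n + int h + 1"]
      by (simp add: algebra_simps del: gbin.simps)
    then have "G h - G (Suc h) = (?P (int n - int h - 1) + y powi (int n - int h) * ?P (int n - int h))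
        - (?P (int n + int h + 1 - 1) + y powi (int n + int h + 1) * ?P (int n + int h + 1))"
      unfolding G_def N gbin.simps(2) by simp
    also have "\<dots> = y powi (int n - int h) * ?P (int n - int h) - y powi (int n + int h + 1) * ?P (int n + int h + 1)"
      unfolding s by (simp del: gbin.simps)
    finally have d: "G h - G (Suc h) = y powi (int n - int h) * ?P (int n - int h)
        - y powi (int n + int h + 1) * ?P (int n + int h + 1)" .
    have e0: "int (n * (n - 1) + h) = int n * (int n - 1) + int h" using m by (simp add: algebra_simps)
    have "q ^ (n * (n - 1) + h) = q powi int (n * (n - 1) + h)" by (rule power_int_of_nat[symmetric])
    also have "\<dots> = y powi (- (int n * (int n - 1) + int h))" unfolding e0 by (rule yq)
    also have "\<dots> = y powi (- (int n * int n)) * y powi (int n - int h)"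
      unfolding pw[symmetric] by (simp add: algebra_simps)
    finally have e: "q ^ (n * (n - 1) + h) = y powi (- (int n * int n)) * y powi (int n - int h)" .
    have e1: "int (2 * h + 1) = 2 * int h + 1" by simp
    have "y ^ (2 * h + 1) = y powi (2 * int h + 1)"
      using power_int_of_nat[of y "2 * h + 1"] unfolding e1 by (rule sym)
    then have "y powi (int n - int h) * y ^ (2 * h + 1) = y powi (int n - int h + (2 * int h + 1))"
      by (simp only: pw)
    also have "int n - int h + (2 * int h + 1) = int n + int h + 1" by simp
    finally have e2: "y powi (int n - int h) * y ^ (2 * h + 1) = y powi (int n + int h + 1)" .
    have cf: "walk_sum y h False n 0 = ?P (int n - int h) - y ^ (2 * h + 1) * ?P (int n + int h + 1)"
      using walk_sum_closed_form[OF y, of h m] unfolding m .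
    have "(\<Sum>w\<in>walks h n 0 False. q ^ (n * (n - 1) + h) * y ^ walk_cost w)
        = q ^ (n * (n - 1) + h) * walk_sum y h False n 0"
      by (simp add: walk_sum_def sum_distrib_left)
    also have "\<dots> = y powi (- (int n * int n)) * (y powi (int n - int h) * ?P (int n - int h)
        - (y powi (int n - int h) * y ^ (2 * h + 1)) * ?P (int n + int h + 1))"
      unfolding cf e by (simp add: algebra_simps del: gbin.simps)
    finally show ?thesis unfolding d e2 .
  qed
  have disj: "walks h n 0 False \<inter> walks k n 0 False = {}" if "h \<noteq> k" for h k
    using that by (auto simp: walks_def)
  have "(\<Sum>\<sigma>\<in>Sort_B n. x ^ (fmaj n \<sigma> + ifmaj n \<sigma>))
      = (\<Sum>\<sigma>\<in>Sort_B n. q ^ (n * (n - 1) + last (?p \<sigma>)) * y ^ walk_cost (?p \<sigma>))"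
    by (rule sum.cong[OF refl weight])
  also have "\<dots> = (\<Sum>w\<in>(\<Union>h\<le>n. walks h n 0 False). q ^ (n * (n - 1) + last w) * y ^ walk_cost w)"
    by (rule sum.reindex_bij_betw[OF Sort_B_profiles[OF n]])
  also have "\<dots> = (\<Sum>h\<le>n. \<Sum>w\<in>walks h n 0 False. q ^ (n * (n - 1) + last w) * y ^ walk_cost w)"
    by (rule sum.UNION_disjoint) (simp_all add: disj)
  also have "\<dots> = (\<Sum>h\<le>n. y powi (- (int n * int n)) * (G h - G (Suc h)))"
  proof (rule sum.cong[OF refl])
    fix h
    have "(\<Sum>w\<in>walks h n 0 False. q ^ (n * (n - 1) + last w) * y ^ walk_cost w)
        = (\<Sum>w\<in>walks h n 0 False. q ^ (n * (n - 1) + h) * y ^ walk_cost w)"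
      by (rule sum.cong) (auto simp: walks_def)
    then show "(\<Sum>w\<in>walks h n 0 False. q ^ (n * (n - 1) + last w) * y ^ walk_cost w)
        = y powi (- (int n * int n)) * (G h - G (Suc h))" unfolding level_sum .
  qed
  also have "\<dots> = y powi (- (int n * int n)) * (\<Sum>h\<le>n. G h - G (Suc h))"
    by (simp add: sum_distrib_left)
  also have "(\<Sum>h\<le>n. G h - G (Suc h)) = G 0 - G (Suc n)" by (rule sum_telescope)
  also have "G (Suc n) = 0" unfolding G_def by (rule gbin_outside) simp
  also have "y powi (- (int n * int n)) * (G 0 - 0) = gbin q (2 * n) (int n)"
    using gbin_inverse[OF y, of "2 * n" "int n"] q
    by (simp add: G_def y_def algebra_simps del: gbin.simps)
  finally show ?thesis by (simp add: q_def)
qed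


section \<open>Noncrossing partitions with marked outer blocks\<close>

text \<open>
  The positive half of a noncrossing partition of type B: a noncrossing partition of
  \<open>{1,\<dots>,n}\<close>, given by its equivalence relation \<open>R\<close>, and the set \<open>F\<close> of the elements
  of those blocks that are joined to negative entries. Such blocks lie under no arc.
\<close>

locale half_partition =
  fixes n :: nat and R :: "int \<Rightarrow> int \<Rightarrow> bool" and F :: "int set"
  assumes R_range: "R x y \<Longrightarrow> x \<in> {1..int n} \<and> y \<in> {1..int n}"
    and R_refl: "x \<in> {1..int n} \<Longrightarrow> R x x"
    and R_sym: "R x y \<Longrightarrow> R y x"
    and R_trans: "R x y \<Longrightarrow> R y z \<Longrightarrow> R x z"
    and F_range: "F \<subseteq> {1..int n}"
    and F_closed: "x \<in> F \<Longrightarrow> R x y \<Longrightarrow> y \<in> F"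
    and nc: "a < b \<Longrightarrow> b < c \<Longrightarrow> c < d \<Longrightarrow> R a c \<Longrightarrow> R b d \<Longrightarrow> R a b"
    and outer: "i \<in> F \<Longrightarrow> x < i \<Longrightarrow> i < y \<Longrightarrow> R x y \<Longrightarrow> R x i"
begin

definition later :: "int \<Rightarrow> bool" where "later i \<longleftrightarrow> (\<exists>j>i. R i j)"
definition earlier :: "int \<Rightarrow> bool" where "earlier i \<longleftrightarrow> (\<exists>j<i. R i j)"
definition nxt :: "int \<Rightarrow> int" where "nxt i = Min {j \<in> {1..int n}. i < j \<and> R i j}"
definition prv :: "int \<Rightarrow> int" where "prv i = Max {j \<in> {1..int n}. j < i \<and> R i j}"
definition mn :: "int \<Rightarrow> int" where "mn i = Min {j \<in> {1..int n}. R i j}"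
definition mx :: "int \<Rightarrow> int" where "mx i = Max {j \<in> {1..int n}. R i j}"

lemma finite_sub: "finite {j \<in> {1..int n}. P j}"
  by (rule finite_subset[of _ "{1..int n}"]) auto

lemma nxtE:
  assumes "later i"
  shows "i < nxt i" "R i (nxt i)" "\<And>j. R i j \<Longrightarrow> i < j \<Longrightarrow> nxt i \<le> j"
proof -
  let ?A = "{j \<in> {1..int n}. i < j \<and> R i j}"
  have "?A \<noteq> {}" using assms R_range unfolding later_def by blast
  then have "nxt i \<in> ?A" unfolding nxt_def by (rule Min_in[OF finite_sub])
  then show "i < nxt i" "R i (nxt i)" by simp_all
  show "nxt i \<le> j" if "R i j" "i < j" for j
    unfolding nxt_def using R_range that by (intro Min_le[OF finite_sub]) blast
qed

lemma prvE:
  assumes "earlier i"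
  shows "prv i < i" "R i (prv i)" "\<And>j. R i j \<Longrightarrow> j < i \<Longrightarrow> j \<le> prv i"
proof -
  let ?A = "{j \<in> {1..int n}. j < i \<and> R i j}"
  have "?A \<noteq> {}" using assms R_range unfolding earlier_def by blast
  then have "prv i \<in> ?A" unfolding prv_def by (rule Max_in[OF finite_sub])
  then show "prv i < i" "R i (prv i)" by simp_all
  show "j \<le> prv i" if "R i j" "j < i" for j
    unfolding prv_def using R_range that by (intro Max_ge[OF finite_sub]) blast
qed

lemma mnE:
  assumes "i \<in> {1..int n}"
  shows "R i (mn i)" "\<And>j. R i j \<Longrightarrow> mn i \<le> j"
proof -
  have "{j \<in> {1..int n}. R i j} \<noteq> {}" using R_refl[OF assms] assms by blast
  then have "mn i \<in> {j \<in> {1..int n}. R i j}" unfolding mn_def by (rule Min_in[OF finite_sub])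
  then show "R i (mn i)" by simp
  show "mn i \<le> j" if "R i j" for j
    unfolding mn_def using R_range that by (intro Min_le[OF finite_sub]) blast
qed

lemma mxE:
  assumes "i \<in> {1..int n}"
  shows "R i (mx i)" "\<And>j. R i j \<Longrightarrow> j \<le> mx i"
proof -
  have "{j \<in> {1..int n}. R i j} \<noteq> {}" using R_refl[OF assms] assms by blast
  then have "mx i \<in> {j \<in> {1..int n}. R i j}" unfolding mx_def by (rule Max_in[OF finite_sub])
  then show "R i (mx i)" by simp
  show "j \<le> mx i" if "R i j" for j
    unfolding mx_def using R_range that by (intro Max_ge[OF finite_sub]) blast
qed

lemma mn_eqI: "R i m \<Longrightarrow> \<not> earlier m \<Longrightarrow> mn i = m"
  using mnE[of i] R_range[of i m] R_sym[of i m] R_trans[of m i "mn i"] unfolding earlier_def by force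

lemma mx_eqI: "R i m \<Longrightarrow> \<not> later m \<Longrightarrow> mx i = m"
  using mxE[of i] R_range[of i m] R_sym[of i m] R_trans[of m i "mx i"] unfolding later_def by force

lemma not_earlier_mn: "i \<in> {1..int n} \<Longrightarrow> \<not> earlier (mn i)"
  unfolding earlier_def using mnE R_trans by (meson not_le)

lemma not_later_mx: "i \<in> {1..int n} \<Longrightarrow> \<not> later (mx i)"
  unfolding later_def using mxE R_trans by (meson not_le)

text \<open>
  Each element is mapped to the next one in its block and the last one back to the first; for a marked
  block the sign changes on the way back, so that the block and its negative form a single cycle.
\<close>

definition val :: "int \<Rightarrow> int" where
  "val i = (if later i then nxt i else if i \<in> F then - mn i else mn i)"

definition ival :: "int \<Rightarrow> int" where
  "ival i = (if earlier i then prv i else if i \<in> F then - mx i else mx i)"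

definition perm :: "int \<Rightarrow> int" where
  "perm x = (if x \<in> {1..int n} then val x else if - x \<in> {1..int n} then - val (- x) else x)"

definition iperm :: "int \<Rightarrow> int" where
  "iperm x = (if x \<in> {1..int n} then ival x else if - x \<in> {1..int n} then - ival (- x) else x)"

lemma perm_pos: "i \<in> {1..int n} \<Longrightarrow> perm i = val i"
  and iperm_pos: "i \<in> {1..int n} \<Longrightarrow> iperm i = ival i"
  by (simp_all add: perm_def iperm_def)

lemma perm_odd: "perm (- x) = - perm x" and iperm_odd: "iperm (- x) = - iperm x"
  by (auto simp: perm_def iperm_def)

lemma iperm_perm_pos:
  assumes i: "i \<in> {1..int n}" shows "iperm (perm i) = i"
proof (cases "later i")
  case True
  note N = nxtE[OF True]
  have e: "earlier (nxt i)" unfolding earlier_def using N R_sym by blast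
  have "prv (nxt i) = i"
  proof (rule antisym)
    show "i \<le> prv (nxt i)" using prvE(3)[OF e] N R_sym by blast
    show "prv (nxt i) \<le> i"
    proof (rule ccontr)
      assume "\<not> prv (nxt i) \<le> i"
      then have "nxt i \<le> prv (nxt i)" using N R_trans prvE(2)[OF e] by (meson not_le)
      then show False using prvE(1)[OF e] by simp
    qed
  qed
  moreover have "nxt i \<in> {1..int n}" using R_range N by blast
  ultimately show ?thesis using True i e by (simp add: perm_pos iperm_pos val_def ival_def)
next
  case False
  have m: "mn i \<in> {1..int n}" "R (mn i) i" using mnE(1)[OF i] R_range R_sym by blast+
  have "mx (mn i) = i" using m(2) False by (rule mx_eqI)
  moreover have "mn i \<in> F \<longleftrightarrow> i \<in> F" using F_closed m(2) R_sym by blast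
  ultimately show ?thesis using False i m(1) not_earlier_mn[OF i]
    by (simp add: perm_pos iperm_pos val_def ival_def iperm_odd)
qed

lemma perm_iperm_pos:
  assumes i: "i \<in> {1..int n}" shows "perm (iperm i) = i"
proof (cases "earlier i")
  case True
  note N = prvE[OF True]
  have e: "later (prv i)" unfolding later_def using N R_sym by blast
  have "nxt (prv i) = i"
  proof (rule antisym)
    show "nxt (prv i) \<le> i" using nxtE(3)[OF e] N R_sym by blast
    show "i \<le> nxt (prv i)"
    proof (rule ccontr)
      assume "\<not> i \<le> nxt (prv i)"
      then have "nxt (prv i) \<le> prv i" using N R_trans nxtE(2)[OF e] by (meson not_le)
      then show False using nxtE(1)[OF e] by simp
    qed
  qed
  moreover have "prv i \<in> {1..int n}" using R_range N by blast
  ultimately show ?thesis using True i e by (simp add: perm_pos iperm_pos val_def ival_def)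
next
  case False
  have m: "mx i \<in> {1..int n}" "R (mx i) i" using mxE(1)[OF i] R_range R_sym by blast+
  have "mn (mx i) = i" using m(2) False by (rule mn_eqI)
  moreover have "mx i \<in> F \<longleftrightarrow> i \<in> F" using F_closed m(2) R_sym by blast
  ultimately show ?thesis using False i m(1) not_later_mx[OF i]
    by (simp add: perm_pos iperm_pos val_def ival_def perm_odd)
qed

lemma perm_inverse: "iperm (perm x) = x" "perm (iperm x) = x"
proof -
  consider "x \<in> {1..int n}" | "- x \<in> {1..int n}" | "x \<notin> {1..int n}" "- x \<notin> {1..int n}" by blast
  then have "iperm (perm x) = x \<and> perm (iperm x) = x"
  proof cases
    case 2
    then show ?thesis
      using iperm_perm_pos[of "- x"] perm_iperm_pos[of "- x"] by (simp add: perm_odd iperm_odd)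
  next
    case 3
    then have "perm x = x" "iperm x = x" by (simp_all only: perm_def iperm_def if_False)
    then show ?thesis by simp
  qed (simp add: iperm_perm_pos perm_iperm_pos)
  then show "iperm (perm x) = x" "perm (iperm x) = x" by simp_all
qed

lemma inv_perm: "inv perm = iperm"
  by (rule inv_equality) (simp_all add: perm_inverse)

lemma perm_signed: "perm \<in> signed_perms n"
  unfolding signed_perms_def
proof (intro CollectI conjI allI)
  have out: "perm x = x" if "x \<notin> signed_range n" for x
  proof -
    have "x \<notin> {1..int n}" "- x \<notin> {1..int n}" using that by (auto simp: signed_range_def)
    then show ?thesis by (simp only: perm_def if_False)
  qed
  have "bij perm" by (rule o_bij[of iperm]) (auto simp: perm_inverse)
  then show "perm permutes signed_range n" unfolding permutes_def using out bij_pointE by metis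
qed (rule perm_odd)

lemma exceedance_iff: "i \<in> {1..int n} \<Longrightarrow> i < perm i \<longleftrightarrow> later i"
  using nxtE(1)[of i] mnE[of i] R_refl[of i] R_range[of i "mn i"] by (force simp: perm_pos val_def)

lemma inv_exceedance_iff: "i \<in> {1..int n} \<Longrightarrow> iperm i < i \<longleftrightarrow> earlier i \<or> i \<in> F"
  using prvE(1)[of i] mxE[of i] R_refl[of i] R_range[of i "mx i"] by (force simp: iperm_pos ival_def)

lemma under_arc:
  assumes "later i" "i < k" "k < nxt i"
  shows "k \<notin> F" "R k j \<Longrightarrow> i < j \<and> j < nxt i"
proof -
  note N = nxtE[OF assms(1)]
  have nR: "\<not> R i k" using N(3)[of k] assms(2,3) by auto
  show "k \<notin> F" using outer[of k i "nxt i"] nR N assms by blast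
  assume kj: "R k j"
  have "j \<noteq> i" "j \<noteq> nxt i" using kj nR R_sym R_trans N(2) by blast+
  moreover have "\<not> j < i" using nc[of j i k "nxt i"] kj assms N nR R_sym R_trans by blast
  moreover have "\<not> nxt i < j" using nc[of i k "nxt i" j] kj assms N nR by blast
  ultimately show "i < j \<and> j < nxt i" by linarith
qed

text \<open>
  If \<open>i\<close> starts an arc, the element \<open>i + 1\<close> lies under it or is its end, and nothing under an arc is mapped beyond
  it. If not, \<open>i\<close> is mapped to the minimum of its block, negated for a marked block; as no arc passes over a
  marked block, the negated minima decrease from left to right.
\<close>

lemma descent_iff:
  assumes i: "i \<in> {1..int n}" "i + 1 \<in> {1..int n}"
  defines "a \<equiv> later" and "b \<equiv> \<lambda>i. earlier i \<or> i \<in> F"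
  shows "perm i > perm (i + 1) \<longleftrightarrow>
    (a i \<and> \<not> (a (i + 1) \<and> b (i + 1))) \<or> (\<not> a i \<and> \<not> a (i + 1) \<and> b (i + 1))"
proof -
  let ?j = "i + 1"
  note m = mnE[OF i(1)] and m' = mnE[OF i(2)]
  have up: "perm ?j > ?j" if "later ?j" using that exceedance_iff[OF i(2)] by simp
  show ?thesis
  proof (cases "later i")
    case True
    note N = nxtE[OF True]
    have p: "perm i = nxt i" using True i by (simp add: perm_pos val_def)
    show ?thesis
    proof (cases "nxt i = ?j")
      case e: True
      then have "earlier ?j" unfolding earlier_def using N R_sym by force
      moreover have "perm ?j < ?j" if "\<not> later ?j"
      proof -
        have "mn ?j \<le> i" using m'(2)[of i] N e R_sym by simp
        moreover have "mn ?j \<ge> 1" using m'(1) R_range[of ?j "mn ?j"] by simp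
        ultimately show ?thesis using that i by (auto simp: perm_pos val_def)
      qed
      ultimately show ?thesis unfolding p e a_def b_def using True up by fastforce
    next
      case False
      then have j: "i < ?j" "?j < nxt i" using N(1) by auto
      note U = under_arc[OF True j]
      have ne: "\<not> earlier ?j" unfolding earlier_def using U(2) by force
      have "perm ?j < nxt i"
      proof (cases "later ?j")
        case True
        then show ?thesis using U(2)[OF nxtE(2)[OF True]] i by (simp add: perm_pos val_def)
      next
        case False
        then show ?thesis using U(1) U(2)[OF m'(1)] i by (simp add: perm_pos val_def)
      qed
      then show ?thesis unfolding p a_def b_def using True ne U(1) by simp
    qed
  next
    case nl: False
    have p: "perm i = (if i \<in> F then - mn i else mn i)" using nl i by (simp add: perm_pos val_def)
    have mi: "1 \<le> mn i" "mn i \<le> i" using m(1) R_range[of i "mn i"] m(2)[OF R_refl[OF i(1)]] by auto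
    have nR: "\<not> R i ?j" using nl unfolding later_def by force
    show ?thesis
    proof (cases "later ?j")
      case True
      then show ?thesis using up[OF True] nl mi i unfolding p a_def b_def by auto
    next
      case nl': False
      have p': "perm ?j = (if ?j \<in> F then - mn ?j else mn ?j)" using nl' i by (simp add: perm_pos val_def)
      have mj: "1 \<le> mn ?j" "mn ?j \<le> ?j" using m'(1) R_range[of ?j "mn ?j"] m'(2)[OF R_refl[OF i(2)]] by auto
      have "perm i > perm ?j \<longleftrightarrow> earlier ?j \<or> ?j \<in> F"
      proof (cases "?j \<in> F")
        case jF: True
        have "mn i < mn ?j" if "i \<in> F"
        proof (rule ccontr)
          assume "\<not> mn i < mn ?j"
          then have "mn ?j < i \<or> mn ?j = i" using mi by linarith
          moreover have "mn ?j \<noteq> i" using m'(1) nR R_sym by metis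
          ultimately have "R (mn ?j) i" using outer[OF that, of "mn ?j" ?j] m'(1) R_sym by auto
          then show False using nR m'(1) R_sym R_trans by blast
        qed
        then show ?thesis using jF mi mj unfolding p p' by auto
      next
        case jF: False
        show ?thesis
        proof (cases "earlier ?j")
          case True
          then have "mn ?j < ?j" unfolding earlier_def using m'(2) by force
          moreover have "mn ?j \<noteq> i" using m'(1) nR R_sym by metis
          ultimately have lt: "mn ?j < i" "i < ?j" by simp_all
          have nRi: "\<not> R (mn ?j) i" using nR m'(1) R_sym R_trans by blast
          then have "i \<notin> F" using outer[of i "mn ?j" ?j] lt m'(1) R_sym by blast
          moreover have "mn ?j < mn i"
          proof (rule ccontr)
            assume a: "\<not> mn ?j < mn i"
            have "mn i \<noteq> mn ?j" using nRi m(1) R_sym by metis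
            then have "R (mn i) (mn ?j)"
              using nc[of "mn i" "mn ?j" i ?j] a lt m(1) m'(1) R_sym by auto
            then show False using nRi m(1) R_sym R_trans by blast
          qed
          ultimately show ?thesis using True jF unfolding p p' by simp
        next
          case False
          then have "mn ?j = ?j" by (intro mn_eqI R_refl i)
          then show ?thesis using False jF mi unfolding p p' by auto
        qed
      qed
      then show ?thesis using nl nl' unfolding a_def b_def by simp
    qed
  qed
qed

lemma inv_descent_iff:
  assumes i: "i \<in> {1..int n}" "i + 1 \<in> {1..int n}"
  defines "a \<equiv> later" and "b \<equiv> \<lambda>i. earlier i \<or> i \<in> F"
  shows "iperm i > iperm (i + 1) \<longleftrightarrow> (a i \<and> \<not> b i) \<or> (\<not> a i \<and> b (i + 1))"
proof -
  let ?j = "i + 1"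
  note m = mxE[OF i(1)] and m' = mxE[OF i(2)]
  have lo: "iperm i < i \<longleftrightarrow> b i" using inv_exceedance_iff[OF i(1)] by (simp add: b_def)
  have lo': "iperm ?j < ?j \<longleftrightarrow> b ?j" using inv_exceedance_iff[OF i(2)] by (simp add: b_def)
  have ne: "iperm i \<noteq> iperm ?j" using perm_inverse(2)[of i] perm_inverse(2)[of ?j] by auto
  show ?thesis
  proof (cases "later i")
    case True
    note N = nxtE[OF True]
    have under: "\<not> b ?j \<and> mx ?j < nxt i" if "nxt i \<noteq> ?j"
    proof -
      have j: "i < ?j" "?j < nxt i" using that N(1) by auto
      show ?thesis using under_arc[OF True j] m'(1) unfolding b_def earlier_def by force
    qed
    have step: "iperm ?j = i" if "nxt i = ?j"
      using iperm_perm_pos[OF i(1)] True i(1) that by (simp add: perm_pos val_def)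
    show ?thesis
    proof (cases "b i")
      case bi: True
      have "iperm i < iperm ?j"
      proof (cases "nxt i = ?j")
        case e: True
        then show ?thesis using step lo bi by simp
      next
        case False
        then show ?thesis using under lo lo' bi by force
      qed
      then show ?thesis using True bi by (simp add: a_def)
    next
      case bi: False
      then have p: "iperm i = mx i" using i by (simp add: iperm_pos ival_def b_def)
      have "nxt i \<le> mx i" using m(2)[OF N(2)] .
      then have "iperm i > iperm ?j"
      proof (cases "nxt i = ?j")
        case True
        then show ?thesis using step p \<open>nxt i \<le> mx i\<close> by simp
      next
        case False
        then have "\<not> b ?j" "mx ?j < nxt i" using under by simp_all
        then show ?thesis using p \<open>nxt i \<le> mx i\<close> i by (simp add: iperm_pos ival_def b_def)
      qed
      then show ?thesis using True bi by (simp add: a_def)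
    qed
  next
    case nl: False
    have nR: "\<not> R i ?j" using nl unfolding later_def by force
    have "iperm i > iperm ?j \<longleftrightarrow> b ?j"
    proof (cases "b ?j")
      case bj: False
      have "mx i = i" using nl by (intro mx_eqI R_refl i)
      then have "iperm i \<le> i" using lo i(1) by (auto simp: iperm_pos ival_def b_def)
      then show ?thesis using bj lo' by simp
    next
      case bj: True
      show ?thesis
      proof (cases "b i")
        case False
        then have "mx i = i" "iperm i = mx i" using nl i
          by (auto simp: iperm_pos ival_def b_def intro!: mx_eqI R_refl)
        then show ?thesis using bj lo' ne by simp
      next
        case bi: True
        have "iperm i > iperm ?j"
        proof (cases "earlier ?j")
          case e: True
          note N = prvE[OF e]
          have "prv ?j \<noteq> i" using N(2) nR R_sym by metis
          then have lt: "prv ?j < i" "i < ?j" using N(1) by simp_all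
          have nRp: "\<not> R (prv ?j) i" using nR N(2) R_sym R_trans by blast
          then have "i \<notin> F" using outer[of i "prv ?j" ?j] lt N(2) R_sym by blast
          then have ei: "earlier i" using bi by (simp add: b_def)
          note N' = prvE[OF ei]
          have "prv ?j < prv i"
          proof (rule ccontr)
            assume a: "\<not> prv ?j < prv i"
            have "prv i \<noteq> prv ?j" using nRp N'(2) R_sym by metis
            then have "R (prv i) (prv ?j)"
              using nc[of "prv i" "prv ?j" i ?j] a lt N(2) N'(2) R_sym by auto
            then show False using nRp N'(2) R_sym R_trans by blast
          qed
          then show ?thesis using e ei i by (simp add: iperm_pos ival_def)
        next
          case ne': False
          then have jF: "?j \<in> F" using bj by (simp add: b_def)
          have pj: "iperm ?j = - mx ?j" using ne' jF i by (simp add: iperm_pos ival_def)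
          have mj: "?j \<le> mx ?j" using m'(2)[OF R_refl[OF i(2)]] .
          show ?thesis
          proof (cases "earlier i")
            case True
            then have "1 \<le> iperm i" using prvE(2)[OF True] R_range[of i "prv i"] i by (simp add: iperm_pos ival_def)
            then show ?thesis using pj mj i by simp
          next
            case False
            then have "iperm i = - mx i" using bi i by (simp add: iperm_pos ival_def b_def)
            moreover have "mx i = i" using nl by (intro mx_eqI R_refl i)
            ultimately show ?thesis using pj mj by simp
          qed
        qed
        then show ?thesis using bj by simp
      qed
    qed
    then show ?thesis using nl by (simp add: a_def)
  qed
qed

end


section \<open>Words of openers and closers\<close>

text \<open>
  The letter of \<open>i\<close> records whether its block continues to the right and whether it continues
  to the left. Words list the letter of the largest element first; a word starts at the
  height \<open>h\<close> given by the number of marked blocks, which have to be closed.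
\<close>

type_synonym letter = "bool \<times> bool"

fun word_height :: "nat \<Rightarrow> letter list \<Rightarrow> nat" where
  "word_height h [] = h"
| "word_height h (x # w) = word_height h w + of_bool (fst x) - of_bool (snd x)"

fun admissible :: "nat \<Rightarrow> letter list \<Rightarrow> bool" where
  "admissible h [] = True"
| "admissible h (x # w) \<longleftrightarrow> admissible h w \<and> (snd x \<longrightarrow> 1 \<le> word_height h w)"

definition words :: "nat \<Rightarrow> nat \<Rightarrow> nat \<Rightarrow> letter list set" where
  "words h n k = {w. length w = n \<and> admissible h w \<and> word_height h w = k}"

definition code :: "nat \<Rightarrow> (nat \<Rightarrow> letter) \<Rightarrow> letter list" where
  "code n p = map p (rev [1..<Suc n])"

lemma code_simps [simp]:
  "code 0 p = []" "code (Suc n) p = p (Suc n) # code n p" "length (code n p) = n"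
  by (simp_all add: code_def)

lemma code_nth: "length w = n \<Longrightarrow> code n (\<lambda>i. w ! (n - i)) = w"
proof (induction w arbitrary: n)
  case (Cons x w)
  then obtain m where m: "n = Suc m" "length w = m" by auto
  have "code m (\<lambda>i. (x # w) ! (Suc m - i)) = code m (\<lambda>i. w ! (m - i))"
    unfolding code_def by (intro map_cong) (auto simp: Suc_diff_le)
  then show ?case using Cons.IH[OF m(2)] m by simp
qed simp

lemma code_eq_iff: "code n p = code n p' \<longleftrightarrow> (\<forall>i. 1 \<le> i \<and> i \<le> n \<longrightarrow> p i = p' i)"
  by (induction n) (auto simp: le_Suc_eq)

lemma card_interval_Suc:
  "card {j \<in> {1..Suc n}. P j} = card {j \<in> {1..n}. P j} + of_bool (P (Suc n))"
proof -
  have "{j \<in> {1..Suc n}. P j} = (if P (Suc n) then insert (Suc n) {j \<in> {1..n}. P j} else {j \<in> {1..n}. P j})"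
    by (auto simp: le_Suc_eq)
  then show ?thesis by simp
qed

lemma word_height_code:
  "admissible h (code n p) \<Longrightarrow>
     word_height h (code n p) + card {j \<in> {1..n}. snd (p j)} = h + card {j \<in> {1..n}. fst (p j)}"
proof (induction n)
  case (Suc n)
  then show ?case unfolding card_interval_Suc by auto
qed simp

lemma admissible_code:
  assumes "\<And>i. i < n \<Longrightarrow> card {j \<in> {1..i}. snd (p j)} + of_bool (snd (p (Suc i))) \<le> h + card {j \<in> {1..i}. fst (p j)}"
  shows "admissible h (code n p)"
  using assms
proof (induction n)
  case (Suc n)
  then have a: "admissible h (code n p)" by simp
  show ?case using a word_height_code[OF a] Suc.prems[of n] by auto
qed simp

definition exceedance_letter :: "(int \<Rightarrow> int) \<Rightarrow> nat \<Rightarrow> letter" where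
  "exceedance_letter \<sigma> i = (int i < \<sigma> (int i), inv \<sigma> (int i) < int i)"

lemma card_nat_interval: "card {j \<in> {a..b}. P (int j)} = card {j \<in> {int a..int b}. P j}"
proof -
  have "{j \<in> {int a..int b}. P j} = int ` {j \<in> {a..b}. P (int j)}"
  proof (intro set_eqI iffI)
    fix j assume "j \<in> {j \<in> {int a..int b}. P j}"
    then show "j \<in> int ` {j \<in> {a..b}. P (int j)}" by (intro image_eqI[of _ _ "nat j"]) auto
  qed auto
  then show ?thesis by (simp add: card_image)
qed

text \<open>
  For every signed permutation \<open>\<sigma>\<close> the exceedances are mapped injectively to inverse exceedances to their right.
  The remaining inverse exceedances are the positive values that \<open>inv \<sigma>\<close> maps to negative places; their number is
  \<open>neg n \<sigma>\<close>.
\<close>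

lemma exceedance_word:
  assumes \<sigma>: "\<sigma> \<in> signed_perms n"
  shows "code n (exceedance_letter \<sigma>) \<in> words (neg n \<sigma>) n 0"
proof -
  let ?\<tau> = "inv \<sigma>"
  have \<tau>: "?\<tau> \<in> signed_perms n" by (rule signed_inv[OF \<sigma>])
  have st: "\<sigma> (?\<tau> x) = x" "?\<tau> (\<sigma> x) = x" for x
    using signed_permsD(3)[OF \<sigma>] by (simp_all add: bij_is_surj surj_f_inv_f bij_is_inj)
  define A where "A = (\<lambda>i j. {k \<in> {i..j}. k < \<sigma> k})"
  define B where "B = (\<lambda>i j. {k \<in> {i..j}. ?\<tau> k < k})"
  have fin: "finite (A i j)" "finite (B i j)" for i j unfolding A_def B_def by (rule finite_sub_interval)+
  have total: "card (B 1 (int n)) = card (A 1 (int n)) + neg n \<sigma>"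
  proof -
    let ?P = "{k \<in> {1..int n}. ?\<tau> k < 0}"
    have "B 1 (int n) = \<sigma> ` A 1 (int n) \<union> ?P"
    proof (intro set_eqI iffI)
      fix k assume k: "k \<in> B 1 (int n)"
      show "k \<in> \<sigma> ` A 1 (int n) \<union> ?P"
      proof (cases "?\<tau> k < 0")
        case True
        then show ?thesis using k by (simp add: B_def)
      next
        case False
        moreover have "?\<tau> k \<noteq> 0" using signed_perm_eq_0[OF \<tau>, of k] k by (auto simp: B_def)
        ultimately have "?\<tau> k \<in> A 1 (int n)" using k unfolding A_def B_def by (simp add: st)
        then have "\<sigma> (?\<tau> k) \<in> \<sigma> ` A 1 (int n)" by (rule imageI)
        then show ?thesis unfolding st by simp
      qed
    next
      fix k assume "k \<in> \<sigma> ` A 1 (int n) \<union> ?P"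
      then show "k \<in> B 1 (int n)"
      proof
        assume "k \<in> \<sigma> ` A 1 (int n)"
        then obtain l where l: "l \<in> A 1 (int n)" "k = \<sigma> l" by blast
        moreover have "\<bar>\<sigma> l\<bar> \<le> int n" using signed_perm_abs_le[OF \<sigma>, of l] l by (simp add: A_def)
        ultimately show ?thesis unfolding B_def A_def by (simp add: st)
      qed (simp add: B_def)
    qed
    moreover have disj: "\<sigma> ` A 1 (int n) \<inter> ?P = {}" by (auto simp: A_def st)
    ultimately have "card (B 1 (int n)) = card (\<sigma> ` A 1 (int n)) + card ?P"
      using card_Un_disjoint[OF finite_imageI[OF fin(1)] finite_sub_interval disj] by (simp only:)
    moreover have "card (\<sigma> ` A 1 (int n)) = card (A 1 (int n))"
      by (rule card_image) (rule inj_on_subset[OF signed_permsD(4)[OF \<sigma>] subset_UNIV])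
    moreover have "card ?P = neg n \<sigma>" using neg_inv[OF \<sigma>] by (simp add: neg_def)
    ultimately show ?thesis by simp
  qed
  have tail: "card (A (int i + 1) (int n)) \<le> card (B (int i + 2) (int n))" for i
  proof (rule card_inj_on_le[OF _ _ fin(2)])
    show "inj_on \<sigma> (A (int i + 1) (int n))" by (rule inj_on_subset[OF signed_permsD(4)[OF \<sigma>] subset_UNIV])
    show "\<sigma> ` A (int i + 1) (int n) \<subseteq> B (int i + 2) (int n)"
    proof (rule image_subsetI)
      fix l assume l: "l \<in> A (int i + 1) (int n)"
      then have "\<bar>\<sigma> l\<bar> \<le> int n" using signed_perm_abs_le[OF \<sigma>, of l] by (simp add: A_def)
      then show "\<sigma> l \<in> B (int i + 2) (int n)" using l by (simp add: A_def B_def st)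
    qed
  qed
  have split: "card {k \<in> {1..int n}. P k} = card {k \<in> {1..int i}. P k} + card {k \<in> {int i + 1..int n}. P k}"
    if "i \<le> n" for P i
  proof -
    have "{k \<in> {1..int n}. P k} = {k \<in> {1..int i}. P k} \<union> {k \<in> {int i + 1..int n}. P k}" using that by auto
    moreover have "{k \<in> {1..int i}. P k} \<inter> {k \<in> {int i + 1..int n}. P k} = {}" by auto
    ultimately show ?thesis by (simp only: card_Un_disjoint[OF finite_sub_interval finite_sub_interval])
  qed
  have first: "card (B (int i + 1) (int n)) = of_bool (?\<tau> (int i + 1) < int i + 1) + card (B (int i + 2) (int n))"
    if "i < n" for i
  proof -
    have "B (int i + 1) (int n) = (if ?\<tau> (int i + 1) < int i + 1 then insert (int i + 1) (B (int i + 2) (int n)) else B (int i + 2) (int n))"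
    proof -
      have "{int i + 1..int n} = insert (int i + 1) {int i + 2..int n}" using that by auto
      then show ?thesis unfolding B_def by auto
    qed
    moreover have "int i + 1 \<notin> B (int i + 2) (int n)" by (simp add: B_def)
    ultimately show ?thesis using fin by simp
  qed
  have adm: "admissible (neg n \<sigma>) (code n (exceedance_letter \<sigma>))"
  proof (rule admissible_code)
    fix i assume i: "i < n"
    have a: "card {j \<in> {1..i}. fst (exceedance_letter \<sigma> j)} = card (A 1 (int i))"
      unfolding exceedance_letter_def A_def using card_nat_interval[of 1 i "\<lambda>k. k < \<sigma> k"] by simp
    have b: "card {j \<in> {1..i}. snd (exceedance_letter \<sigma> j)} = card (B 1 (int i))"
      unfolding exceedance_letter_def B_def using card_nat_interval[of 1 i "\<lambda>k. ?\<tau> k < k"] by simp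
    have e: "snd (exceedance_letter \<sigma> (Suc i)) \<longleftrightarrow> ?\<tau> (int i + 1) < int i + 1"
      by (simp add: exceedance_letter_def add.commute)
    show "card {j \<in> {1..i}. snd (exceedance_letter \<sigma> j)} + of_bool (snd (exceedance_letter \<sigma> (Suc i)))
        \<le> neg n \<sigma> + card {j \<in> {1..i}. fst (exceedance_letter \<sigma> j)}"
      using total tail[of i] first[OF i] split[OF less_imp_le[OF i], of "\<lambda>k. k < \<sigma> k"]
        split[OF less_imp_le[OF i], of "\<lambda>k. ?\<tau> k < k"]
      unfolding a b A_def B_def e by linarith
  qed
  have a: "card {j \<in> {1..n}. fst (exceedance_letter \<sigma> j)} = card (A 1 (int n))"
    unfolding exceedance_letter_def A_def using card_nat_interval[of 1 n "\<lambda>k. k < \<sigma> k"] by simp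
  have b: "card {j \<in> {1..n}. snd (exceedance_letter \<sigma> j)} = card (B 1 (int n))"
    unfolding exceedance_letter_def B_def using card_nat_interval[of 1 n "\<lambda>k. ?\<tau> k < k"] by simp
  have "word_height (neg n \<sigma>) (code n (exceedance_letter \<sigma>)) = 0"
    using word_height_code[OF adm] total unfolding a b by linarith
  with adm show ?thesis by (simp add: words_def)
qed

lemma words_start_unique:
  assumes "w \<in> words h n k" "w \<in> words h' n k" shows "h = h'"
proof -
  have w: "code n (\<lambda>i. w ! (n - i)) = w" using assms(1) by (intro code_nth) (simp add: words_def)
  show ?thesis
    using word_height_code[of h n "\<lambda>i. w ! (n - i)"] word_height_code[of h' n "\<lambda>i. w ! (n - i)"] assms
    unfolding w words_def by simp
qed

context half_partition
begin

definition b :: "int \<Rightarrow> bool" where "b i \<longleftrightarrow> earlier i \<or> i \<in> F"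

lemma later_range: "later i \<Longrightarrow> i \<in> {1..int n}"
  unfolding later_def using R_range by blast

lemma b_range: "b i \<Longrightarrow> i \<in> {1..int n}"
  unfolding b_def earlier_def using R_range F_range by blast

lemma earlier_nxt: "later i \<Longrightarrow> earlier (nxt i)"
  unfolding earlier_def using nxtE R_sym by blast

lemma later_prv: "earlier i \<Longrightarrow> later (prv i)"
  unfolding later_def using prvE R_sym by blast

lemma perm_later: "later i \<Longrightarrow> perm i = nxt i"
  using later_range by (simp add: perm_pos val_def)

lemma iperm_earlier: "earlier i \<Longrightarrow> iperm i = prv i"
  using b_range[of i] by (simp add: iperm_pos ival_def b_def)

text \<open>An arc closes at the first place where the word returns to its level.\<close>

lemma nxt_balance:
  assumes i: "later i"
  shows "card {k \<in> {i..nxt i - 1}. later k} \<le> card {k \<in> {i + 1..nxt i}. b k}"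
    and "\<And>j. i < j \<Longrightarrow> j < nxt i \<Longrightarrow> card {k \<in> {i + 1..j}. b k} < card {k \<in> {i..j - 1}. later k}"
proof -
  note N = nxtE[OF i]
  have injp: "inj_on perm X" for X by (metis inj_onI perm_inverse(1))
  have injq: "inj_on iperm X" for X by (metis inj_onI perm_inverse(2))
  show "card {k \<in> {i..nxt i - 1}. later k} \<le> card {k \<in> {i + 1..nxt i}. b k}"
  proof (rule card_inj_on_le[OF injp _ finite_sub_interval])
    show "perm ` {k \<in> {i..nxt i - 1}. later k} \<subseteq> {k \<in> {i + 1..nxt i}. b k}"
    proof (rule image_subsetI)
      fix k assume "k \<in> {k \<in> {i..nxt i - 1}. later k}"
      then have k: "i \<le> k" "k < nxt i" "later k" by auto
      have "i < nxt k \<and> nxt k \<le> nxt i"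
      proof (cases "k = i")
        case False
        then show ?thesis using under_arc(2)[OF i _ k(2) nxtE(2)[OF k(3)]] k by simp
      qed (use N in simp)
      then show "perm k \<in> {k \<in> {i + 1..nxt i}. b k}"
        using earlier_nxt[OF k(3)] perm_later[OF k(3)] by (simp add: b_def)
    qed
  qed
  fix j assume j: "i < j" "j < nxt i"
  have "card {k \<in> {i + 1..j}. b k} \<le> card {k \<in> {i + 1..j - 1}. later k}"
  proof (rule card_inj_on_le[OF injq _ finite_sub_interval])
    show "iperm ` {k \<in> {i + 1..j}. b k} \<subseteq> {k \<in> {i + 1..j - 1}. later k}"
    proof (rule image_subsetI)
      fix k assume "k \<in> {k \<in> {i + 1..j}. b k}"
      then have k: "i < k" "k < nxt i" "k \<le> j" "b k" using j by auto
      then have e: "earlier k" using under_arc(1)[OF i k(1,2)] by (simp add: b_def)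
      note P = prvE[OF e]
      have "i < prv k" using under_arc(2)[OF i k(1,2) P(2)] by simp
      then show "iperm k \<in> {k \<in> {i + 1..j - 1}. later k}"
        using P(1) k(3) later_prv[OF e] iperm_earlier[OF e] by simp
    qed
  qed
  also have "\<dots> < card {k \<in> {i..j - 1}. later k}"
  proof (rule psubset_card_mono[OF finite_sub_interval])
    have "i \<in> {k \<in> {i..j - 1}. later k}" "i \<notin> {k \<in> {i + 1..j - 1}. later k}" using i j by simp_all
    moreover have "{k \<in> {i + 1..j - 1}. later k} \<subseteq> {k \<in> {i..j - 1}. later k}" by auto
    ultimately show "{k \<in> {i + 1..j - 1}. later k} \<subset> {k \<in> {i..j - 1}. later k}" by blast
  qed
  finally show "card {k \<in> {i + 1..j}. b k} < card {k \<in> {i..j - 1}. later k}" .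
qed

lemma earlier_iff: "earlier x \<longleftrightarrow> (\<exists>k<x. later k \<and> nxt k = x)"
proof
  assume e: "earlier x"
  note P = prvE[OF e]
  have "perm (iperm x) = x" by (rule perm_inverse)
  then have "nxt (prv x) = x" unfolding iperm_earlier[OF e] perm_later[OF later_prv[OF e]] .
  then show "\<exists>k<x. later k \<and> nxt k = x" using P(1) later_prv[OF e] by blast
qed (use earlier_nxt in blast)

lemma mn_nxt: "later k \<Longrightarrow> mn (nxt k) = mn k"
proof -
  assume k: "later k"
  have kr: "k \<in> {1..int n}" by (rule later_range[OF k])
  have "R (nxt k) (mn k)" using nxtE(2)[OF k] mnE(1)[OF kr] R_sym R_trans by blast
  then show ?thesis using not_earlier_mn[OF kr] by (rule mn_eqI)
qed

lemma mn_first: "x \<in> {1..int n} \<Longrightarrow> \<not> earlier x \<Longrightarrow> mn x = x"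
  by (rule mn_eqI[OF R_refl])

lemma perm_not_later:
  assumes "x \<in> {1..int n}" "\<not> later x"
  shows "perm x = (if b (mn x) then - mn x else mn x)"
proof -
  have "mn x \<in> F \<longleftrightarrow> x \<in> F" using mnE(1)[OF assms(1)] R_sym F_closed by blast
  then show ?thesis using assms not_earlier_mn[OF assms(1)] by (simp add: perm_pos val_def b_def)
qed

end

text \<open>
  By the balance conditions the two predicates determine the next element in each block, and with it the
  minima of the blocks.
\<close>

lemma perm_determined:
  assumes "half_partition n R F" "half_partition n R' F'"
    and later: "\<And>i. half_partition.later R i \<longleftrightarrow> half_partition.later R' i"
    and b: "\<And>i. half_partition.b R F i \<longleftrightarrow> half_partition.b R' F' i"
  shows "half_partition.perm n R F = half_partition.perm n R' F'"
proof -
  interpret P: half_partition n R F by fact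
  interpret Q: half_partition n R' F' by fact
  have nxt: "P.nxt i = Q.nxt i" if i: "P.later i" for i
  proof (rule antisym)
    have i': "Q.later i" using i later by simp
    note pb = P.nxt_balance[OF i] and qb = Q.nxt_balance[OF i']
    show "P.nxt i \<le> Q.nxt i"
    proof (rule ccontr)
      assume "\<not> P.nxt i \<le> Q.nxt i"
      then show False using pb(2)[of "Q.nxt i"] qb(1) Q.nxtE(1)[OF i'] unfolding later b by simp
    qed
    show "Q.nxt i \<le> P.nxt i"
    proof (rule ccontr)
      assume "\<not> Q.nxt i \<le> P.nxt i"
      then show False using qb(2)[of "P.nxt i"] pb(1) P.nxtE(1)[OF i] unfolding later b by simp
    qed
  qed
  have mn: "P.mn x = Q.mn x" if "x \<in> {1..int n}" for x
    using that
  proof (induction "nat x" arbitrary: x rule: less_induct)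
    case less
    show ?case
    proof (cases "P.earlier x")
      case True
      then obtain k where k: "k < x" "P.later k" "P.nxt k = x" unfolding P.earlier_iff by blast
      then have "nat k < nat x" "k \<in> {1..int n}" using P.later_range[OF k(2)] by auto
      then have "P.mn k = Q.mn k" by (rule less.hyps)
      moreover have "Q.later k" "Q.nxt k = x" using k later nxt[OF k(2)] by simp_all
      ultimately show ?thesis using P.mn_nxt[OF k(2)] Q.mn_nxt[of k] k(3) by simp
    next
      case False
      have "\<not> Q.earlier x"
      proof
        assume "Q.earlier x"
        then obtain k where k: "k < x" "Q.later k" "Q.nxt k = x" unfolding Q.earlier_iff by blast
        then have "P.later k" "P.nxt k = x" using later nxt[of k] by simp_all
        then show False using False k(1) unfolding P.earlier_iff by blast
      qed
      then show ?thesis using P.mn_first[OF less.prems False] Q.mn_first[OF less.prems] by simp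
    qed
  qed
  have pos: "P.perm x = Q.perm x" if x: "x \<in> {1..int n}" for x
  proof (cases "P.later x")
    case True
    then show ?thesis using P.perm_later[OF True] Q.perm_later[of x] nxt[OF True] later by simp
  next
    case False
    then show ?thesis using P.perm_not_later[OF x False] Q.perm_not_later[OF x] mn[OF x] later b by simp
  qed
  show ?thesis
  proof
    fix x
    consider "x \<in> {1..int n}" | "- x \<in> {1..int n}" | "x \<notin> {1..int n}" "- x \<notin> {1..int n}" by blast
    then show "P.perm x = Q.perm x"
    proof cases
      case 2
      then show ?thesis using pos[of "- x"] P.perm_odd[of x] Q.perm_odd[of x] by simp
    next
      case 3
      then show ?thesis by (simp only: P.perm_def Q.perm_def if_False)
    qed (rule pos)
  qed
qed


text \<open>
  Conversely the blocks can be read off the heights \<open>K\<close> of a word: two elements are in the same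
  block if they lie on the same level and the height does not drop below it in between.
\<close>

locale height_word =
  fixes n :: nat and a b :: "int \<Rightarrow> bool" and K :: "int \<Rightarrow> int"
  assumes K_step: "x \<in> {1..int n} \<Longrightarrow> K x = K (x - 1) + of_bool (a x) - of_bool (b x)"
    and K_nonneg: "0 \<le> g \<Longrightarrow> 0 \<le> K g"
    and K_close: "x \<in> {1..int n} \<Longrightarrow> b x \<Longrightarrow> 1 \<le> K (x - 1)"
    and K_end: "K (int n) = 0"
begin

definition level :: "int \<Rightarrow> int" where "level x = K (x - 1) + 1 - of_bool (b x)"

definition same_block :: "int \<Rightarrow> int \<Rightarrow> bool" where
  "same_block x y \<longleftrightarrow> x \<in> {1..int n} \<and> y \<in> {1..int n} \<and> level x = level y \<and>
     (\<forall>g. min x y \<le> g \<and> g < max x y \<longrightarrow> level x \<le> K g)"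

definition marked :: "int set" where
  "marked = {x \<in> {1..int n}. \<forall>g. 0 \<le> g \<and> g < x \<longrightarrow> level x \<le> K g}"

lemma level_right: "x \<in> {1..int n} \<Longrightarrow> level x = K x + 1 - of_bool (a x)"
  using K_step[of x] by (simp add: level_def)

lemma level_ge:
  assumes "x \<in> {1..int n}" shows "K x \<le> level x" "K (x - 1) \<le> level x" "1 \<le> level x"
proof -
  show "K x \<le> level x" using level_right[OF assms] by (cases "a x") simp_all
  show "K (x - 1) \<le> level x" by (simp add: level_def)
  show "1 \<le> level x"
    using K_close[OF assms] K_nonneg[of "x - 1"] assms by (cases "b x") (simp_all add: level_def)
qed

lemma sb_less:
  "x < y \<Longrightarrow> same_block x y \<longleftrightarrow> x \<in> {1..int n} \<and> y \<in> {1..int n} \<and> level x = level y \<and>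
     (\<forall>g. x \<le> g \<and> g < y \<longrightarrow> level x \<le> K g)"
  by (simp add: same_block_def)

lemma sb_sym: "same_block x y \<Longrightarrow> same_block y x"
  by (auto simp: same_block_def min.commute max.commute)

lemma sb_trans:
  assumes "same_block x y" "same_block y z" shows "same_block x z"
proof -
  have "level x \<le> K g" if "min x z \<le> g" "g < max x z" for g
  proof -
    have "(min x y \<le> g \<and> g < max x y) \<or> (min y z \<le> g \<and> g < max y z)" using that by linarith
    then show ?thesis using assms unfolding same_block_def by auto
  qed
  then show ?thesis using assms unfolding same_block_def by auto
qed

lemma half_partition: "half_partition n same_block marked"
proof
  fix x y assume "same_block x y"
  then show "x \<in> {1..int n} \<and> y \<in> {1..int n}" by (simp add: same_block_def)
next
  fix x assume "x \<in> {1..int n}"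
  then show "same_block x x" by (simp add: same_block_def)
next
  fix x y assume "same_block x y" then show "same_block y x" by (rule sb_sym)
next
  fix x y z assume "same_block x y" "same_block y z" then show "same_block x z" by (rule sb_trans)
next
  show "marked \<subseteq> {1..int n}" by (auto simp: marked_def)
next
  fix x y assume x: "x \<in> marked" and xy: "same_block x y"
  have "level y \<le> K g" if g: "0 \<le> g" "g < y" for g
  proof (cases "g < x")
    case True
    then show ?thesis using x xy g by (simp add: marked_def same_block_def)
  next
    case False
    then have "min x y \<le> g \<and> g < max x y" using g by simp
    then show ?thesis using xy unfolding same_block_def by metis
  qed
  then show "y \<in> marked" using xy by (simp add: marked_def same_block_def)
next
  fix p q r s assume pq: "p < q" "q < r" "r < s" and pr: "same_block p r" and qs: "same_block q s"
  have R: "p \<in> {1..int n}" "q \<in> {1..int n}" "r \<in> {1..int n}" using pr qs by (simp_all add: same_block_def)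
  have 1: "\<And>g. p \<le> g \<Longrightarrow> g < r \<Longrightarrow> level p \<le> K g" "level p = level r"
    using pr sb_less[of p r] pq by auto
  have 2: "\<And>g. q \<le> g \<Longrightarrow> g < s \<Longrightarrow> level q \<le> K g" using qs sb_less[of q s] pq by auto
  have "level p \<le> level q" using 1(1)[of "q - 1"] level_ge(2)[OF R(2)] pq by linarith
  moreover have "level q \<le> level r" using 2[of "r - 1"] level_ge(2)[OF R(3)] pq by linarith
  ultimately have "level p = level q" using 1(2) by simp
  then show "same_block p q" using sb_less[OF pq(1)] R 1(1) pq by auto
next
  fix i x y assume i: "i \<in> marked" and xi: "x < i" and iy: "i < y" and xy: "same_block x y"
  have R: "x \<in> {1..int n}" "i \<in> {1..int n}" using xy i by (simp_all add: same_block_def marked_def)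
  have 1: "\<And>g. x \<le> g \<Longrightarrow> g < y \<Longrightarrow> level x \<le> K g" using xy sb_less[of x y] xi iy by auto
  have "level x \<le> level i" using 1[of "i - 1"] level_ge(2)[OF R(2)] xi iy by linarith
  moreover have "level i \<le> K x" using i xi R by (simp add: marked_def)
  ultimately have "level x = level i" using level_ge(1)[OF R(1)] by simp
  then show "same_block x i" using sb_less[OF xi] R 1 iy by auto
qed

lemma sb_later_iff:
  assumes x: "x \<in> {1..int n}" shows "(\<exists>y>x. same_block x y) \<longleftrightarrow> a x"
proof
  assume "\<exists>y>x. same_block x y"
  then obtain y where y: "x < y" "same_block x y" by blast
  then have "level x \<le> K x" using sb_less[OF y(1)] by auto
  then show "a x" using level_right[OF x] by (cases "a x") simp_all
next
  assume ax: "a x"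
  then have Kx: "K x = level x" using level_right[OF x] by simp
  let ?P = "\<lambda>g. x \<le> g \<and> g \<le> int n \<and> K g < level x"
  let ?G = "{g \<in> {x..int n}. K g < level x}"
  have "int n \<in> ?G" using K_end level_ge(3)[OF x] x by simp
  then have ne: "?G \<noteq> {}" by blast
  define g where "g = Min ?G"
  have g: "g \<in> ?G" unfolding g_def by (rule Min_in[OF finite_sub_interval ne])
  have gmin: "level x \<le> K k" if "x \<le> k" "k < g" for k
  proof (rule ccontr)
    assume "\<not> level x \<le> K k"
    then have "k \<in> ?G" using that g by simp
    then have "g \<le> k" unfolding g_def by (rule Min_le[OF finite_sub_interval])
    then show False using that by simp
  qed
  have xg: "x < g" using g Kx by (cases "x = g") auto
  have gr: "g \<in> {1..int n}" using g x by simp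
  have "level x \<le> K (g - 1)" using gmin[of "g - 1"] xg by simp
  moreover have "K g < level x" using g by simp
  ultimately have "b g" "K (g - 1) = level x" using K_step[OF gr] by (cases "a g"; cases "b g"; simp)+
  then have "level g = level x" by (simp add: level_def)
  then have "same_block x g" using sb_less[OF xg] x gr gmin by auto
  then show "\<exists>y>x. same_block x y" using xg by blast
qed

lemma sb_earlier_iff:
  assumes x: "x \<in> {1..int n}" shows "(\<exists>y<x. same_block x y) \<or> x \<in> marked \<longleftrightarrow> b x"
proof
  assume "(\<exists>y<x. same_block x y) \<or> x \<in> marked"
  then have "level x \<le> K (x - 1)"
  proof
    assume "\<exists>y<x. same_block x y"
    then obtain y where y: "y < x" "same_block y x" using sb_sym by blast
    then show ?thesis using sb_less[OF y(1)] by auto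
  qed (use x in \<open>simp add: marked_def\<close>)
  then show "b x" by (cases "b x") (simp_all add: level_def)
next
  assume bx: "b x"
  then have Kx: "K (x - 1) = level x" by (simp add: level_def)
  let ?G = "{g \<in> {0..x - 1}. K g < level x}"
  show "(\<exists>y<x. same_block x y) \<or> x \<in> marked"
  proof (cases "?G = {}")
    case True
    then have "level x \<le> K g" if "0 \<le> g" "g < x" for g using that by force
    then show ?thesis using x by (simp add: marked_def)
  next
    case ne: False
    define g where "g = Max ?G"
    have g: "g \<in> ?G" unfolding g_def by (rule Max_in[OF finite_sub_interval ne])
    have gmax: "level x \<le> K k" if "g < k" "k < x" for k
    proof (rule ccontr)
      assume "\<not> level x \<le> K k"
      then have "k \<in> ?G" using that g by simp
      then have "k \<le> g" unfolding g_def by (rule Max_ge[OF finite_sub_interval])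
      then show False using that by simp
    qed
    have gx: "g + 1 < x" using g Kx by (cases "g = x - 1") auto
    have yr: "g + 1 \<in> {1..int n}" using g x gx by simp
    have "level x \<le> K (g + 1)" using gmax[of "g + 1"] gx by simp
    moreover have "K g < level x" using g by simp
    ultimately have "a (g + 1)" "K (g + 1) = level x"
      using K_step[OF yr] by (cases "a (g + 1)"; cases "b (g + 1)"; simp)+
    then have "level (g + 1) = level x" using level_right[OF yr] by simp
    then have "same_block (g + 1) x" using sb_less[OF gx] x yr gmax by auto
    then show ?thesis using gx sb_sym by blast
  qed
qed

end

definition half_perms :: "nat \<Rightarrow> (int \<Rightarrow> int) set" where
  "half_perms n = {half_partition.perm n R F | R F. half_partition n R F}"

text \<open>
  Two halves with the same word have the same permutation by \<open>perm_determined\<close>, and every word comes from the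
  blocks that are read off its heights.
\<close>

lemma half_perms_words:
  "bij_betw (\<lambda>\<sigma>. code n (exceedance_letter \<sigma>)) (half_perms n) (\<Union>h\<le>n. words h n 0)"
  unfolding bij_betw_def
proof
  have letter: "exceedance_letter (half_partition.perm n R F) i
      = (half_partition.later R (int i), half_partition.b R F (int i))"
    if hp: "half_partition n R F" and i: "1 \<le> i" "i \<le> n" for R F i
  proof -
    interpret half_partition n R F by fact
    show ?thesis using exceedance_iff[of "int i"] inv_exceedance_iff[of "int i"] i
      by (simp add: exceedance_letter_def inv_perm b_def)
  qed
  show "inj_on (\<lambda>\<sigma>. code n (exceedance_letter \<sigma>)) (half_perms n)"
  proof (rule inj_onI)
    fix \<sigma> \<tau> assume "\<sigma> \<in> half_perms n" "\<tau> \<in> half_perms n"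
      and eq: "code n (exceedance_letter \<sigma>) = code n (exceedance_letter \<tau>)"
    then obtain R F R' F' where R: "half_partition n R F" "\<sigma> = half_partition.perm n R F"
      and R': "half_partition n R' F'" "\<tau> = half_partition.perm n R' F'"
      unfolding half_perms_def by blast
    interpret P: half_partition n R F by fact
    interpret Q: half_partition n R' F' by fact
    have e: "P.later (int i) = Q.later (int i) \<and> P.b (int i) = Q.b (int i)" if i: "1 \<le> i" "i \<le> n" for i
      using eq letter[OF R(1) i] letter[OF R'(1) i] i unfolding code_eq_iff R(2) R'(2) by auto
    have e': "P.later i = Q.later i \<and> P.b i = Q.b i" for i
    proof (cases "i \<in> {1..int n}")
      case True
      then have "1 \<le> nat i" "nat i \<le> n" "int (nat i) = i" by auto
      then show ?thesis using e[of "nat i"] by metis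
    next
      case False
      then show ?thesis using P.later_range Q.later_range P.b_range Q.b_range by blast
    qed
    show "\<sigma> = \<tau>" unfolding R(2) R'(2)
      by (rule perm_determined[OF R(1) R'(1)]) (use e' in simp_all)
  qed
  show "(\<lambda>\<sigma>. code n (exceedance_letter \<sigma>)) ` half_perms n = (\<Union>h\<le>n. words h n 0)"
  proof (intro equalityI subsetI)
    fix w assume "w \<in> (\<lambda>\<sigma>. code n (exceedance_letter \<sigma>)) ` half_perms n"
    then obtain R F where R: "half_partition n R F" "w = code n (exceedance_letter (half_partition.perm n R F))"
      unfolding half_perms_def by blast
    interpret half_partition n R F by fact
    have "neg n perm \<le> card {1..int n}" unfolding neg_def by (rule card_mono) auto
    then have "neg n perm \<le> n" by simp
    then show "w \<in> (\<Union>h\<le>n. words h n 0)" using exceedance_word[OF perm_signed] R(2) by blast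
  next
    fix w assume "w \<in> (\<Union>h\<le>n. words h n 0)"
    then obtain h where w: "length w = n" "admissible h w" "word_height h w = 0"
      by (auto simp: words_def)
    define p where "p = (\<lambda>i. w ! (n - i))"
    have wp: "code n p = w" unfolding p_def by (rule code_nth[OF w(1)])
    have adm: "admissible h (code i p)" if "i \<le> n" for i
      using that
    proof (induction rule: inc_induct)
      case base
      show ?case using w(2) wp by simp
    qed simp
    define K where "K = (\<lambda>g. int (word_height h (code (nat g) p)))"
    define a b where "a = (\<lambda>x. fst (p (nat x)))" and "b = (\<lambda>x. snd (p (nat x)))"
    have Suc_x: "code (nat x) p = p (nat x) # code (nat (x - 1)) p" if "x \<in> {1..int n}" for x
    proof -
      have "1 \<le> x" using that by simp
      then have "nat x = Suc (nat (x - 1))" by arith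
      then show ?thesis by (simp only: code_simps(2))
    qed
    have close: "1 \<le> word_height h (code (nat (x - 1)) p)" if x: "x \<in> {1..int n}" and "b x" for x
    proof -
      have "nat x \<le> n" using x by auto
      then show ?thesis using adm[of "nat x"] \<open>b x\<close> unfolding Suc_x[OF x] b_def by simp
    qed
    interpret height_word n a b K
    proof
      fix x assume x: "x \<in> {1..int n}"
      show "K x = K (x - 1) + of_bool (a x) - of_bool (b x)"
        using close[OF x] unfolding K_def a_def[symmetric] Suc_x[OF x] by (auto simp: a_def b_def)
      show "1 \<le> K (x - 1)" if "b x" using close[OF x that] by (simp add: K_def)
    next
      show "0 \<le> K g" for g by (simp add: K_def)
      show "K (int n) = 0" using w(3) wp by (simp add: K_def)
    qed
    interpret H: half_partition n same_block marked by (rule half_partition)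
    have "exceedance_letter H.perm i = p i" if i: "1 \<le> i" "i \<le> n" for i
    proof -
      have ir: "int i \<in> {1..int n}" using i by simp
      have "H.later (int i) = a (int i)" unfolding H.later_def by (rule sb_later_iff[OF ir])
      moreover have "H.b (int i) = b (int i)" unfolding H.b_def H.earlier_def by (rule sb_earlier_iff[OF ir])
      moreover have "p i = (a (int i), b (int i))" by (simp add: a_def b_def)
      ultimately show ?thesis using letter[OF half_partition i] by (simp only:)
    qed
    then have "code n (exceedance_letter H.perm) = w" using wp code_eq_iff by metis
    moreover have "H.perm \<in> half_perms n" unfolding half_perms_def using half_partition by blast
    ultimately show "w \<in> (\<lambda>\<sigma>. code n (exceedance_letter \<sigma>)) ` half_perms n" by blast
  qed
qed


section \<open>Permutations of noncrossing partitions of type B\<close>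

lemma B_less_trans: "B_less x y \<Longrightarrow> B_less y z \<Longrightarrow> B_less x z"
  and B_less_irrefl: "\<not> B_less x x"
  by (auto simp: B_less_def)

lemma sorted_B_list_unique:
  assumes "sorted_wrt B_less xs" "sorted_wrt B_less ys" "set xs = set ys"
  shows "xs = ys"
  using assms
proof (induction xs arbitrary: ys)
  case (Cons x xs)
  then obtain y zs where ys: "ys = y # zs" by (cases ys) auto
  have xy: "x = y"
  proof (rule ccontr)
    assume "x \<noteq> y"
    then have "x \<in> set zs" "y \<in> set xs" using Cons.prems(3) ys by auto
    then have "B_less y x" "B_less x y" using Cons.prems(1,2) ys by auto
    then show False using B_less_trans B_less_irrefl by blast
  qed
  have "x \<notin> set xs" "y \<notin> set zs" using Cons.prems(1,2) ys B_less_irrefl by auto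
  then have "set xs = set zs" using Cons.prems(3) ys xy by auto
  then show ?case using Cons.IH[of zs] Cons.prems(1,2) ys xy by simp
qed simp

lemma block_list:
  assumes "finite B" "0 \<notin> B"
  shows "sorted_wrt B_less (block_list B)" "set (block_list B) = B"
proof -
  let ?N = "sorted_list_of_set {x \<in> B. x < 0}" and ?P = "sorted_list_of_set {x \<in> B. 0 < x}"
  have set: "set ?N = {x \<in> B. x < 0}" "set ?P = {x \<in> B. 0 < x}" using assms(1) by auto
  have "sorted_wrt B_less (rev ?N)" unfolding sorted_wrt_rev
    by (rule sorted_wrt_mono_rel[OF _ strict_sorted_list_of_set]) (use set in \<open>auto simp: B_less_def\<close>)
  moreover have "sorted_wrt B_less ?P"
    by (rule sorted_wrt_mono_rel[OF _ strict_sorted_list_of_set]) (use set in \<open>auto simp: B_less_def\<close>)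
  ultimately have "sorted_wrt B_less (rev ?N @ ?P)"
    using set by (auto simp: sorted_wrt_append B_less_def)
  moreover have "set (rev ?N @ ?P) = B"
  proof -
    have "x < 0 \<or> 0 < x" if "x \<in> B" for x using that assms(2) by (cases "x = 0") auto
    then show ?thesis using set by auto
  qed
  ultimately have xs: "sorted_wrt B_less (rev ?N @ ?P) \<and> set (rev ?N @ ?P) = B" by (rule conjI)
  have "block_list B = rev ?N @ ?P"
    unfolding block_list_def
  proof (rule the_equality)
    show "ys = rev ?N @ ?P" if "sorted_wrt B_less ys \<and> set ys = B" for ys
      using that xs by (intro sorted_B_list_unique) simp_all
  qed (rule xs)
  then show "sorted_wrt B_less (block_list B)" "set (block_list B) = B" using xs by simp_all
qed

lemma cycle_of_list_nth:
  assumes "distinct cs" "i < length cs"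
  shows "cycle_of_list cs (cs ! i) = cs ! (Suc i mod length cs)"
proof -
  have "map (cycle_of_list cs) cs = rotate1 cs" using cyclic_rotation[OF assms(1), of 1] by simp
  then have "map (cycle_of_list cs) cs ! i = rotate1 cs ! i" by simp
  then show ?thesis using assms(2) by (simp add: nth_rotate1)
qed

lemma block_cycle:
  assumes B: "finite B" "0 \<notin> B" and xy: "x \<in> B" "y \<in> B"
  shows "B_less x y \<Longrightarrow> (\<And>z. z \<in> B \<Longrightarrow> B_less x z \<Longrightarrow> z = y \<or> B_less y z) \<Longrightarrow> cycle_of_list (block_list B) x = y"
    and "(\<And>z. z \<in> B \<Longrightarrow> \<not> B_less x z) \<Longrightarrow> (\<And>z. z \<in> B \<Longrightarrow> \<not> B_less z y) \<Longrightarrow> cycle_of_list (block_list B) x = y"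
proof -
  let ?xs = "block_list B"
  note bl = block_list[OF B]
  have less: "B_less (?xs ! i) (?xs ! j)" if "i < j" "j < length ?xs" for i j
    using bl(1) that by (simp add: sorted_wrt_iff_nth_less)
  have dist: "distinct ?xs"
    unfolding distinct_conv_nth
  proof (intro allI impI)
    fix i j assume "i < length ?xs" "j < length ?xs" "i \<noteq> j"
    then show "?xs ! i \<noteq> ?xs ! j" using less[of i j] less[of j i] B_less_irrefl by (metis linorder_neqE_nat)
  qed
  obtain i where i: "i < length ?xs" "?xs ! i = x" using xy(1) bl(2) by (metis in_set_conv_nth)
  obtain j where j: "j < length ?xs" "?xs ! j = y" using xy(2) bl(2) by (metis in_set_conv_nth)
  have cyc: "cycle_of_list ?xs x = ?xs ! (Suc i mod length ?xs)" using cycle_of_list_nth[OF dist i(1)] i(2) by simp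
  have mem: "?xs ! k \<in> B" if "k < length ?xs" for k using that bl(2) by (metis nth_mem)
  show "cycle_of_list ?xs x = y" if lt: "B_less x y" and least: "\<And>z. z \<in> B \<Longrightarrow> B_less x z \<Longrightarrow> z = y \<or> B_less y z"
  proof -
    have ij: "i < j"
    proof (rule ccontr)
      assume "\<not> i < j"
      then have "x = y \<or> B_less y x" using less[of j i] i j by (metis linorder_neqE_nat)
      then show False using lt B_less_trans B_less_irrefl by blast
    qed
    have "j = Suc i"
    proof (rule ccontr)
      assume "j \<noteq> Suc i"
      then have k: "Suc i < j" using ij by simp
      let ?z = "?xs ! Suc i"
      have "B_less x ?z" "B_less ?z y" using less[of i "Suc i"] less[of "Suc i" j] k i j by auto
      moreover have "?z \<in> B" using mem k j by simp
      ultimately show False using least[of ?z] B_less_trans B_less_irrefl by blast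
    qed
    then show ?thesis using cyc j by simp
  qed
  show "cycle_of_list ?xs x = y" if "\<And>z. z \<in> B \<Longrightarrow> \<not> B_less x z" and "\<And>z. z \<in> B \<Longrightarrow> \<not> B_less z y"
  proof -
    have "\<not> Suc i < length ?xs" using that(1)[OF mem[of "Suc i"]] less[of i "Suc i"] i(2) by auto
    then have "Suc i = length ?xs" using i(1) by simp
    moreover have "\<not> 0 < j"
    proof
      assume j0: "0 < j"
      have "B_less (?xs ! 0) y" using less[OF j0 j(1)] unfolding j(2) .
      moreover have "0 < length ?xs" using j0 j(1) by linarith
      then have "?xs ! 0 \<in> B" by (rule mem)
      ultimately show False using that(2) by blast
    qed
    ultimately show ?thesis using cyc j by simp
  qed
qed

text \<open>
  In terms of the equivalence relation of a partition, the image of an element under its permutation is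
  characterized by order properties within the class, which are easier to verify than positions in a list.
\<close>

locale signed_partition =
  fixes n :: nat and E :: "int \<Rightarrow> int \<Rightarrow> bool"
  assumes E_range: "E x y \<Longrightarrow> x \<in> signed_range n \<and> y \<in> signed_range n"
    and E_refl: "x \<in> signed_range n \<Longrightarrow> E x x"
    and E_sym: "E x y \<Longrightarrow> E y x"
    and E_trans: "E x y \<Longrightarrow> E y z \<Longrightarrow> E x z"
    and E_neg: "E x y \<Longrightarrow> E (- x) (- y)"
    and E_nc: "B_less a b \<Longrightarrow> B_less b c \<Longrightarrow> B_less c d \<Longrightarrow> E a c \<Longrightarrow> E b d \<Longrightarrow> E a b"

definition class_perm :: "nat \<Rightarrow> (int \<Rightarrow> int \<Rightarrow> bool) \<Rightarrow> int \<Rightarrow> int" where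
  "class_perm n E x = (if x \<in> signed_range n then cycle_of_list (block_list {y. E x y}) x else x)"

lemma NC_B_class_perm: "NC_B n = {class_perm n E | E. signed_partition n E}"
proof (intro equalityI subsetI)
  fix \<sigma> assume "\<sigma> \<in> NC_B n"
  then have "\<sigma> \<in> perm_of_partition ` {P. type_B_partition n P \<and> noncrossing B_less P}"
    unfolding NC_B_def .
  then obtain P where "\<sigma> = perm_of_partition P" "P \<in> {P. type_B_partition n P \<and> noncrossing B_less P}"
    by (rule imageE)
  then have P: "\<sigma> = perm_of_partition P" "type_B_partition n P" "noncrossing B_less P" by simp_all
  have un: "\<Union>P = signed_range n" and d: "disjoint P" and ng: "\<And>B. B \<in> P \<Longrightarrow> uminus ` B \<in> P"
    using P(2) unfolding type_B_partition_def partition_on_def by simp_all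
  have dis: "B = C" if "B \<in> P" "C \<in> P" "x \<in> B" "x \<in> C" for B C x
    using disjointD[OF d that(1,2)] that(3,4) by blast
  define E where "E = (\<lambda>x y. \<exists>B\<in>P. x \<in> B \<and> y \<in> B)"
  have "signed_partition n E"
  proof
    show "E x y \<Longrightarrow> x \<in> signed_range n \<and> y \<in> signed_range n" for x y using un unfolding E_def by blast
    show "x \<in> signed_range n \<Longrightarrow> E x x" for x using un unfolding E_def by blast
    show "E x y \<Longrightarrow> E y x" for x y unfolding E_def by blast
    show "E x y \<Longrightarrow> E y z \<Longrightarrow> E x z" for x y z using dis unfolding E_def by metis
    show "E x y \<Longrightarrow> E (- x) (- y)" for x y using ng unfolding E_def by blast
    show "E a b" if o: "B_less a b" "B_less b c" "B_less c d" and "E a c" "E b d" for a b c d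
    proof -
      obtain B C where BC: "B \<in> P" "a \<in> B" "c \<in> B" "C \<in> P" "b \<in> C" "d \<in> C"
        using \<open>E a c\<close> \<open>E b d\<close> unfolding E_def by blast
      then have "B = C" using P(3) o unfolding noncrossing_def by blast
      then show ?thesis using BC unfolding E_def by blast
    qed
  qed
  moreover have "\<sigma> = class_perm n E"
  proof
    fix x show "\<sigma> x = class_perm n E x"
    proof (cases "x \<in> signed_range n")
      case True
      then obtain B where B: "B \<in> P" "x \<in> B" using un by blast
      have the_block: "(THE B. B \<in> P \<and> x \<in> B) = B" by (rule the_equality) (use B dis in blast)+
      have cls: "{y. E x y} = B" unfolding E_def using B dis by blast
      show ?thesis
        unfolding P(1) perm_of_partition_def class_perm_def un if_P[OF True] the_block cls ..
    next
      case False
      then show ?thesis unfolding P(1) perm_of_partition_def class_perm_def un by (simp only: if_False)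
    qed
  qed
  ultimately show "\<sigma> \<in> {class_perm n E | E. signed_partition n E}" by blast
next
  fix \<sigma> assume "\<sigma> \<in> {class_perm n E | E. signed_partition n E}"
  then obtain E where E: "\<sigma> = class_perm n E" "signed_partition n E" by blast
  interpret signed_partition n E by fact
  let ?P = "(\<lambda>x. {y. E x y}) ` signed_range n"
  have cls: "{y. E x y} = {y. E z y}" if "E x z" for x z using that E_sym E_trans by blast
  have un: "\<Union>?P = signed_range n" using E_refl E_range by blast
  have blk: "B = {y. E x y}" if "B \<in> ?P" "x \<in> B" for B x using that cls by blast
  have ng: "uminus ` B \<in> ?P" if B: "B \<in> ?P" for B
  proof -
    obtain x where x: "x \<in> signed_range n" "B = {y. E x y}" using B by blast
    have "uminus ` B = {y. E (- x) y}"
    proof (intro equalityI subsetI)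
      fix y assume "y \<in> {y. E (- x) y}"
      then have "E x (- y)" using E_neg[of "- x" y] by simp
      then show "y \<in> uminus ` B" using x by (intro image_eqI[of _ _ "- y"]) auto
    qed (use x E_neg in auto)
    then show ?thesis using x by (auto simp: signed_range_def)
  qed
  have "type_B_partition n ?P"
    unfolding type_B_partition_def partition_on_def disjoint_def
  proof (intro conjI allI ballI impI)
    show "\<Union>?P = signed_range n" by fact
    show "{} \<notin> ?P" using E_refl by blast
    show "A \<inter> B = {}" if "A \<in> ?P" "B \<in> ?P" "A \<noteq> B" for A B using blk[OF that(1)] blk[OF that(2)] that(3) by blast
    show "B \<in> ?P \<longleftrightarrow> uminus ` B \<in> ?P" for B
    proof
      assume "uminus ` B \<in> ?P"
      then have "uminus ` uminus ` B \<in> ?P" by (rule ng)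
      then show "B \<in> ?P" by (simp add: image_comp)
    qed (rule ng)
  qed
  moreover have "noncrossing B_less ?P"
    unfolding noncrossing_def
  proof (rule notI, elim exE conjE bexE)
    fix a b c d B C assume o: "B_less a b" "B_less b c" "B_less c d"
      and BC: "B \<in> ?P" "C \<in> ?P" "B \<noteq> C" "a \<in> B" "c \<in> B" "b \<in> C" "d \<in> C"
    have "E a c" "E b d" using blk BC by blast+
    then have "E a b" using E_nc o by blast
    then show False using blk[OF BC(1,4)] blk[OF BC(2,6)] BC(3) cls by blast
  qed
  moreover have "\<sigma> = perm_of_partition ?P"
  proof
    fix x show "\<sigma> x = perm_of_partition ?P x"
    proof (cases "x \<in> signed_range n")
      case True
      have the_block: "(THE B. B \<in> ?P \<and> x \<in> B) = {y. E x y}"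
        by (rule the_equality) (use True E_refl blk in blast)+
      show ?thesis
        unfolding E(1) perm_of_partition_def class_perm_def un if_P[OF True] the_block ..
    next
      case False
      then show ?thesis unfolding E(1) perm_of_partition_def class_perm_def un by (simp only: if_False)
    qed
  qed
  ultimately show "\<sigma> \<in> NC_B n" unfolding NC_B_def by (intro image_eqI CollectI conjI)
qed

lemma pos_signed_range: "0 < i \<Longrightarrow> i \<in> signed_range n \<longleftrightarrow> i \<in> {1..int n}"
  by (auto simp: signed_range_def)

definition half_rel :: "(int \<Rightarrow> int \<Rightarrow> bool) \<Rightarrow> int \<Rightarrow> int \<Rightarrow> bool" where
  "half_rel E i j \<longleftrightarrow> 0 < i \<and> 0 < j \<and> E i j"

definition half_marks :: "(int \<Rightarrow> int \<Rightarrow> bool) \<Rightarrow> int set" where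
  "half_marks E = {i. 0 < i \<and> (\<exists>z<0. E i z)}"

context signed_partition
begin

sublocale half_partition n "half_rel E" "half_marks E"
proof
  show "half_rel E x y \<Longrightarrow> x \<in> {1..int n} \<and> y \<in> {1..int n}" for x y
    using E_range[of x y] pos_signed_range[of x n] pos_signed_range[of y n] unfolding half_rel_def by blast
  show "x \<in> {1..int n} \<Longrightarrow> half_rel E x x" for x
    using E_refl[of x] pos_signed_range[of x n] unfolding half_rel_def by simp
  show "half_rel E x y \<Longrightarrow> half_rel E y x" for x y using E_sym unfolding half_rel_def by blast
  show "half_rel E x y \<Longrightarrow> half_rel E y z \<Longrightarrow> half_rel E x z" for x y z using E_trans unfolding half_rel_def by blast
  show "half_marks E \<subseteq> {1..int n}" using E_range pos_signed_range unfolding half_marks_def by blast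
  show "x \<in> half_marks E \<Longrightarrow> half_rel E x y \<Longrightarrow> y \<in> half_marks E" for x y
    unfolding half_rel_def half_marks_def using E_trans E_sym by blast
  show "half_rel E a b" if "a < b" "b < c" "c < d" "half_rel E a c" "half_rel E b d" for a b c d
    using that E_nc[of a b c d] unfolding half_rel_def B_less_def by auto
  show "half_rel E x i" if i: "i \<in> half_marks E" "x < i" "i < y" "half_rel E x y" for i x y
  proof -
    obtain z where z: "z < 0" "E i z" "0 < i" using i(1) unfolding half_marks_def by blast
    have xy: "0 < x" "0 < y" "E x y" using i(4) unfolding half_rel_def by auto
    have "E z x" using E_nc[of z x i y] z xy i(2,3) E_sym[OF z(2)] unfolding B_less_def by auto
    then have "E x i" using E_trans[OF z(2)] E_sym by blast
    then show ?thesis using z xy unfolding half_rel_def by blast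
  qed
qed

abbreviation "\<sigma> \<equiv> class_perm n E"

lemma class_finite: "finite {y. E x y}" "0 \<notin> {y. E x y}"
proof -
  have sub: "{y. E x y} \<subseteq> signed_range n" using E_range by blast
  then show "finite {y. E x y}" by (rule finite_subset) (simp add: signed_range_def)
  show "0 \<notin> {y. E x y}" using sub by (auto simp: signed_range_def)
qed

lemma class_perm_next:
  assumes "E x y" "B_less x y" "\<And>z. E x z \<Longrightarrow> B_less x z \<Longrightarrow> z = y \<or> B_less y z"
  shows "\<sigma> x = y"
proof -
  have x: "x \<in> signed_range n" using E_range[OF assms(1)] by blast
  then show ?thesis unfolding class_perm_def
    using block_cycle(1)[OF class_finite, of x x y] assms E_refl[OF x] by simp
qed

lemma class_perm_last:
  assumes "E x y" "\<And>z. E x z \<Longrightarrow> \<not> B_less x z" "\<And>z. E x z \<Longrightarrow> \<not> B_less z y"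
  shows "\<sigma> x = y"
proof -
  have x: "x \<in> signed_range n" using E_range[OF assms(1)] by blast
  then show ?thesis unfolding class_perm_def
    using block_cycle(2)[OF class_finite, of x x y] assms E_refl[OF x] by simp
qed

text \<open>
  The largest element of a marked block. The cycle returns from it to the first element of the block, which is
  negative: in the order at hand, the negative number \<open>- first_neg i\<close> that is closest to 0.
\<close>

definition top :: "int \<Rightarrow> bool" where "top i \<longleftrightarrow> i \<in> half_marks E \<and> \<not> later i"

definition first_neg :: "int \<Rightarrow> int" where
  "first_neg i = Min {m \<in> {1..int n}. E i (- m)}"

lemma first_negE:
  assumes "top i"
  shows "0 < first_neg i" "E i (- first_neg i)" "\<And>m. E i (- m) \<Longrightarrow> 0 < m \<Longrightarrow> first_neg i \<le> m"
proof -
  let ?A = "{m \<in> {1..int n}. E i (- m)}"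
  have mem: "m \<in> ?A" if m: "E i (- m)" "0 < m" for m
  proof -
    have "- m \<in> signed_range n" using E_range[OF m(1)] by blast
    then have "m \<le> int n" by (simp add: signed_range_def)
    then show ?thesis using m by simp
  qed
  obtain z where z: "z < 0" "E i z" using assms unfolding top_def half_marks_def by blast
  have "?A \<noteq> {}" using mem[of "- z"] z by auto
  then have "first_neg i \<in> ?A" unfolding first_neg_def by (rule Min_in[OF finite_sub])
  then show "0 < first_neg i" "E i (- first_neg i)" by simp_all
  show "first_neg i \<le> m" if "E i (- m)" "0 < m" for m
    unfolding first_neg_def using mem[OF that] by (intro Min_le[OF finite_sub])
qed

lemma not_top_cases:
  assumes i: "i \<in> {1..int n}" "\<not> top i"
  shows "\<sigma> i = val i" "\<sigma> (- i) = - val i"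
proof -
  have pos: "0 < i" using i by simp
  have Ei: "E (- i) z \<Longrightarrow> E i (- z)" for z using E_neg[of "- i" z] by simp
  have rel: "half_rel E i z" if "E i z" "0 < z" for z using that pos unfolding half_rel_def by blast
  have nz: "z \<noteq> 0" if "E x z" for x z using E_range[OF that] by (auto simp: signed_range_def)
  have "\<sigma> i = val i \<and> \<sigma> (- i) = - val i"
  proof (cases "later i")
    case True
    note N = nxtE[OF True]
    have en: "E i (nxt i)" using N(2) unfolding half_rel_def by blast
    have "\<sigma> i = nxt i"
    proof (rule class_perm_next[OF en])
      show "B_less i (nxt i)" using N(1) pos by (simp add: B_less_def)
      fix z assume z: "E i z" "B_less i z"
      then have "0 < z" "i < z" using pos by (auto simp: B_less_def)
      then show "z = nxt i \<or> B_less (nxt i) z" using N(3)[OF rel[OF z(1)]] N(1) pos by (auto simp: B_less_def)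
    qed
    moreover have "\<sigma> (- i) = - nxt i"
    proof (rule class_perm_next[OF E_neg[OF en]])
      show "B_less (- i) (- nxt i)" using N(1) pos by (simp add: B_less_def)
      fix z assume z: "E (- i) z" "B_less (- i) z"
      show "z = - nxt i \<or> B_less (- nxt i) z"
      proof (cases "z < 0")
        case True
        then have "nxt i \<le> - z" using N(3)[OF rel[OF Ei[OF z(1)]]] z(2) by (auto simp: B_less_def)
        then show ?thesis using N(1) pos by (auto simp: B_less_def)
      next
        case False
        then show ?thesis using nz[OF z(1)] N(1) pos by (auto simp: B_less_def)
      qed
    qed
    ultimately show ?thesis using True by (simp add: val_def)
  next
    case False
    then have nF: "i \<notin> half_marks E" using i by (simp add: top_def)
    then have allpos: "0 < z" if "E i z" for z using that nz[OF that] pos unfolding half_marks_def by force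
    note M = mnE[OF i(1)]
    have mn: "E i (mn i)" "0 < mn i" using M(1) unfolding half_rel_def by auto
    have le: "z \<le> i" if "E i z" for z
      using False rel[OF that allpos[OF that]] unfolding later_def by force
    have "\<sigma> i = mn i"
    proof (rule class_perm_last[OF mn(1)])
      fix z assume z: "E i z"
      show "\<not> B_less i z" using le[OF z] pos by (auto simp: B_less_def)
      show "\<not> B_less z (mn i)" using M(2)[OF rel[OF z allpos[OF z]]] allpos[OF z] by (auto simp: B_less_def)
    qed
    moreover have "\<sigma> (- i) = - mn i"
    proof (rule class_perm_last[OF E_neg[OF mn(1)]])
      fix z assume "E (- i) z"
      then have z: "E i (- z)" by (rule Ei)
      show "\<not> B_less (- i) z" using le[OF z] allpos[OF z] pos by (auto simp: B_less_def)
      show "\<not> B_less z (- mn i)" using M(2)[OF rel[OF z allpos[OF z]]] allpos[OF z] mn(2) by (auto simp: B_less_def)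
    qed
    ultimately show ?thesis using False nF by (simp add: val_def)
  qed
  then show "\<sigma> i = val i" "\<sigma> (- i) = - val i" by blast+
qed

lemma class_perm_top:
  assumes i: "top i" shows "\<sigma> i = - first_neg i"
proof (rule class_perm_last)
  note f = first_negE[OF i]
  show "E i (- first_neg i)" by (rule f)
  have pos: "0 < i" using i unfolding top_def half_marks_def by blast
  fix z assume z: "E i z"
  show "\<not> B_less i z"
  proof
    assume "B_less i z"
    then have "i < z" "half_rel E i z" using pos z by (auto simp: B_less_def half_rel_def)
    then show False using i unfolding top_def later_def by blast
  qed
  show "\<not> B_less z (- first_neg i)"
    using f(3)[of "- z"] z f(1) by (auto simp: B_less_def)
qed

lemma tops_ordered:
  assumes "top i" "top j" "i < j"
  shows "\<sigma> i < \<sigma> j" "mn i < mn j"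
proof -
  have ij: "0 < i" "0 < j" "i \<in> half_marks E" "j \<in> half_marks E" using assms unfolding top_def half_marks_def by auto
  have r: "i \<in> {1..int n}" "j \<in> {1..int n}" using F_range ij by blast+
  have nE: "\<not> E i j" using assms ij unfolding top_def later_def half_rel_def by blast
  note f = first_negE[OF assms(1)] and g = first_negE[OF assms(2)]
  have "first_neg j < first_neg i"
  proof (rule ccontr)
    assume "\<not> first_neg j < first_neg i"
    then consider "first_neg i = first_neg j" | "first_neg i < first_neg j" by linarith
    then have "E (- first_neg i) (- first_neg j)"
    proof cases
      case 1
      then show ?thesis using E_refl E_range[OF f(2)] by simp
    next
      case 2
      then show ?thesis using E_nc[of "- first_neg i" "- first_neg j" i j] f g E_sym ij assms(3) by (simp add: B_less_def)
    qed
    then show False using nE f(2) g(2) E_sym E_trans by blast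
  qed
  then show "\<sigma> i < \<sigma> j" using class_perm_top assms by simp
  note M = mnE[OF r(1)] and M' = mnE[OF r(2)]
  have nR: "\<not> half_rel E i j" using nE unfolding half_rel_def by blast
  show "mn i < mn j"
  proof (rule ccontr)
    assume "\<not> mn i < mn j"
    then have le: "mn j \<le> mn i" "mn i \<le> i" using M(2) R_refl[OF r(1)] by auto
    have "half_rel E (mn j) i"
    proof (cases "mn j = i")
      case True
      then show ?thesis using R_refl[OF r(1)] by simp
    next
      case False
      then show ?thesis using outer[OF ij(3), of "mn j" j] le assms(3) R_sym[OF M'(1)] by linarith
    qed
    then show False using nR R_trans[OF M'(1)] R_sym by blast
  qed
qed

lemma top_values:
  defines "T \<equiv> {i \<in> {1..int n}. top i}"
  shows "\<sigma> ` T = (\<lambda>i. - mn i) ` T"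
proof (rule card_subset_eq)
  have fin: "finite T" unfolding T_def by (rule finite_sub)
  then show "finite ((\<lambda>i. - mn i) ` T)" by simp
  have "inj_on \<sigma> T" "inj_on (\<lambda>i. - mn i) T"
    using tops_ordered unfolding T_def inj_on_def by (metis (mono_tags, lifting) less_irrefl linorder_neqE mem_Collect_eq neg_equal_iff_equal)+
  then show "card (\<sigma> ` T) = card ((\<lambda>i. - mn i) ` T)" by (simp add: card_image)
  show "\<sigma> ` T \<subseteq> (\<lambda>i. - mn i) ` T"
  proof (rule image_subsetI)
    fix i assume "i \<in> T"
    then have i: "top i" "0 < i" by (auto simp: T_def)
    let ?m = "first_neg i"
    note f = first_negE[OF i(1)]
    have mi: "E ?m (- i)" using E_sym[OF E_neg[OF f(2)]] by simp
    then have mF: "?m \<in> half_marks E" using f(1) i(2) unfolding half_marks_def by force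
    then have mr: "?m \<in> {1..int n}" using F_range by blast
    note X = mxE[OF mr]
    have "mx ?m \<in> T" unfolding T_def top_def using F_closed[OF mF X(1)] not_later_mx[OF mr] R_range[OF X(1)] by simp
    moreover have "\<not> earlier ?m"
    proof
      assume "earlier ?m"
      then obtain k where k: "k < ?m" "half_rel E ?m k" unfolding earlier_def by blast
      then have "E (- i) k" using E_trans[OF E_sym[OF mi]] unfolding half_rel_def by blast
      then have "E i (- k)" using E_neg[of "- i" k] by simp
      then show False using f(3)[of k] k unfolding half_rel_def by simp
    qed
    then have "mn (mx ?m) = ?m" using mn_eqI R_sym[OF X(1)] by blast
    ultimately show "\<sigma> i \<in> (\<lambda>i. - mn i) ` T" using class_perm_top[OF i(1)] by (intro image_eqI[of _ _ "mx ?m"]) auto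
  qed
qed

text \<open>
  Among the tops of the marked blocks, the entries increase, whereas the negated minima
  decrease: reversing the negative entries closes every marked block with its own minimum.
\<close>

lemma rev_neg_class_perm: "rev_neg n \<sigma> = perm"
proof
  fix x
  define L where "L = neg_positions n \<sigma>"
  have neg_iff: "\<sigma> i < 0 \<longleftrightarrow> top i" if i: "i \<in> {1..int n}" for i
  proof (cases "top i")
    case True
    then show ?thesis using class_perm_top first_negE(1) by simp
  next
    case False
    then have "0 < val i" using i nxtE(2)[of i] mnE(1)[OF i] unfolding val_def top_def half_rel_def by auto
    then show ?thesis using not_top_cases[OF i False] False by simp
  qed
  have setL: "set L = {i \<in> {1..int n}. top i}" using neg_iff by (auto simp: L_def neg_positions_def)
  have srt: "sorted_wrt (<) L" unfolding L_def neg_positions_def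
    by (intro sorted_wrt_filter) (simp add: sorted_wrt_upto)
  have "sorted_wrt (<) (map \<sigma> L)" unfolding sorted_wrt_map
    by (rule sorted_wrt_mono_rel[OF _ srt]) (use setL tops_ordered(1) in auto)
  moreover have "sorted_wrt (<) (rev (map (\<lambda>i. - mn i) L))" unfolding sorted_wrt_rev sorted_wrt_map
    by (rule sorted_wrt_mono_rel[OF _ srt]) (use setL tops_ordered(2) in auto)
  moreover have "set (map \<sigma> L) = set (rev (map (\<lambda>i. - mn i) L))" using top_values setL by simp
  ultimately have "map \<sigma> L = rev (map (\<lambda>i. - mn i) L)" by (metis strict_sorted_equal)
  then have "map \<sigma> (rev L) = map (\<lambda>i. - mn i) L" by (metis rev_map rev_rev_ident)
  then have mo: "map_of (zip L (map \<sigma> (rev L))) y = (if y \<in> set L then Some (- mn y) else None)" for y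
    by (simp add: map_of_zip_map)
  show "rev_neg n \<sigma> x = perm x"
  proof (cases "\<bar>x\<bar> \<in> set L")
    case True
    then have x: "\<bar>x\<bar> \<in> {1..int n}" "top \<bar>x\<bar>" using setL by auto
    have v: "val \<bar>x\<bar> = - mn \<bar>x\<bar>" using x by (simp add: val_def top_def)
    have "rev_neg n \<sigma> x = sgn x * val \<bar>x\<bar>" using mo True v unfolding rev_neg_def L_def by simp
    then show ?thesis using x by (cases "0 < x") (auto simp: perm_def)
  next
    case False
    then have e: "rev_neg n \<sigma> x = \<sigma> x" using mo unfolding rev_neg_def L_def by simp
    have "x \<in> {1..int n} \<or> - x \<in> {1..int n} \<or> x \<notin> signed_range n" by (auto simp: signed_range_def)
    then consider "x \<in> {1..int n}" | "- x \<in> {1..int n}" | "x \<notin> signed_range n" by blast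
    then show ?thesis
    proof cases
      case 1
      then show ?thesis using not_top_cases(1)[of x] False setL e by (simp add: perm_def)
    next
      case 2
      then show ?thesis using not_top_cases(2)[of "- x"] False setL e by (simp add: perm_def)
    next
      case 3
      then show ?thesis using e by (auto simp: perm_def class_perm_def signed_range_def)
    qed
  qed
qed

end

text \<open>
  Conversely, let each marked block be joined to the negative of a marked block, in an order-reversing way: the
  first one to the negative of the last one, and so on. Since the negative numbers are ordered by their
  absolute values, this makes the joined blocks nested and hence noncrossing.
\<close>

lemma order_reversing_involution:
  assumes "finite (M :: int set)"
  obtains \<iota> where "\<And>m. m \<in> M \<Longrightarrow> \<iota> m \<in> M" "\<And>m. m \<in> M \<Longrightarrow> \<iota> (\<iota> m) = m"
    "\<And>m m'. m \<in> M \<Longrightarrow> m' \<in> M \<Longrightarrow> m < m' \<Longrightarrow> \<iota> m' < \<iota> m"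
proof -
  let ?xs = "sorted_list_of_set M" and ?k = "card M"
  have xs: "set ?xs = M" "length ?xs = ?k" "distinct ?xs" using assms by auto
  have mono: "?xs ! i < ?xs ! j" if "i < j" "j < ?k" for i j
    using strict_sorted_list_of_set[of M] that xs(2) by (simp add: sorted_wrt_iff_nth_less)
  define idx where "idx = (\<lambda>m. SOME i. i < ?k \<and> ?xs ! i = m)"
  have idx: "idx m < ?k" "?xs ! idx m = m" if "m \<in> M" for m
  proof -
    have "\<exists>i. i < ?k \<and> ?xs ! i = m" using that xs by (metis in_set_conv_nth)
    then show "idx m < ?k" "?xs ! idx m = m" unfolding idx_def by (metis (mono_tags, lifting) someI_ex)+
  qed
  have idx_nth: "idx (?xs ! i) = i" if "i < ?k" for i
  proof -
    have "?xs ! i \<in> M" using xs that by (metis nth_mem)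
    then show ?thesis using idx[of "?xs ! i"] that xs by (simp add: nth_eq_iff_index_eq)
  qed
  let ?\<iota> = "\<lambda>m. ?xs ! (?k - 1 - idx m)"
  show thesis
  proof (rule that[of ?\<iota>])
    show "?\<iota> m \<in> M" if "m \<in> M" for m using idx(1)[OF that] xs nth_mem[of "?k - 1 - idx m" ?xs] by simp
    show "?\<iota> (?\<iota> m) = m" if "m \<in> M" for m
    proof -
      have "idx (?\<iota> m) = ?k - 1 - idx m" using idx(1)[OF that] by (intro idx_nth) simp
      moreover have "?k - 1 - (?k - 1 - idx m) = idx m" using idx(1)[OF that] by simp
      ultimately show ?thesis using idx(2)[OF that] by simp
    qed
    show "?\<iota> m' < ?\<iota> m" if m: "m \<in> M" "m' \<in> M" "m < m'" for m m'
    proof -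
      have "idx m < idx m'"
        using mono[of "idx m'" "idx m"] idx[OF m(1)] idx[OF m(2)] m(3) by (metis linorder_neqE_nat order.asym)
      then show ?thesis using idx(1)[OF m(1)] idx(1)[OF m(2)] by (intro mono) auto
    qed
  qed
qed

text \<open>
  The classes are described by an invariant \<open>c\<close>. It is the minimum of the block on the positive side, and on the
  negative side the minimum of the partner block or, for unmarked blocks, the negated minimum.
\<close>

lemma half_partition_extends:
  assumes "half_partition n R F"
  obtains E where "signed_partition n E" "half_rel E = R" "half_marks E = F"
proof -
  interpret half_partition n R F by fact
  have mn_R: "R x (mn x)" "mn x \<in> {1..int n}" if "x \<in> {1..int n}" for x
    using mnE(1)[OF that] R_range[OF mnE(1)[OF that]] by blast+
  have mn_iff: "mn x = mn y \<longleftrightarrow> R x y" if "x \<in> {1..int n}" "y \<in> {1..int n}" for x y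
  proof
    assume "mn x = mn y"
    then show "R x y" using mn_R(1)[OF that(1)] R_sym[OF mn_R(1)[OF that(2)]] R_trans[of x "mn x" y] by simp
  next
    assume "R x y"
    then show "mn x = mn y"
      using mnE(2)[OF that(1) R_trans[OF _ mn_R(1)[OF that(2)]], of ]
        mnE(2)[OF that(2) R_trans[OF R_sym mn_R(1)[OF that(1)]]] by (meson order.antisym)
  qed
  have mn_F: "mn x \<in> F" if "x \<in> F" for x using F_closed[OF that mn_R(1)] F_range that by blast
  have mn_mn: "mn (mn x) = mn x" if "x \<in> {1..int n}" for x
    using mn_iff[OF mn_R(2)[OF that] that] R_sym[OF mn_R(1)[OF that]] by blast
  have mono: "mn x \<le> mn y" if xy: "x \<in> F" "y \<in> F" "x \<le> y" for x y
  proof (rule ccontr)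
    assume lt: "\<not> mn x \<le> mn y"
    have r: "x \<in> {1..int n}" "y \<in> {1..int n}" using xy F_range by blast+
    have "mn x \<le> x" using mnE(2)[OF r(1) R_refl[OF r(1)]] .
    then have "R (mn y) x \<or> x = y" using outer[OF xy(1), of "mn y" y] lt xy(3) R_sym[OF mn_R(1)[OF r(2)]] by force
    then have "mn x = mn y"
      using mn_iff[OF mn_R(2)[OF r(2)] r(1)] mn_mn[OF r(2)] by auto
    then show False using lt by simp
  qed
  obtain \<iota> where \<iota>: "\<And>m. m \<in> mn ` F \<Longrightarrow> \<iota> m \<in> mn ` F" "\<And>m. m \<in> mn ` F \<Longrightarrow> \<iota> (\<iota> m) = m"
    "\<And>m m'. m \<in> mn ` F \<Longrightarrow> m' \<in> mn ` F \<Longrightarrow> m < m' \<Longrightarrow> \<iota> m' < \<iota> m"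
    using order_reversing_involution[of "mn ` F"] finite_subset[OF F_range] by (metis finite_atLeastAtMost_int finite_imageI)
  define c where "c = (\<lambda>x. if 0 < x then mn x else if - x \<in> F then \<iota> (mn (- x)) else - mn (- x))"
  define E where "E = (\<lambda>x y. x \<in> signed_range n \<and> y \<in> signed_range n \<and> c x = c y)"
  have range: "x \<in> signed_range n \<longleftrightarrow> (if 0 < x then x \<in> {1..int n} else - x \<in> {1..int n})" for x
    by (auto simp: signed_range_def)
  have \<iota>F: "\<iota> (mn x) \<in> F" "0 < \<iota> (mn x)" "mn (\<iota> (mn x)) = \<iota> (mn x)" if "x \<in> F" for x
  proof -
    obtain f where f: "f \<in> F" "\<iota> (mn x) = mn f" using \<iota>(1)[of "mn x"] \<open>x \<in> F\<close> by blast
    have fr: "f \<in> {1..int n}" using f F_range by blast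
    show "\<iota> (mn x) \<in> F" "0 < \<iota> (mn x)" "mn (\<iota> (mn x)) = \<iota> (mn x)"
      using mn_F[OF f(1)] mn_R(2)[OF fr] mn_mn[OF fr] f(2) by auto
  qed
  have F_iff: "x \<in> F \<longleftrightarrow> y \<in> F" if "R x y" for x y using F_closed that R_sym by blast
  have pp: "E x y \<longleftrightarrow> R x y" if "0 < x" "0 < y" for x y
    using that mn_iff[of x y] R_range[of x y] unfolding E_def range c_def by auto
  have nn: "E (- x) (- y) \<longleftrightarrow> R x y" if "0 < x" "0 < y" for x y
  proof -
    have "c (- x) = c (- y) \<longleftrightarrow> mn x = mn y" if r: "x \<in> {1..int n}" "y \<in> {1..int n}"
    proof (cases "x \<in> F"; cases "y \<in> F")
      assume F: "x \<in> F" "y \<in> F"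
      then have "\<iota> (mn x) = \<iota> (mn y) \<longleftrightarrow> mn x = mn y" using \<iota>(2)[of "mn x"] \<iota>(2)[of "mn y"] by (metis imageI)
      then show ?thesis using F \<open>0 < x\<close> \<open>0 < y\<close> unfolding c_def by simp
    next
      assume F: "x \<in> F" "y \<notin> F"
      then show ?thesis using mn_iff[OF r] F_iff[of x y] \<iota>F(2)[OF F(1)] mn_R(2)[OF r(2)] \<open>0 < x\<close> \<open>0 < y\<close> unfolding c_def by auto
    next
      assume F: "x \<notin> F" "y \<in> F"
      then show ?thesis using mn_iff[OF r] F_iff[of x y] \<iota>F(2)[OF F(2)] mn_R(2)[OF r(1)] \<open>0 < x\<close> \<open>0 < y\<close> unfolding c_def by auto
    next
      assume F: "x \<notin> F" "y \<notin> F"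
      then show ?thesis using \<open>0 < x\<close> \<open>0 < y\<close> unfolding c_def by auto
    qed
    then show ?thesis using that mn_iff[of x y] R_range[of x y] unfolding E_def range by auto
  qed
  have pn: "E x (- y) \<longleftrightarrow> x \<in> F \<and> y \<in> F \<and> mn x = \<iota> (mn y)" if "0 < x" "0 < y" for x y
  proof
    assume e: "E x (- y)"
    then have r: "x \<in> {1..int n}" "y \<in> {1..int n}" and eq: "c x = c (- y)" using that unfolding E_def range by auto
    have yF: "y \<in> F"
    proof (rule ccontr)
      assume "y \<notin> F"
      then have "mn x = - mn y" using eq that by (simp add: c_def)
      then show False using mn_R(2)[OF r(1)] mn_R(2)[OF r(2)] by simp
    qed
    then have m: "mn x = \<iota> (mn y)" using eq that by (simp add: c_def)
    then have "x \<in> F" using \<iota>F(1)[OF yF] F_iff[OF mn_R(1)[OF r(1)]] by simp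
    then show "x \<in> F \<and> y \<in> F \<and> mn x = \<iota> (mn y)" using yF m by blast
  next
    assume "x \<in> F \<and> y \<in> F \<and> mn x = \<iota> (mn y)"
    then show "E x (- y)" using that F_range unfolding E_def range c_def by auto
  qed
  have sym: "E x y \<Longrightarrow> E y x" for x y unfolding E_def by simp
  have sgn: "0 < x \<or> 0 < - x" if "x \<in> signed_range n" for x using that by (auto simp: signed_range_def)
  have np: "E (- x) y \<Longrightarrow> E x (- y)" if "0 < x" "0 < y" for x y
    using that pn[of y x] pn[of x y] \<iota>(2) sym by (metis imageI)
  have "signed_partition n E"
  proof
    show "E x y \<Longrightarrow> x \<in> signed_range n \<and> y \<in> signed_range n" for x y unfolding E_def by blast
    show "x \<in> signed_range n \<Longrightarrow> E x x" for x unfolding E_def by simp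
    show "E x y \<Longrightarrow> E y x" for x y by (rule sym)
    show "E x y \<Longrightarrow> E y z \<Longrightarrow> E x z" for x y z unfolding E_def by simp
    show "E (- x) (- y)" if e: "E x y" for x y
    proof -
      have "0 < x \<or> 0 < - x" "0 < y \<or> 0 < - y" using e sgn unfolding E_def by blast+
      then consider "0 < x" "0 < y" | "0 < x" "0 < - y" | "0 < - x" "0 < y" | "0 < - x" "0 < - y" by blast
      then show ?thesis
      proof cases
        case 1
        then show ?thesis using e pp nn by blast
      next
        case 2
        then show ?thesis using np[of "- y" x] sym[OF e] sym[of "- y" "- x"] by simp
      next
        case 3
        then show ?thesis using np[of "- x" y] e by simp
      next
        case 4
        then show ?thesis using e pp[of "- x" "- y"] nn[of "- x" "- y"] by simp
      qed
    qed
    show "E a b" if o: "B_less a b" "B_less b c" "B_less c d" and e: "E a c" "E b d" for a b c d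
    proof -
      have "0 < a \<and> a < b \<and> b < c \<and> c < d \<or> a < 0 \<and> 0 < b \<and> b < c \<and> c < d
          \<or> a < 0 \<and> b < a \<and> 0 < c \<and> c < d \<or> a < 0 \<and> b < a \<and> c < b \<and> 0 < d
          \<or> a < 0 \<and> b < a \<and> c < b \<and> d < c"
        using o unfolding B_less_def by (smt (verit))
      then consider "0 < a" "a < b" "b < c" "c < d"
        | "a < 0" "0 < b" "b < c" "c < d"
        | "a < 0" "b < a" "0 < c" "c < d"
        | "a < 0" "b < a" "c < b" "0 < d"
        | "a < 0" "b < a" "c < b" "d < c"
        by blast
      then show ?thesis
      proof cases
        case 1
        then show ?thesis using nc[of a b c d] e pp by auto
      next
        case 2
        have F: "c \<in> F" using pn[of c "- a"] sym[OF e(1)] 2 by simp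
        have "R b c" using outer[OF F, of b d] pp[of b d] e(2) 2 by simp
        then have "E b c" using pp[of b c] 2 by simp
        then show ?thesis using e(1) unfolding E_def by simp
      next
        case 3
        have A: "c \<in> F" "- a \<in> F" "mn c = \<iota> (mn (- a))" using pn[of c "- a"] sym[OF e(1)] 3 by auto
        have B: "d \<in> F" "- b \<in> F" "mn d = \<iota> (mn (- b))" using pn[of d "- b"] sym[OF e(2)] 3 by auto
        have "mn c \<le> mn d" "mn (- a) \<le> mn (- b)" using mono[OF A(1) B(1)] mono[OF A(2) B(2)] 3 by simp_all
        moreover have "\<not> mn (- a) < mn (- b)" using \<iota>(3)[of "mn (- a)" "mn (- b)"] A B \<open>mn c \<le> mn d\<close> by auto
        ultimately have "mn (- a) = mn (- b)" by simp
        then have "R (- a) (- b)" using mn_iff[of "- a" "- b"] A(2) B(2) F_range by blast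
        then show ?thesis using nn[of "- a" "- b"] 3 by simp
      next
        case 4
        have F: "- b \<in> F" using pn[of d "- b"] sym[OF e(2)] 4 by simp
        have "R (- a) (- c)" using nn[of "- a" "- c"] e(1) 4 by simp
        then have "R (- a) (- b)" using outer[OF F, of "- a" "- c"] 4 by simp
        then show ?thesis using nn[of "- a" "- b"] 4 by simp
      next
        case 5
        have "R (- a) (- c)" "R (- b) (- d)" using nn[of "- a" "- c"] nn[of "- b" "- d"] e 5 by auto
        then have "R (- a) (- b)" using nc[of "- a" "- b" "- c" "- d"] 5 by simp
        then show ?thesis using nn[of "- a" "- b"] 5 by simp
      qed
    qed
  qed
  moreover have "half_rel E = R"
  proof (intro ext)
    fix x y show "half_rel E x y = R x y" using pp[of x y] R_range[of x y] unfolding half_rel_def by auto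
  qed
  moreover have "half_marks E = F"
  proof (intro equalityI subsetI)
    fix i assume "i \<in> half_marks E"
    then obtain z where "0 < i" "z < 0" "E i z" unfolding half_marks_def by blast
    then show "i \<in> F" using pn[of i "- z"] by simp
  next
    fix i assume i: "i \<in> F"
    then have "0 < i" using F_range by auto
    moreover have "E i (- \<iota> (mn i))" using pn[of i "\<iota> (mn i)"] \<iota>F[OF i] \<open>0 < i\<close> i \<iota>(2)[of "mn i"] by simp
    ultimately show "i \<in> half_marks E" using \<iota>F(2)[OF i] unfolding half_marks_def
      by (intro CollectI conjI exI[of _ "- \<iota> (mn i)"]) auto
  qed
  ultimately show thesis by (rule that)
qed

lemma rev_NC_B: "rev_neg n ` NC_B n = half_perms n"
proof (intro equalityI subsetI)
  fix \<tau> assume "\<tau> \<in> rev_neg n ` NC_B n"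
  then obtain E where E: "signed_partition n E" "\<tau> = rev_neg n (class_perm n E)"
    unfolding NC_B_class_perm by blast
  interpret signed_partition n E by fact
  show "\<tau> \<in> half_perms n" unfolding E(2) rev_neg_class_perm half_perms_def
    using half_partition_axioms by blast
next
  fix \<tau> assume "\<tau> \<in> half_perms n"
  then obtain R F where R: "half_partition n R F" "\<tau> = half_partition.perm n R F" unfolding half_perms_def by blast
  obtain E where E: "signed_partition n E" "half_rel E = R" "half_marks E = F"
    using half_partition_extends[OF R(1)] .
  have "\<tau> = rev_neg n (class_perm n E)"
    using signed_partition.rev_neg_class_perm[OF E(1)] unfolding E(2,3) R(2) ..
  then show "\<tau> \<in> rev_neg n ` NC_B n" unfolding NC_B_class_perm using E(1) by blast
qed


section \<open>Counting words\<close>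

text \<open>
  The contribution of the gap between two neighbouring letters to the number of descents of the
  permutation and of its inverse.
\<close>

definition gap_descents :: "letter \<Rightarrow> letter \<Rightarrow> nat" where
  "gap_descents x y =
     of_bool ((fst x \<and> \<not> (fst y \<and> snd y)) \<or> (\<not> fst x \<and> \<not> fst y \<and> snd y))
     + of_bool ((fst x \<and> \<not> snd x) \<or> (\<not> fst x \<and> snd y))"

fun word_weight :: "letter list \<Rightarrow> nat" where
  "word_weight (y # x # w) = word_weight (x # w) + length (x # w) * gap_descents x y"
| "word_weight w = 0"

text \<open>
  The letter \<open>y\<close> comes after the word. Summing over words followed by a fixed letter, instead of words that end in
  a fixed letter, is what makes the closed forms below differences of only two Gaussian binomial
  coefficients.
\<close>

definition word_sum :: "real \<Rightarrow> nat \<Rightarrow> letter \<Rightarrow> nat \<Rightarrow> nat \<Rightarrow> real" where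
  "word_sum q h y n k = (\<Sum>w\<in>words h n k. q ^ word_weight (y # w))"

lemma finite_words [simp, intro]: "finite (words h n k)"
proof (rule finite_subset)
  show "words h n k \<subseteq> {w. set w \<subseteq> UNIV \<and> length w = n}" by (auto simp: words_def)
qed (rule finite_lists_length_eq[OF finite_class.finite_UNIV])

lemma words_0: "words h 0 k = (if k = h then {[]} else {})"
  by (auto simp: words_def)

lemma words_Suc:
  "words h (Suc n) k =
     (if k = 0 then {} else Cons (True, False) ` words h n (k - 1))
     \<union> Cons (False, False) ` words h n k
     \<union> (if k = 0 then {} else Cons (True, True) ` words h n k)
     \<union> Cons (False, True) ` words h n (Suc k)"
proof (intro equalityI subsetI)
  fix v assume "v \<in> words h (Suc n) k"
  then obtain x w where v: "v = x # w" "length w = n" "admissible h w"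
    "snd x \<longrightarrow> 1 \<le> word_height h w" "word_height h w + of_bool (fst x) - of_bool (snd x) = k"
    by (cases v) (auto simp: words_def)
  obtain a b where x: "x = (a, b)" by (cases x)
  show "v \<in> (if k = 0 then {} else Cons (True, False) ` words h n (k - 1))
     \<union> Cons (False, False) ` words h n k
     \<union> (if k = 0 then {} else Cons (True, True) ` words h n k)
     \<union> Cons (False, True) ` words h n (Suc k)"
    using v x by (cases a; cases b) (auto simp: words_def)
next
  fix v assume "v \<in> (if k = 0 then {} else Cons (True, False) ` words h n (k - 1))
     \<union> Cons (False, False) ` words h n k
     \<union> (if k = 0 then {} else Cons (True, True) ` words h n k)
     \<union> Cons (False, True) ` words h n (Suc k)"
  then show "v \<in> words h (Suc n) k" by (auto simp: words_def split: if_splits)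
qed

lemma sum_Cons_words:
  "(\<Sum>v\<in>Cons x ` words h n k. q ^ word_weight (y # v)) = q ^ (Suc n * gap_descents x y) * word_sum q h x n k"
proof -
  have "(\<Sum>v\<in>Cons x ` words h n k. q ^ word_weight (y # v)) = (\<Sum>w\<in>words h n k. q ^ word_weight (y # x # w))"
    by (subst sum.reindex) (auto simp: inj_on_def)
  also have "\<dots> = (\<Sum>w\<in>words h n k. q ^ (Suc n * gap_descents x y) * q ^ word_weight (x # w))"
    by (rule sum.cong) (auto simp: words_def power_add)
  finally show ?thesis by (simp add: word_sum_def sum_distrib_left)
qed

lemma word_sum_Suc:
  "word_sum q h y (Suc n) k =
     (if k = 0 then 0 else q ^ (Suc n * gap_descents (True, False) y) * word_sum q h (True, False) n (k - 1))
     + q ^ (Suc n * gap_descents (False, False) y) * word_sum q h (False, False) n k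
     + (if k = 0 then 0 else q ^ (Suc n * gap_descents (True, True) y) * word_sum q h (True, True) n k)
     + q ^ (Suc n * gap_descents (False, True) y) * word_sum q h (False, True) n (Suc k)"
proof -
  let ?f = "\<lambda>v. q ^ word_weight (y # v)"
  let ?A = "if k = 0 then {} else Cons (True, False) ` words h n (k - 1)"
    and ?B = "Cons (False, False) ` words h n k"
    and ?C = "if k = 0 then {} else Cons (True, True) ` words h n k"
    and ?D = "Cons (False, True) ` words h n (Suc k)"
  have fin: "finite ?A" "finite ?B" "finite ?C" "finite ?D" by auto
  have "word_sum q h y (Suc n) k = sum ?f (?A \<union> ?B \<union> ?C \<union> ?D)"
    unfolding word_sum_def words_Suc ..
  also have "\<dots> = sum ?f ?A + sum ?f ?B + sum ?f ?C + sum ?f ?D"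
    using fin by (subst sum.union_disjoint, auto)+
  also have "sum ?f ?A = (if k = 0 then 0 else q ^ (Suc n * gap_descents (True, False) y) * word_sum q h (True, False) n (k - 1))"
    by (simp add: sum_Cons_words del: word_weight.simps mult_Suc)
  also have "sum ?f ?C = (if k = 0 then 0 else q ^ (Suc n * gap_descents (True, True) y) * word_sum q h (True, True) n k)"
    by (simp add: sum_Cons_words del: word_weight.simps mult_Suc)
  finally show ?thesis unfolding sum_Cons_words .
qed

text \<open>
  This identity and the next one reduce the four families of sums, one for each letter that comes next, to two.
\<close>

lemma word_weight_close:
  "word_weight ((False, True) # w) = word_weight ((True, True) # w) + length w"
proof (cases w)
  case (Cons x v)
  obtain a b where "x = (a, b)" by (cases x)
  then show ?thesis using Cons by (cases a; cases b) (simp_all add: gap_descents_def)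
qed simp

lemma word_weight_open: "word_weight ((True, False) # w) = word_weight ((False, False) # w)"
proof (cases w)
  case (Cons x v)
  obtain a b where "x = (a, b)" by (cases x)
  then show ?thesis using Cons by (cases a; cases b) (simp_all add: gap_descents_def)
qed simp

lemma word_sum_open: "word_sum q h (True, False) n k = word_sum q h (False, False) n k"
  unfolding word_sum_def word_weight_open ..

lemma word_sum_close: "word_sum q h (False, True) n k = q ^ n * word_sum q h (True, True) n k"
  unfolding word_sum_def word_weight_close sum_distrib_left
  by (rule sum.cong) (auto simp: words_def power_add)

lemma word_sum_recursion:
  fixes q :: real and h :: nat
  defines "S \<equiv> word_sum q h (False, False)" and "T \<equiv> word_sum q h (True, True)"
  shows "S (Suc n) k = (if k = 0 then 0 else q ^ (2 * Suc n) * S n (k - 1) + q ^ Suc n * T n k) + S n k + q ^ n * T n (Suc k)"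
    and "T (Suc n) k = (if k = 0 then 0 else q ^ Suc n * S n (k - 1) + T n k) + q ^ Suc n * S n k + q ^ (2 * n + 1) * T n (Suc k)"
proof -
  have g: "gap_descents (True, False) (False, False) = 2" "gap_descents (False, False) (False, False) = 0"
    "gap_descents (True, True) (False, False) = 1" "gap_descents (False, True) (False, False) = 0"
    "gap_descents (True, False) (True, True) = 1" "gap_descents (False, False) (True, True) = 1"
    "gap_descents (True, True) (True, True) = 0" "gap_descents (False, True) (True, True) = 1"
    by (simp_all add: gap_descents_def)
  show "S (Suc n) k = (if k = 0 then 0 else q ^ (2 * Suc n) * S n (k - 1) + q ^ Suc n * T n k) + S n k + q ^ n * T n (Suc k)"
    unfolding S_def T_def word_sum_Suc[of q h _ n k] g word_sum_open word_sum_close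
    by (simp add: mult.commute)
  have e: "q ^ (Suc n * 1) * (q ^ n * t) = q ^ (2 * n + 1) * t" for t by (simp add: power_add mult_2)
  show "T (Suc n) k = (if k = 0 then 0 else q ^ Suc n * S n (k - 1) + T n k) + q ^ Suc n * S n k + q ^ (2 * n + 1) * T n (Suc k)"
    unfolding S_def T_def word_sum_Suc[of q h _ n k] g word_sum_open word_sum_close e by simp
qed

text \<open>
  As for the height profiles, the solution is a Gaussian binomial coefficient minus its mirror image. The
  recursions, read for all integers \<open>k\<close>, are expansions of the coefficients of row \<open>2 * n + 2\<close> in terms of row
  \<open>2 * n\<close>.
\<close>

lemma word_sum_closed_form:
  fixes q :: real and h n k :: nat
  assumes q: "q > 0"
  defines "g \<equiv> \<lambda>n. gbin q (2 * n)"
  shows "word_sum q h (False, False) n k =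
      q powi ((int k - int h) ^ 2 + (int k - int h)) * g n (int n + (int k - int h))
      - q powi ((int k + int h) ^ 2 + 3 * int k + int h + 1) * g n (int n + (int k + int h + 1))"
  and "word_sum q h (True, True) n k =
      q powi ((int k - int h) ^ 2) * g n (int n + (int k - int h))
      - q powi ((int k + int h) ^ 2 + 2 * int k) * g n (int n + (int k + int h + 1))"
proof -
  let ?S = "word_sum q h (False, False)" and ?T = "word_sum q h (True, True)"
  let ?s = "\<lambda>n k. q powi ((k - int h) ^ 2 + (k - int h)) * g n (int n + (k - int h))
      - q powi ((k + int h) ^ 2 + 3 * k + int h + 1) * g n (int n + (k + int h + 1))"
  let ?t = "\<lambda>n k. q powi ((k - int h) ^ 2) * g n (int n + (k - int h))
      - q powi ((k + int h) ^ 2 + 2 * k) * g n (int n + (k + int h + 1))"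
  have pw: "q powi (a + b) = q powi a * q powi b" for a b using q by (simp add: power_int_add)
  have gS: "g (Suc n) (m + 1) = q powi (2 * (2 * int n + 1 - m)) * g n (m - 1)
      + (1 + q powi (2 * int n + 1 - m)) * g n m + q powi (m + 1) * g n (m + 1)" for n m
  proof -
    have "int (Suc (2 * n)) + 1 - (m + 1) = 2 * int n + 1 - m" "m + 1 - 1 = m" "2 * Suc n = Suc (Suc (2 * n))" by simp_all
    then have "g (Suc n) (m + 1) = q powi (2 * int n + 1 - m) * gbin q (Suc (2 * n)) m + gbin q (Suc (2 * n)) (m + 1)"
      using gbin_Suc'[OF q, of "Suc (2 * n)" "m + 1"] unfolding g_def by metis
    also have "gbin q (Suc (2 * n)) m = q powi (2 * int n + 1 - m) * g n (m - 1) + g n m"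
      using gbin_Suc'[OF q, of "2 * n" m] by (simp add: g_def del: gbin.simps)
    also have "gbin q (Suc (2 * n)) (m + 1) = g n m + q powi (m + 1) * g n (m + 1)"
      unfolding gbin.simps(2) g_def by simp
    also have "q powi (2 * (2 * int n + 1 - m)) = q powi (2 * int n + 1 - m) * q powi (2 * int n + 1 - m)"
      unfolding mult_2 pw ..
    ultimately show ?thesis by (simp add: algebra_simps del: gbin.simps)
  qed
  have gT: "g (Suc n) (m + 1) = q powi (2 * int n + 1 - m) * g n (m - 1)
      + (1 + q powi (m + 1)) * g n m + q powi (2 * (m + 1)) * g n (m + 1)" for n m
  proof -
    have "g (Suc n) (m + 1) = gbin q (Suc (2 * n)) m + q powi (m + 1) * gbin q (Suc (2 * n)) (m + 1)"
      using gbin.simps(2)[of q "Suc (2 * n)" "m + 1"] by (simp add: g_def del: gbin.simps)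
    also have "gbin q (Suc (2 * n)) m = q powi (2 * int n + 1 - m) * g n (m - 1) + g n m"
      using gbin_Suc'[OF q, of "2 * n" m] by (simp add: g_def del: gbin.simps)
    also have "gbin q (Suc (2 * n)) (m + 1) = g n m + q powi (m + 1) * g n (m + 1)"
      unfolding gbin.simps(2) g_def by simp
    also have "q powi (2 * (m + 1)) = q powi (m + 1) * q powi (m + 1)"
      unfolding mult_2 pw ..
    ultimately show ?thesis by (simp add: algebra_simps del: gbin.simps)
  qed
  have gSE: "q powi E * g (Suc n) (m + 1) = q powi (E + 2 * (2 * int n + 1 - m)) * g n (m - 1)
      + q powi (E + (2 * int n + 1 - m)) * g n m + q powi E * g n m + q powi (E + (m + 1)) * g n (m + 1)" for E n m
  proof -
    have "x * (a * g1 + (1 + b) * g2 + c * g3) = (x * a) * g1 + (x * b) * g2 + x * g2 + (x * c) * g3"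
      for x a b c g1 g2 g3 :: real by (simp add: algebra_simps)
    then show ?thesis unfolding gS pw[of E] by blast
  qed
  have gTE: "q powi E * g (Suc n) (m + 1) = q powi (E + (2 * int n + 1 - m)) * g n (m - 1)
      + q powi E * g n m + q powi (E + (m + 1)) * g n m + q powi (E + 2 * (m + 1)) * g n (m + 1)" for E n m
  proof -
    have "x * (a * g1 + (1 + b) * g2 + c * g3) = (x * a) * g1 + x * g2 + (x * b) * g2 + (x * c) * g3"
      for x a b c g1 g2 g3 :: real by (simp add: algebra_simps)
    then show ?thesis unfolding gT pw[of E] by blast
  qed
  have powi: "q ^ j = q powi int j" for j by simp
  have stepS: "?s (Suc n) k = q powi (2 * int n + 2) * ?s n (k - 1) + q powi (int n + 1) * ?t n k + ?s n k
      + q powi int n * ?t n (k + 1)" for n k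
  proof -
    define A where "A = (\<lambda>e m. q powi e * g n m)"
    have mul: "q powi c * (q powi e * x) = q powi (c + e) * x" for c e x by (simp add: pw)
    have f1: "q powi ((k - int h)\<^sup>2 + (k - int h)) * g (Suc n) (int (Suc n) + (k - int h)) =
        q powi (2 * int n + 2) * (q powi ((k - 1 - int h)\<^sup>2 + (k - 1 - int h)) * g n (int n + (k - 1 - int h)))
        + q powi (int n + 1) * (q powi ((k - int h)\<^sup>2) * g n (int n + (k - int h)))
        + q powi ((k - int h)\<^sup>2 + (k - int h)) * g n (int n + (k - int h))
        + q powi int n * (q powi ((k + 1 - int h)\<^sup>2) * g n (int n + (k + 1 - int h)))"
    proof -
      define m where "m = int n + (k - int h)"
      define E where "E = (k - int h)\<^sup>2 + (k - int h)"
      have i: "int (Suc n) + (k - int h) = m + 1" "int n + (k - 1 - int h) = m - 1"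
        "int n + (k + 1 - int h) = m + 1" by (simp_all add: m_def)
      have e: "2 * int n + 2 + ((k - 1 - int h)\<^sup>2 + (k - 1 - int h)) = E + 2 * (2 * int n + 1 - m)"
        "int n + 1 + (k - int h)\<^sup>2 = E + (2 * int n + 1 - m)"
        "int n + (k + 1 - int h)\<^sup>2 = E + (m + 1)"
        by (simp_all add: power2_eq_square algebra_simps m_def E_def)
      show ?thesis unfolding mul e i m_def[symmetric] E_def[symmetric] by (rule gSE)
    qed
    have f2: "q powi ((k + int h)\<^sup>2 + 3 * k + int h + 1) * g (Suc n) (int (Suc n) + (k + int h + 1)) =
        q powi (2 * int n + 2) * (q powi ((k - 1 + int h)\<^sup>2 + 3 * (k - 1) + int h + 1) * g n (int n + (k - 1 + int h + 1)))
        + q powi (int n + 1) * (q powi ((k + int h)\<^sup>2 + 2 * k) * g n (int n + (k + int h + 1)))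
        + q powi ((k + int h)\<^sup>2 + 3 * k + int h + 1) * g n (int n + (k + int h + 1))
        + q powi int n * (q powi ((k + 1 + int h)\<^sup>2 + 2 * (k + 1)) * g n (int n + (k + 1 + int h + 1)))"
    proof -
      define m where "m = int n + (k + int h + 1)"
      define E where "E = (k + int h)\<^sup>2 + 3 * k + int h + 1"
      have i: "int (Suc n) + (k + int h + 1) = m + 1" "int n + (k - 1 + int h + 1) = m - 1"
        "int n + (k + 1 + int h + 1) = m + 1" by (simp_all add: m_def)
      have e: "2 * int n + 2 + ((k - 1 + int h)\<^sup>2 + 3 * (k - 1) + int h + 1) = E + 2 * (2 * int n + 1 - m)"
        "int n + 1 + ((k + int h)\<^sup>2 + 2 * k) = E + (2 * int n + 1 - m)"
        "int n + ((k + 1 + int h)\<^sup>2 + 2 * (k + 1)) = E + (m + 1)"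
        by (simp_all add: power2_eq_square algebra_simps m_def E_def)
      show ?thesis unfolding mul e i m_def[symmetric] E_def[symmetric] by (rule gSE)
    qed
    show ?thesis unfolding f1 f2 right_diff_distrib by linarith
  qed
  have stepT: "?t (Suc n) k = q powi (int n + 1) * ?s n (k - 1) + ?t n k + q powi (int n + 1) * ?s n k
      + q powi (2 * int n + 1) * ?t n (k + 1)" for n k
  proof -
    have mul: "q powi c * (q powi e * x) = q powi (c + e) * x" for c e x by (simp add: pw)
    have f1: "q powi ((k - int h)\<^sup>2) * g (Suc n) (int (Suc n) + (k - int h)) =
        q powi (int n + 1) * (q powi ((k - 1 - int h)\<^sup>2 + (k - 1 - int h)) * g n (int n + (k - 1 - int h)))
        + q powi ((k - int h)\<^sup>2) * g n (int n + (k - int h))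
        + q powi (int n + 1) * (q powi ((k - int h)\<^sup>2 + (k - int h)) * g n (int n + (k - int h)))
        + q powi (2 * int n + 1) * (q powi ((k + 1 - int h)\<^sup>2) * g n (int n + (k + 1 - int h)))"
    proof -
      define m where "m = int n + (k - int h)"
      define E where "E = (k - int h)\<^sup>2"
      have i: "int (Suc n) + (k - int h) = m + 1" "int n + (k - 1 - int h) = m - 1"
        "int n + (k + 1 - int h) = m + 1" by (simp_all add: m_def)
      have e: "int n + 1 + ((k - 1 - int h)\<^sup>2 + (k - 1 - int h)) = E + (2 * int n + 1 - m)"
        "int n + 1 + (E + (k - int h)) = E + (m + 1)"
        "2 * int n + 1 + (k + 1 - int h)\<^sup>2 = E + 2 * (m + 1)"
        by (simp_all add: power2_eq_square algebra_simps m_def E_def)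
      show ?thesis unfolding E_def[symmetric] mul e i m_def[symmetric] by (rule gTE)
    qed
    have f2: "q powi ((k + int h)\<^sup>2 + 2 * k) * g (Suc n) (int (Suc n) + (k + int h + 1)) =
        q powi (int n + 1) * (q powi ((k - 1 + int h)\<^sup>2 + 3 * (k - 1) + int h + 1) * g n (int n + (k - 1 + int h + 1)))
        + q powi ((k + int h)\<^sup>2 + 2 * k) * g n (int n + (k + int h + 1))
        + q powi (int n + 1) * (q powi ((k + int h)\<^sup>2 + 3 * k + int h + 1) * g n (int n + (k + int h + 1)))
        + q powi (2 * int n + 1) * (q powi ((k + 1 + int h)\<^sup>2 + 2 * (k + 1)) * g n (int n + (k + 1 + int h + 1)))"
    proof -
      define m where "m = int n + (k + int h + 1)"
      define E where "E = (k + int h)\<^sup>2 + 2 * k"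
      have i: "int (Suc n) + (k + int h + 1) = m + 1" "int n + (k - 1 + int h + 1) = m - 1"
        "int n + (k + 1 + int h + 1) = m + 1" by (simp_all add: m_def)
      have e: "int n + 1 + ((k - 1 + int h)\<^sup>2 + 3 * (k - 1) + int h + 1) = E + (2 * int n + 1 - m)"
        "int n + 1 + ((k + int h)\<^sup>2 + 3 * k + int h + 1) = E + (m + 1)"
        "2 * int n + 1 + ((k + 1 + int h)\<^sup>2 + 2 * (k + 1)) = E + 2 * (m + 1)"
        by (simp_all add: power2_eq_square algebra_simps m_def E_def)
      show ?thesis unfolding mul e i m_def[symmetric] E_def[symmetric] by (rule gTE)
    qed
    show ?thesis unfolding f1 f2 right_diff_distrib by linarith
  qed
  \<comment> \<open>The recursions lack two terms at \<open>k = 0\<close>. Continued to \<open>k = - 1\<close>, the closed forms make these cancel.\<close>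
  have boundary: "q powi (int n + 1) * ?s n (- 1) = - ?t n 0" for n
  proof -
    have s: "g n (int n + (- 1 + int h + 1)) = g n (int n - int h)"
      "g n (int n + (0 + int h + 1)) = g n (int n - int h - 1)"
      using gbin_symmetric[OF q, of "2 * n" "int n - int h"] gbin_symmetric[OF q, of "2 * n" "int n - int h - 1"]
      by (simp_all add: g_def algebra_simps del: gbin.simps)
    have i: "int n + (- 1 - int h) = int n - int h - 1" "int n + (0 - int h) = int n - int h" by simp_all
    have mul: "q powi c * (q powi e * x) = q powi (c + e) * x" for c e x by (simp add: pw)
    have e: "int n + 1 + ((- 1 - int h)\<^sup>2 + (- 1 - int h)) = (int h)\<^sup>2 + (int n + 1 + int h)"
      "int n + 1 + ((- 1 + int h)\<^sup>2 + 3 * - 1 + int h + 1) = (int h)\<^sup>2 + (int n - int h)"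
      "(0 - int h)\<^sup>2 = (int h)\<^sup>2" "(0 + int h)\<^sup>2 + 2 * 0 = (int h)\<^sup>2"
      by (simp_all add: power2_eq_square algebra_simps)
    have "g n (int n - int h - 1) + q powi (int n - int h) * g n (int n - int h)
        = q powi (int n + 1 + int h) * g n (int n - int h - 1) + g n (int n - int h)"
      using gbin_Suc'[OF q, of "2 * n" "int n - int h"] gbin.simps(2)[of q "2 * n" "int n - int h"]
      by (simp add: g_def algebra_simps del: gbin.simps)
    then have "x * (q powi (int n + 1 + int h) * g n (int n - int h - 1)) - x * (q powi (int n - int h) * g n (int n - int h))
        = - (x * g n (int n - int h) - x * g n (int n - int h - 1))" for x
      by (simp only: right_diff_distrib[symmetric] mult_minus_right[symmetric]) simp
    then show ?thesis unfolding right_diff_distrib mul e i s unfolding pw[of "(int h)\<^sup>2"] mult.assoc .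
  qed
  have main: "?S n k = ?s n (int k) \<and> ?T n k = ?t n (int k)" for k
  proof (induction n arbitrary: k)
    case 0
    have "g 0 j = (if j = 0 then 1 else 0)" for j by (simp add: g_def)
    then show ?case by (auto simp: word_sum_def words_0)
  next
    case (Suc n)
    note IH = conjunct1[OF Suc] conjunct2[OF Suc]
    have p: "q ^ (2 * Suc n) = q powi (2 * int n + 2)" "q ^ Suc n = q powi (int n + 1)" "q ^ n = q powi int n"
      "q ^ (2 * n + 1) = q powi (2 * int n + 1)" unfolding powi by (simp_all only: of_nat_mult of_nat_Suc of_nat_add of_nat_numeral of_nat_1 distrib_left add.commute mult_1_right)
    have k1: "int (Suc k) = int k + 1" for k by simp
    show ?case
    proof (cases "k = 0")
      case True
      have alg: "X * X * s + X * t = 0 \<and> X * s + t = 0" if "X * s = - t" for X s t :: real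
      proof -
        have "X * X * s + X * t = X * (X * s + t)" by (simp add: algebra_simps)
        then show ?thesis using that by simp
      qed
      have XX: "q powi (2 * int n + 2) = q powi (int n + 1) * q powi (int n + 1)" by (simp flip: pw)
      have m1: "(0 :: int) - 1 = - 1" by simp
      have z: "q powi (2 * int n + 2) * ?s n (0 - 1) + q powi (int n + 1) * ?t n 0 = 0"
          "q powi (int n + 1) * ?s n (0 - 1) + ?t n 0 = 0"
        unfolding XX m1 using alg[OF boundary[of n]] by (rule conjunct1, rule conjunct2)
      have S: "?S (Suc n) 0 = ?s n 0 + q powi int n * ?t n (0 + 1)"
        unfolding word_sum_recursion[of q h n 0] IH p k1 if_P[OF refl] of_nat_0 by simp
      have T: "?T (Suc n) 0 = q powi (int n + 1) * ?s n 0 + q powi (2 * int n + 1) * ?t n (0 + 1)"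
        unfolding word_sum_recursion[of q h n 0] IH p k1 if_P[OF refl] of_nat_0 by simp
      have cancel: "y = x" if "a + b = 0" "y = c + d" "x = a + b + c + d" for a b c d x y :: real
        using that by simp
      have "?S (Suc n) 0 = ?s (Suc n) 0" "?T (Suc n) 0 = ?t (Suc n) 0"
        by (rule cancel[OF z(1) S stepS[where n = n and k = 0]], rule cancel[OF z(2) T stepT[where n = n and k = 0]])
      then show ?thesis unfolding True of_nat_0 by (rule conjI)
    next
      case False
      then have k2: "int (k - 1) = int k - 1" by simp
      have "?S (Suc n) k = ?s (Suc n) (int k)"
        unfolding word_sum_recursion[of q h n k] IH p k1[of k] k2 if_not_P[OF False]
        by (rule stepS[symmetric])
      moreover have "?T (Suc n) k = ?t (Suc n) (int k)"
        unfolding word_sum_recursion[of q h n k] IH p k1[of k] k2 if_not_P[OF False]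
        by (rule stepT[symmetric])
      ultimately show ?thesis by (rule conjI)
    qed
  qed
  show "word_sum q h (False, False) n k =
      q powi ((int k - int h) ^ 2 + (int k - int h)) * g n (int n + (int k - int h))
      - q powi ((int k + int h) ^ 2 + 3 * int k + int h + 1) * g n (int n + (int k + int h + 1))"
    "word_sum q h (True, True) n k =
      q powi ((int k - int h) ^ 2) * g n (int n + (int k - int h))
      - q powi ((int k + int h) ^ 2 + 2 * int k) * g n (int n + (int k + int h + 1))"
    using main[of k] by (rule conjunct1, rule conjunct2)
qed

lemma word_weight_end:
  assumes "w \<in> words h n 0" shows "word_weight ((False, False) # w) = word_weight w"
proof (cases w)
  case (Cons x v)
  obtain a b where x: "x = (a, b)" by (cases x)
  have "\<not> a" using assms unfolding Cons x words_def by (cases b) auto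
  then show ?thesis using Cons x by (simp add: gap_descents_def)
qed simp

lemma sum_words:
  assumes q: "q > (0 :: real)"
  shows "(\<Sum>h\<le>n. \<Sum>w\<in>words h n 0. q ^ (word_weight w + h)) = gbin q (2 * n) (int n)"
proof -
  define G where "G = (\<lambda>h :: nat. q ^ (h * h) * gbin q (2 * n) (int n - int h))"
  have "(\<Sum>w\<in>words h n 0. q ^ (word_weight w + h)) = G h - G (Suc h)" for h
  proof -
    have "(\<Sum>w\<in>words h n 0. q ^ (word_weight w + h)) = (\<Sum>w\<in>words h n 0. q ^ h * q ^ word_weight ((False, False) # w))"
      by (rule sum.cong) (simp_all add: word_weight_end power_add)
    also have "\<dots> = q powi int h * word_sum q h (False, False) n 0"
      by (simp add: word_sum_def sum_distrib_left)
    also have "\<dots> = q powi int h * (q powi ((int 0 - int h) ^ 2 + (int 0 - int h)) * gbin q (2 * n) (int n + (int 0 - int h)))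
      - q powi int h * (q powi ((int 0 + int h) ^ 2 + 3 * int 0 + int h + 1) * gbin q (2 * n) (int n + (int 0 + int h + 1)))"
      unfolding word_sum_closed_form(1)[OF q] right_diff_distrib ..
    also have "\<dots> = q powi int (h * h) * gbin q (2 * n) (int n - int h) - q powi int (Suc h * Suc h) * gbin q (2 * n) (int n + int h + 1)"
    proof -
      have mul: "q powi c * (q powi e * x) = q powi (c + e) * x" for c e x using q by (simp add: power_int_add)
      have e: "int h + ((int 0 - int h) ^ 2 + (int 0 - int h)) = int (h * h)"
        "int h + ((int 0 + int h) ^ 2 + 3 * int 0 + int h + 1) = int (Suc h * Suc h)"
        by (simp_all add: power2_eq_square algebra_simps)
      have i: "int n + (int 0 - int h) = int n - int h" "int n + (int 0 + int h + 1) = int n + int h + 1" by simp_all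
      show ?thesis unfolding mul e i ..
    qed
    also have "gbin q (2 * n) (int n + int h + 1) = gbin q (2 * n) (int n - int (Suc h))"
      using gbin_symmetric[OF q, of "2 * n" "int n + int h + 1"] by (simp add: algebra_simps del: gbin.simps)
    finally show ?thesis unfolding G_def power_int_of_nat .
  qed
  then have "(\<Sum>h\<le>n. \<Sum>w\<in>words h n 0. q ^ (word_weight w + h)) = (\<Sum>h\<le>n. G h - G (Suc h))" by simp
  also have "\<dots> = G 0 - G (Suc n)" by (rule sum_telescope)
  also have "G (Suc n) = 0" unfolding G_def by (simp add: gbin_outside)
  finally show ?thesis by (simp add: G_def)
qed


section \<open>The total weight of the reversed noncrossing partitions\<close>

lemma word_weight_code:
  "word_weight (code n p) = (\<Sum>i\<in>{1..<n}. i * gap_descents (p i) (p (Suc i)))"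
proof (induction n)
  case (Suc n)
  then show ?case
  proof (cases n)
    case (Suc m)
    have "word_weight (code (Suc n) p) = word_weight (code n p) + n * gap_descents (p n) (p (Suc n))"
      using Suc by simp
    also have "\<dots> = (\<Sum>i\<in>{1..<Suc n}. i * gap_descents (p i) (p (Suc i)))"
      using Suc.IH Suc by (simp add: sum.atLeastLessThan_Suc)
    finally show ?thesis .
  qed simp
qed simp

text \<open>
  The descent at a gap is determined by the two letters next to it, both for the permutation and for its inverse.
\<close>

lemma half_perm_weight:
  assumes "\<sigma> \<in> half_perms n"
  shows "fmaj n \<sigma> + ifmaj n \<sigma> = 2 * (word_weight (code n (exceedance_letter \<sigma>)) + neg n \<sigma>)"
proof -
  obtain R F where R: "half_partition n R F" "\<sigma> = half_partition.perm n R F"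
    using assms unfolding half_perms_def by blast
  interpret half_partition n R F by fact
  have inv: "inv \<sigma> = iperm" unfolding R(2) by (rule inv_perm)
  have letter: "exceedance_letter \<sigma> i = (later (int i), earlier (int i) \<or> int i \<in> F)" if "i \<in> {1..n}" for i
    using exceedance_iff[of "int i"] inv_exceedance_iff[of "int i"] that
    unfolding exceedance_letter_def inv unfolding R(2) by simp
  have gap: "gap_descents (exceedance_letter \<sigma> i) (exceedance_letter \<sigma> (Suc i))
      = of_bool (\<sigma> (int i) > \<sigma> (int i + 1)) + of_bool (inv \<sigma> (int i) > inv \<sigma> (int i + 1))"
    if i: "i \<in> {1..<n}" for i
  proof -
    have r: "int i \<in> {1..int n}" "int i + 1 \<in> {1..int n}" "i \<in> {1..n}" "Suc i \<in> {1..n}" using i by auto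
    have e: "int (Suc i) = int i + 1" by simp
    show ?thesis
      unfolding letter[OF r(3)] letter[OF r(4)] e gap_descents_def fst_conv snd_conv inv
      unfolding R(2) descent_iff[OF r(1,2)] inv_descent_iff[OF r(1,2)] ..
  qed
  have des: "(\<Sum>i\<in>fDes n \<tau>. i) = (\<Sum>i\<in>{1..<n}. i * of_bool (\<tau> (int i) > \<tau> (int i + 1)))" for \<tau>
  proof -
    have "\<Sum> {i \<in> {1..<n}. \<tau> (int i) > \<tau> (int i + 1)} = (\<Sum>i\<in>{1..<n}. if \<tau> (int i) > \<tau> (int i + 1) then i else 0)"
      by (rule sum.inter_filter) simp
    also have "\<dots> = (\<Sum>i\<in>{1..<n}. i * of_bool (\<tau> (int i) > \<tau> (int i + 1)))"
      by (rule sum.cong) auto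
    finally show ?thesis unfolding sum_fDes_eq .
  qed
  have "word_weight (code n (exceedance_letter \<sigma>)) = (\<Sum>i\<in>fDes n \<sigma>. i) + (\<Sum>i\<in>fDes n (inv \<sigma>). i)"
    unfolding word_weight_code des sum.distrib[symmetric]
    by (rule sum.cong[OF refl]) (simp only: gap distrib_left)
  moreover have "neg n (inv \<sigma>) = neg n \<sigma>" using neg_inv perm_signed unfolding R(2) by blast
  ultimately show ?thesis unfolding fmaj_def ifmaj_def by simp
qed

lemma sum_half_perms:
  assumes x: "x > (0 :: real)"
  shows "(\<Sum>\<sigma>\<in>half_perms n. x ^ (fmaj n \<sigma> + ifmaj n \<sigma>)) = gbin (x\<^sup>2) (2 * n) (int n)"
proof -
  let ?code = "\<lambda>\<sigma>. code n (exceedance_letter \<sigma>)"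
  \<comment> \<open>The start height of a word is determined by its letters, as the word ends at height 0.\<close>
  define start where "start = (\<lambda>w. THE h. w \<in> words h n 0)"
  have start: "start w = h" if "w \<in> words h n 0" for w h
    unfolding start_def using that words_start_unique by (intro the_equality)
  define g where "g = (\<lambda>w. (x\<^sup>2) ^ (word_weight w + start w))"
  have signed: "\<sigma> \<in> signed_perms n" if "\<sigma> \<in> half_perms n" for \<sigma>
    using that half_partition.perm_signed unfolding half_perms_def by blast
  have "(\<Sum>\<sigma>\<in>half_perms n. x ^ (fmaj n \<sigma> + ifmaj n \<sigma>)) = (\<Sum>\<sigma>\<in>half_perms n. g (?code \<sigma>))"
  proof (rule sum.cong[OF refl])
    fix \<sigma> assume \<sigma>: "\<sigma> \<in> half_perms n"
    have "start (?code \<sigma>) = neg n \<sigma>" by (rule start[OF exceedance_word[OF signed[OF \<sigma>]]])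
    then show "x ^ (fmaj n \<sigma> + ifmaj n \<sigma>) = g (?code \<sigma>)"
      unfolding g_def half_perm_weight[OF \<sigma>] by (simp only: power_mult)
  qed
  also have "\<dots> = sum g (\<Union>h\<le>n. words h n 0)" by (rule sum.reindex_bij_betw[OF half_perms_words])
  also have "\<dots> = (\<Sum>h\<le>n. sum g (words h n 0))"
    by (rule sum.UNION_disjoint) (use words_start_unique in auto)
  also have "\<dots> = (\<Sum>h\<le>n. \<Sum>w\<in>words h n 0. (x\<^sup>2) ^ (word_weight w + h))"
    unfolding g_def using start by (intro sum.cong refl) simp
  also have "\<dots> = gbin (x\<^sup>2) (2 * n) (int n)" using x by (intro sum_words) simp
  finally show ?thesis .
qed

section \<open>From numbers to polynomials\<close>

lemma int_poly_eqI:
  fixes p q :: "int poly"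
  assumes "\<And>m. m > 0 \<Longrightarrow> poly p m = poly q m"
  shows "p = q"
proof (rule ccontr)
  assume "p \<noteq> q"
  then have "finite {m. poly (p - q) m = 0}" by (intro poly_roots_finite) simp
  moreover have "range (\<lambda>k. int (Suc k)) \<subseteq> {m. poly (p - q) m = 0}" using assms by auto
  ultimately have "finite (range (\<lambda>k. int (Suc k)))" by (rule finite_subset[rotated])
  moreover have "infinite (range (\<lambda>k. int (Suc k)))" by (rule range_inj_infinite) (simp add: inj_def)
  ultimately show False by blast
qed

lemma poly_q_fact: "real_of_int (poly (q_fact (monom 1 2) k) m) = q_fact ((real_of_int m)\<^sup>2) k"
  by (simp add: q_fact_def q_int_def poly_prod poly_sum poly_power poly_monom)

lemma poly_q_binomial:
  assumes "m > 0"
  shows "real_of_int (poly (q_binomial (monom 1 2) (2 * n) n) m) = gbin ((real_of_int m)\<^sup>2) (2 * n) (int n)"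
proof -
  let ?M = "monom (1 :: int) 2" and ?q = "(real_of_int m)\<^sup>2"
  have q: "?q > 0" using assms by simp
  have "q_fact ?M n * q_fact ?M n dvd q_fact ?M (2 * n)" using q_fact_dvd[of ?M n n] by (simp add: mult_2)
  then have "q_binomial ?M (2 * n) n * (q_fact ?M n * q_fact ?M n) = q_fact ?M (2 * n)"
    unfolding q_binomial_def by (simp add: mult_2)
  then have "real_of_int (poly (q_binomial ?M (2 * n) n * (q_fact ?M n * q_fact ?M n)) m)
      = real_of_int (poly (q_fact ?M (2 * n)) m)" by simp
  then have "real_of_int (poly (q_binomial ?M (2 * n) n) m) * (q_fact ?q n * q_fact ?q n) = q_fact ?q (2 * n)"
    by (simp only: poly_mult of_int_mult poly_q_fact)
  also have "\<dots> = gbin ?q (2 * n) (int n) * (q_fact ?q n * q_fact ?q n)"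
    using gbin_q_fact[OF q, of n "2 * n"] by (simp add: mult_2)
  finally show ?thesis using q_fact_pos[OF q, of n] by simp
qed

lemma sum_monom_eq_q_binomial:
  assumes "\<And>x :: real. x > 0 \<Longrightarrow> (\<Sum>\<sigma>\<in>A. x ^ w \<sigma>) = gbin (x\<^sup>2) (2 * n) (int n)"
  shows "(\<Sum>\<sigma>\<in>A. monom (1 :: int) (w \<sigma>)) = q_binomial (monom 1 2) (2 * n) n"
proof (rule int_poly_eqI)
  fix m :: int assume m: "m > 0"
  have "real_of_int (poly (\<Sum>\<sigma>\<in>A. monom 1 (w \<sigma>)) m) = (\<Sum>\<sigma>\<in>A. (real_of_int m) ^ w \<sigma>)"
    by (simp add: poly_sum poly_monom)
  also have "\<dots> = real_of_int (poly (q_binomial (monom 1 2) (2 * n) n) m)"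
    using assms[of "real_of_int m"] poly_q_binomial[OF m] m by simp
  finally show "poly (\<Sum>\<sigma>\<in>A. monom 1 (w \<sigma>)) m = poly (q_binomial (monom 1 2) (2 * n) n) m"
    by (simp only: of_int_eq_iff)
qed

theorem corollary1p4:
  fixes n :: nat
  assumes "n \<ge> 1"
  shows "(\<Sum>\<sigma>\<in>rev_neg n ` NC_B n. monom (1::int) (fmaj n \<sigma> + ifmaj n \<sigma>))
           = (\<Sum>\<sigma>\<in>Sort_B n. monom 1 (fmaj n \<sigma> + ifmaj n \<sigma>))
       \<and> (\<Sum>\<sigma>\<in>Sort_B n. monom (1::int) (fmaj n \<sigma> + ifmaj n \<sigma>))
           = q_binomial (monom 1 2) (2 * n) n"
proof -
  have "(\<Sum>\<sigma>\<in>rev_neg n ` NC_B n. monom (1::int) (fmaj n \<sigma> + ifmaj n \<sigma>)) = q_binomial (monom 1 2) (2 * n) n"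
    unfolding rev_NC_B by (rule sum_monom_eq_q_binomial[OF sum_half_perms])
  moreover have "(\<Sum>\<sigma>\<in>Sort_B n. monom (1::int) (fmaj n \<sigma> + ifmaj n \<sigma>)) = q_binomial (monom 1 2) (2 * n) n"
    by (rule sum_monom_eq_q_binomial[OF sum_Sort_B[OF assms]])
  ultimately show ?thesis by simp
qed

end
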